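(* Let $M$ be a smooth Riemannian manifold of dimension $2$ or $3$ and let $\Delta$ be a continuous corank-1 distribution on $M$. If $\Delta$ is asymptotically involutive on average, then $\Delta$ is integrable. If $\Delta$ is uniformly asymptotically involutive on average, then $\Delta$ is uniquely integrable.
   Context: A corank-1 distribution $\Delta$ on an $n$-dimensional manifold $M$ is a choice of an $(n-1)$-dimensional subspace $\Delta_p\subset T_pM$ for each $p\in M$. A (local) integral manifold is a submanifold $N$ with $T_pN=\Delta_p$ for all $p\in N$. $\Delta$ is integrable if there is a (local) integral manifold through every point, and uniquely integrable if moreover it is unique as a local object (any two integral manifolds through $p$ coincide near $p$). Locally $\Delta=\ker(\eta)$ for a continuous nowhere vanishing 1-form $\eta$. $\|\cdot\|_x$ denotes the norm at the point $x$ induced by the Riemannian metric; convergence of sequences is in the $C^0$ topology. Dimension 3. Let $(x^1,x^2,x^3)$ be local coordinates on a neighbourhood $\mathcal U$ of $x_0$ such that $\Delta=\ker(\eta)$ is everywhere transversal to $\partial/\partial x^3$ on $\mathcal U$. Let $\eta_k$ be $C^1$ 1-forms on $\mathcal U$ with $\eta_k\to\eta$, and write $$d\eta_k=d\eta_{k,1}\,dx^1\wedge dx^3+d\eta_{k,2}\,dx^2\wedge dx^3+d\eta_{k,3}\,dx^1\wedge dx^2$$ with coefficient functions $d\eta_{k,i}$. For $k$ large, $\Delta_k=\ker(\eta_k)$ is transversal to $\partial/\partial x^3$ and is spanned by unique $C^1$ vector fields of the form $X_k=\frac{\partial}{\partial x^1}+a_k\frac{\partial}{\partial x^3}$, $Y_k=\frac{\partial}{\partial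 x^2}+b_k\frac{\partial}{\partial x^3}$. Let $e^{\tau X_k},e^{\tau Y_k}$ be their flows. For a smaller neighbourhood $\mathcal U'\subset\mathcal U$ of $x_0$ choose $t_0>0$ such that $e^{\tau X_k}(x),e^{\tau Y_k}(x)$ are defined and lie in $\mathcal U$ for all $x\in\mathcal U'$, $|\tau|\le t_0$ (and all large $k$). For $x\in\mathcal U'$, $|t|\le t_0$ set $$\widetilde{d\eta}_{k,1}(x,t)=\int_0^t d\eta_{k,1}(e^{\tau X_k}(x))\,d\tau,\qquad \widetilde{d\eta}_{k,2}(x,t)=\int_0^t d\eta_{k,2}(e^{\tau Y_k}(x))\,d\tau,$$ $$\widetilde{d\eta}_k(x,t)=\max\{\widetilde{d\eta}_{k,1}(x,t),\widetilde{d\eta}_{k,2}(x,t)\}.$$ Dimension 2. With coordinates $(x^1,x^2)$ and $\Delta$ transversal to $\partial/\partial x^2$, $\Delta_k$ is spanned by the single vector field $X_k=\frac{\partial}{\partial x^1}+a_k\frac{\partial}{\partial x^2}$, one writes $d\eta_k=d\eta_{k,1}\,dx^1\wedge dx^2$, and $\widetilde{d\eta}_k(x,t)=\int_0^t d\eta_{k,1}(e^{\tau X_k}(x))\,d\tau$; everything else is the same. Definition. $\Delta=\ker(\eta)$ is asymptotically involutive on average if for every $x_0\in M$ there exist local coordinates on a neighbourhood $\mathcal U$ of $x_0$ in which $\Delta$ is everywhere transversal to the last coordinate direction ($\partial/\partial x^3$ in dimension 3, $\partial/\partial x^2$ in dimension 2), a sequence of $C^1$ 1-forms $\eta_k\to\eta$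 on $\mathcal U$ with the corresponding $\Delta_k=\ker(\eta_k)$ and frames $\{X_k,Y_k\}$ (or $\{X_k\}$ in dimension 2), a neighbourhood $\mathcal U'\subset\mathcal U$ of $x_0$ and $t_0>0$ such that for all large $k$ the flows $e^{\tau X_k}(x)$, $e^{\tau Y_k}(x)$ (only $e^{\tau X_k}(x)$ in dimension 2) are defined and lie in $\mathcal U$ for all $x\in\mathcal U'$, $|\tau|\le t_0$, and such that, as $k\to\infty$, $$\|\eta_k\wedge d\eta_k\|_x\,e^{\widetilde{d\eta}_k(x,t)}\to 0\quad\text{for }x\in\mathcal U',\ |t|\le t_0,$$ uniformly in $(x,t)$. It is uniformly asymptotically involutive on average if moreover (for the same data) $$\|\eta_k-\eta\|_x\,e^{\widetilde{d\eta}_k(x,t)}\to 0\quad\text{for }x\in\mathcal U',\ |t|\le t_0,$$ uniformly in $(x,t)$.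
   Formalization: The approximating forms η_k are required to be normalised, η_k(∂/∂x^n)=1 in the last coordinate; without this the statement is false, e.g. η=ε(dy−√|y|dx), η_k=ε(dy−(y²+δ_k²)^{1/4}dx), 0<ε<1, δ_k→0, in dimension 2. *)

theory Defs
  imports "HOL-Analysis.Analysis"
begin

section \<open>Differentiability classes\<close>

text \<open>Intended for open sets: all iterated directional derivatives of order \<open>\<le> k\<close> are continuous, and
  those of order \<open>< k\<close> are (totally) differentiable.\<close>

fun Ck_on :: "nat \<Rightarrow> ('a::euclidean_space \<Rightarrow> 'b::real_normed_vector) \<Rightarrow> 'a set \<Rightarrow> bool" where
  "Ck_on 0 f S \<longleftrightarrow> continuous_on S f"
| "Ck_on (Suc k) f S \<longleftrightarrow>
     (\<forall>x\<in>S. f differentiable (at x)) \<and> (\<forall>v. Ck_on k (\<lambda>x. frechet_derivative f (at x) v) S)"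

definition smooth_on :: "('a::euclidean_space \<Rightarrow> 'b::real_normed_vector) \<Rightarrow> 'a set \<Rightarrow> bool" where
  "smooth_on f S \<longleftrightarrow> (\<forall>k. Ck_on k f S)"

definition C1_diffeo_on :: "('a::euclidean_space \<Rightarrow> 'a) \<Rightarrow> 'a set \<Rightarrow> bool" where
  "C1_diffeo_on \<psi> V \<longleftrightarrow>
     open V \<and> open (\<psi> ` V) \<and> inj_on \<psi> V \<and> Ck_on 1 \<psi> V \<and> Ck_on 1 (inv_into V \<psi>) (\<psi> ` V)"


section \<open>Smooth manifolds, tangent vectors, Riemannian metrics\<close>

text \<open>A chart is a pair of its domain and its coordinate map; the values of the coordinate map
  outside the domain are irrelevant.\<close>

type_synonym ('a, 'n) chart = "'a set \<times> ('a \<Rightarrow> real^'n)"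

definition is_chart :: "'a topology \<Rightarrow> ('a, 'n::finite) chart \<Rightarrow> bool" where
  "is_chart M c \<longleftrightarrow>
     openin M (fst c) \<and> open (snd c ` fst c) \<and>
     homeomorphic_map (subtopology M (fst c)) (top_of_set (snd c ` fst c)) (snd c)"

definition chart_image :: "('a, 'n) chart \<Rightarrow> (real^'n) set" where
  "chart_image c = snd c ` fst c"

definition chart_inv :: "('a, 'n) chart \<Rightarrow> real^'n \<Rightarrow> 'a" where
  "chart_inv c = inv_into (fst c) (snd c)"

definition transition :: "('a, 'n) chart \<Rightarrow> ('a, 'n) chart \<Rightarrow> real^'n \<Rightarrow> real^'n" where
  "transition c d = snd d \<circ> chart_inv c"

definition compatible :: "('a, 'n::finite) chart \<Rightarrow> ('a, 'n) chart \<Rightarrow> bool" where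
  "compatible c d \<longleftrightarrow>
     smooth_on (transition c d) (snd c ` (fst c \<inter> fst d)) \<and>
     smooth_on (transition d c) (snd d ` (fst c \<inter> fst d))"

text \<open>\<open>A\<close> is the maximal atlas, so that "local coordinates" are exactly the elements of \<open>A\<close>.\<close>

definition smooth_manifold :: "'a topology \<Rightarrow> ('a, 'n::finite) chart set \<Rightarrow> bool" where
  "smooth_manifold M A \<longleftrightarrow>
     Hausdorff_space M \<and> second_countable M \<and>
     (\<forall>c\<in>A. is_chart M c) \<and>
     (\<Union>c\<in>A. fst c) = topspace M \<and>
     (\<forall>c\<in>A. \<forall>d\<in>A. compatible c d) \<and>
     (\<forall>c. is_chart M c \<and> (\<forall>d\<in>A. compatible c d) \<longrightarrow> c \<in> A)"

text \<open>A tangent vector at \<open>p\<close> is the family of its coordinate expressions in all charts around \<open>p\<close>,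
  related by the derivatives of the coordinate changes. The value \<open>0\<close> at all other charts is a
  dummy value making the representation unique.\<close>

type_synonym ('a, 'n) tvec = "('a, 'n) chart \<Rightarrow> real^'n"

definition tangent_space ::
  "('a, 'n::finite) chart set \<Rightarrow> 'a \<Rightarrow> ('a, 'n) tvec set" where
  "tangent_space A p =
     {v. (\<forall>c\<in>A. \<forall>d\<in>A. p \<in> fst c \<and> p \<in> fst d \<longrightarrow>
            v d = frechet_derivative (transition c d) (at (snd c p)) (v c)) \<and>
         (\<forall>c. \<not> (c \<in> A \<and> p \<in> fst c) \<longrightarrow> v c = 0)}"

text \<open>The tangent vector at \<open>p\<close> with components \<open>u\<close> in the chart \<open>c\<close>.\<close>

definition coord_vec ::
  "('a, 'n::finite) chart set \<Rightarrow> ('a, 'n) chart \<Rightarrow> 'a \<Rightarrow> real^'n \<Rightarrow> ('a, 'n) tvec" where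
  "coord_vec A c p u =
     (\<lambda>d. if d \<in> A \<and> p \<in> fst d then frechet_derivative (transition c d) (at (snd c p)) u else 0)"

definition metric_coord ::
  "('a, 'n::finite) chart set \<Rightarrow> ('a \<Rightarrow> ('a, 'n) tvec \<Rightarrow> ('a, 'n) tvec \<Rightarrow> real)
    \<Rightarrow> ('a, 'n) chart \<Rightarrow> real^'n \<Rightarrow> real^'n \<Rightarrow> real^'n \<Rightarrow> real" where
  "metric_coord A g c x u v =
     g (chart_inv c x) (coord_vec A c (chart_inv c x) u) (coord_vec A c (chart_inv c x) v)"

definition riemannian_metric ::
  "('a, 'n::finite) chart set \<Rightarrow> ('a \<Rightarrow> ('a, 'n) tvec \<Rightarrow> ('a, 'n) tvec \<Rightarrow> real) \<Rightarrow> bool" where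
  "riemannian_metric A g \<longleftrightarrow>
     (\<forall>c\<in>A.
        (\<forall>x\<in>chart_image c.
           bilinear (metric_coord A g c x) \<and>
           (\<forall>u v. metric_coord A g c x u v = metric_coord A g c x v u) \<and>
           (\<forall>u. u \<noteq> 0 \<longrightarrow> metric_coord A g c x u u > 0)) \<and>
        (\<forall>u v. smooth_on (\<lambda>x. metric_coord A g c x u v) (chart_image c)))"


section \<open>Distributions and integral manifolds\<close>

definition corank1_distribution ::
  "'a topology \<Rightarrow> ('a, 'n::finite) chart set \<Rightarrow> ('a \<Rightarrow> ('a, 'n) tvec set) \<Rightarrow> bool" where
  "corank1_distribution M A \<Delta> \<longleftrightarrow>
     (\<forall>p\<in>topspace M.
        \<Delta> p \<subseteq> tangent_space A p \<and>
        (\<forall>c\<in>A. p \<in> fst c \<longrightarrow>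
           subspace ((\<lambda>v. v c) ` \<Delta> p) \<and> dim ((\<lambda>v. v c) ` \<Delta> p) = CARD('n) - 1))"

text \<open>1-forms on the domain of a chart are given by their vector of coefficients, as functions on
  the image of the chart: \<open>\<eta> x $ i\<close> is the coefficient of \<open>dx\<^sup>i\<close>, and \<open>\<eta> x \<bullet> u\<close> is the
  value on the vector with components \<open>u\<close>.\<close>

definition is_kernel_on ::
  "('a, 'n::finite) chart set \<Rightarrow> ('a, 'n) chart \<Rightarrow> (real^'n \<Rightarrow> real^'n)
    \<Rightarrow> ('a \<Rightarrow> ('a, 'n) tvec set) \<Rightarrow> bool" where
  "is_kernel_on A c \<eta> \<Delta> \<longleftrightarrow>
     (\<forall>p\<in>fst c. \<Delta> p = {v \<in> tangent_space A p. \<eta> (snd c p) \<bullet> v c = 0})"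

definition local_defining_form ::
  "('a, 'n::finite) chart set \<Rightarrow> ('a, 'n) chart \<Rightarrow> (real^'n \<Rightarrow> real^'n)
    \<Rightarrow> ('a \<Rightarrow> ('a, 'n) tvec set) \<Rightarrow> bool" where
  "local_defining_form A c \<eta> \<Delta> \<longleftrightarrow>
     continuous_on (chart_image c) \<eta> \<and> (\<forall>x\<in>chart_image c. \<eta> x \<noteq> 0) \<and> is_kernel_on A c \<eta> \<Delta>"

definition continuous_corank1_distribution ::
  "'a topology \<Rightarrow> ('a, 'n::finite) chart set \<Rightarrow> ('a \<Rightarrow> ('a, 'n) tvec set) \<Rightarrow> bool" where
  "continuous_corank1_distribution M A \<Delta> \<longleftrightarrow>
     corank1_distribution M A \<Delta> \<and>
     (\<forall>p\<in>topspace M. \<exists>c\<in>A. p \<in> fst c \<and> (\<exists>\<eta>. local_defining_form A c \<eta> \<Delta>))"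

text \<open>Embedded \<open>C\<^sup>1\<close> submanifolds of dimension \<open>m\<close>, by means of slice charts of class \<open>C\<^sup>1\<close>.\<close>

definition C1_submanifold ::
  "'a topology \<Rightarrow> ('a, 'n::finite) chart set \<Rightarrow> nat \<Rightarrow> 'a set \<Rightarrow> bool" where
  "C1_submanifold M A m N \<longleftrightarrow>
     N \<subseteq> topspace M \<and>
     (\<forall>p\<in>N. \<exists>c\<in>A. p \<in> fst c \<and>
        (\<exists>\<psi> S. C1_diffeo_on \<psi> (chart_image c) \<and> subspace S \<and> dim S = m \<and>
               \<psi> ` (snd c ` (N \<inter> fst c)) = S \<inter> \<psi> ` chart_image c))"

text \<open>The tangent space of a submanifold consists of the velocities of the curves in it.\<close>

definition submanifold_tangent_space ::
  "'a topology \<Rightarrow> ('a, 'n::finite) chart set \<Rightarrow> 'a set \<Rightarrow> 'a \<Rightarrow> ('a, 'n) tvec set" where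
  "submanifold_tangent_space M A N p =
     {v \<in> tangent_space A p.
        \<exists>\<gamma> \<epsilon>. \<epsilon> > 0 \<and> \<gamma> 0 = p \<and> \<gamma> ` {-\<epsilon><..<\<epsilon>} \<subseteq> N \<and>
              continuous_map (top_of_set {-\<epsilon><..<\<epsilon>}) M \<gamma> \<and>
              (\<forall>c\<in>A. p \<in> fst c \<longrightarrow> ((\<lambda>t. snd c (\<gamma> t)) has_vector_derivative v c) (at 0))}"

definition integral_manifold ::
  "'a topology \<Rightarrow> ('a, 'n::finite) chart set \<Rightarrow> ('a \<Rightarrow> ('a, 'n) tvec set) \<Rightarrow> 'a set \<Rightarrow> bool" where
  "integral_manifold M A \<Delta> N \<longleftrightarrow>
     C1_submanifold M A (CARD('n) - 1) N \<and> (\<forall>p\<in>N. submanifold_tangent_space M A N p = \<Delta> p)"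

definition integrable_distribution ::
  "'a topology \<Rightarrow> ('a, 'n::finite) chart set \<Rightarrow> ('a \<Rightarrow> ('a, 'n) tvec set) \<Rightarrow> bool" where
  "integrable_distribution M A \<Delta> \<longleftrightarrow>
     (\<forall>p\<in>topspace M. \<exists>N. integral_manifold M A \<Delta> N \<and> p \<in> N)"

definition uniquely_integrable_distribution ::
  "'a topology \<Rightarrow> ('a, 'n::finite) chart set \<Rightarrow> ('a \<Rightarrow> ('a, 'n) tvec set) \<Rightarrow> bool" where
  "uniquely_integrable_distribution M A \<Delta> \<longleftrightarrow>
     integrable_distribution M A \<Delta> \<and>
     (\<forall>p\<in>topspace M. \<forall>N N'.
        integral_manifold M A \<Delta> N \<and> p \<in> N \<and> integral_manifold M A \<Delta> N' \<and> p \<in> N' \<longrightarrow>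
        (\<exists>W. openin M W \<and> p \<in> W \<and> N \<inter> W = N' \<inter> W))"


section \<open>Differential forms in coordinates\<close>

definition ext_deriv :: "(real^'n \<Rightarrow> real^'n) \<Rightarrow> real^'n \<Rightarrow> real^'n \<Rightarrow> real^'n::finite \<Rightarrow> real" where
  "ext_deriv \<eta> x u v =
     frechet_derivative \<eta> (at x) u \<bullet> v - frechet_derivative \<eta> (at x) v \<bullet> u"

text \<open>The coefficient of \<open>dx\<^sup>i \<and> dx\<^sup>j\<close> in \<open>d\<eta>\<close>.\<close>

definition ext_deriv_coeff :: "(real^'n \<Rightarrow> real^'n) \<Rightarrow> 'n::finite \<Rightarrow> 'n \<Rightarrow> real^'n \<Rightarrow> real" where
  "ext_deriv_coeff \<eta> i j x = ext_deriv \<eta> x (axis i 1) (axis j 1)"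

definition wedge_ext_deriv ::
  "(real^'n \<Rightarrow> real^'n) \<Rightarrow> real^'n \<Rightarrow> real^'n \<Rightarrow> real^'n \<Rightarrow> real^'n::finite \<Rightarrow> real" where
  "wedge_ext_deriv \<eta> x u v w =
     (\<eta> x \<bullet> u) * ext_deriv \<eta> x v w + (\<eta> x \<bullet> v) * ext_deriv \<eta> x w u + (\<eta> x \<bullet> w) * ext_deriv \<eta> x u v"

text \<open>Norms of alternating forms induced by an inner product \<open>G\<close>. For 1-forms and for forms of top
  degree (the only cases in which they are used, apart from the form \<open>0\<close>) these operator norms
  coincide with the norms given by the induced inner product on forms.\<close>

definition norm_1form :: "(real^'n \<Rightarrow> real^'n \<Rightarrow> real) \<Rightarrow> real^'n::finite \<Rightarrow> real" where
  "norm_1form G \<alpha> = Sup {\<bar>\<alpha> \<bullet> u\<bar> | u. G u u \<le> 1}"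

definition norm_3form ::
  "(real^'n \<Rightarrow> real^'n \<Rightarrow> real) \<Rightarrow> (real^'n \<Rightarrow> real^'n \<Rightarrow> real^'n::finite \<Rightarrow> real) \<Rightarrow> real" where
  "norm_3form G \<omega> = Sup {\<bar>\<omega> u v w\<bar> | u v w. G u u \<le> 1 \<and> G v v \<le> 1 \<and> G w w \<le> 1}"


section \<open>Asymptotic involutivity on average\<close>

text \<open>Throughout, \<open>l\<close> is the index of the last coordinate. The remaining indices \<open>i \<noteq> l\<close> play the
  role of \<open>1, 2\<close> in dimension 3, and of \<open>1\<close> in dimension 2.\<close>

definition transversal_to_coord ::
  "('a, 'n::finite) chart set \<Rightarrow> ('a, 'n) chart \<Rightarrow> 'n \<Rightarrow> ('a \<Rightarrow> ('a, 'n) tvec set) \<Rightarrow> bool" where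
  "transversal_to_coord A c l \<Delta> \<longleftrightarrow> (\<forall>p\<in>fst c. coord_vec A c p (axis l 1) \<notin> \<Delta> p)"

text \<open>The unique vector field of the form \<open>\<partial>/\<partial>x\<^sup>i + a \<partial>/\<partial>x\<^sup>l\<close> in the kernel of \<open>\<eta>\<close>: \<open>X\<close> for
  \<open>i = 1\<close>, \<open>Y\<close> for \<open>i = 2\<close>.\<close>

definition frame_field :: "'n \<Rightarrow> (real^'n \<Rightarrow> real^'n) \<Rightarrow> 'n \<Rightarrow> real^'n \<Rightarrow> real^'n::finite" where
  "frame_field l \<eta> i x = axis i 1 - (\<eta> x $ i / \<eta> x $ l) *\<^sub>R axis l 1"

text \<open>\<open>F \<tau> x\<close> is the flow of \<open>X\<close>, defined and staying in \<open>V\<close> for \<open>x \<in> V'\<close> and \<open>\<bar>\<tau>\<bar> \<le> t0\<close>.\<close>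

definition is_flow ::
  "('b::real_normed_vector \<Rightarrow> 'b) \<Rightarrow> 'b set \<Rightarrow> 'b set \<Rightarrow> real \<Rightarrow> (real \<Rightarrow> 'b \<Rightarrow> 'b) \<Rightarrow> bool" where
  "is_flow X V V' t0 F \<longleftrightarrow>
     (\<forall>x\<in>V'. F 0 x = x \<and>
        (\<forall>\<tau>\<in>{-t0..t0}. F \<tau> x \<in> V \<and>
           ((\<lambda>s. F s x) has_vector_derivative X (F \<tau> x)) (at \<tau> within {-t0..t0})))"

text \<open>The integral is oriented: for \<open>t < 0\<close> it is minus the integral over \<open>[t, 0]\<close>. Here \<open>F i\<close> is the
  flow of the frame field with index \<open>i\<close>.\<close>

definition averaged_coeff ::
  "'n \<Rightarrow> (real^'n \<Rightarrow> real^'n) \<Rightarrow> ('n::finite \<Rightarrow> real \<Rightarrow> real^'n \<Rightarrow> real^'n)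
    \<Rightarrow> 'n \<Rightarrow> real^'n \<Rightarrow> real \<Rightarrow> real" where
  "averaged_coeff l \<eta> F i x t = (LBINT \<tau>=ereal 0..ereal t. ext_deriv_coeff \<eta> i l (F i \<tau> x))"

definition averaged_ext_deriv ::
  "'n \<Rightarrow> (real^'n \<Rightarrow> real^'n) \<Rightarrow> ('n::finite \<Rightarrow> real \<Rightarrow> real^'n \<Rightarrow> real^'n)
    \<Rightarrow> real^'n \<Rightarrow> real \<Rightarrow> real" where
  "averaged_ext_deriv l \<eta> F x t = Max ((\<lambda>i. averaged_coeff l \<eta> F i x t) ` (UNIV - {l}))"

text \<open>Since a form is determined by its kernel only up to a nonvanishing factor, a representative has
  to be fixed: like the frame fields, the approximating forms are normalised in the last coordinate,
  \<open>\<eta>\<^sub>k(\<partial>/\<partial>x\<^sup>l) = 1\<close>. The factor is not harmless. Multiplying \<open>\<eta>\<^sub>k\<close> by a constant \<open>\<epsilon>\<close>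
  multiplies the exponents \<open>averaged_ext_deriv\<close> by \<open>\<epsilon>\<close>, and without the normalisation
  \<open>\<eta> = \<epsilon> (dy - \<bar>y\<bar>\<^sup>1\<^sup>/\<^sup>2 dx)\<close> with \<open>0 < \<epsilon> < 1\<close>, approximated by
  \<open>\<epsilon> (dy - (y\<^sup>2 + \<delta>\<^sup>2)\<^sup>1\<^sup>/\<^sup>4 dx)\<close> as \<open>\<delta> \<rightarrow> 0\<close>, would be uniformly asymptotically involutive on
  average although it is not uniquely integrable.\<close>

definition approximation_data ::
  "('a, 'n::finite) chart set \<Rightarrow> ('a \<Rightarrow> ('a, 'n) tvec \<Rightarrow> ('a, 'n) tvec \<Rightarrow> real) \<Rightarrow> 'n
    \<Rightarrow> ('a \<Rightarrow> ('a, 'n) tvec set) \<Rightarrow> 'a \<Rightarrow> ('a, 'n) chart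
    \<Rightarrow> (real^'n \<Rightarrow> real^'n) \<Rightarrow> (nat \<Rightarrow> real^'n \<Rightarrow> real^'n) \<Rightarrow> (real^'n) set \<Rightarrow> real
    \<Rightarrow> (nat \<Rightarrow> 'n \<Rightarrow> real \<Rightarrow> real^'n \<Rightarrow> real^'n) \<Rightarrow> bool" where
  "approximation_data A g l \<Delta> x0 c \<eta> \<eta>s V' t0 F \<longleftrightarrow>
     c \<in> A \<and> x0 \<in> fst c \<and>
     local_defining_form A c \<eta> \<Delta> \<and>
     transversal_to_coord A c l \<Delta> \<and>
     (\<forall>k. Ck_on 1 (\<eta>s k) (chart_image c)) \<and>
     (\<forall>k. \<forall>x\<in>chart_image c. \<eta>s k x $ l = 1) \<and>
     uniform_limit (chart_image c)
       (\<lambda>k x. norm_1form (metric_coord A g c x) (\<eta>s k x - \<eta> x)) (\<lambda>_. 0) sequentially \<and>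
     open V' \<and> snd c x0 \<in> V' \<and> V' \<subseteq> chart_image c \<and> t0 > 0 \<and>
     (\<forall>\<^sub>F k in sequentially. \<forall>i. i \<noteq> l \<longrightarrow>
        is_flow (frame_field l (\<eta>s k) i) (chart_image c) V' t0 (F k i))"

definition involutive_limit ::
  "('a, 'n::finite) chart set \<Rightarrow> ('a \<Rightarrow> ('a, 'n) tvec \<Rightarrow> ('a, 'n) tvec \<Rightarrow> real) \<Rightarrow> 'n
    \<Rightarrow> ('a, 'n) chart \<Rightarrow> (nat \<Rightarrow> real^'n \<Rightarrow> real^'n) \<Rightarrow> (real^'n) set \<Rightarrow> real
    \<Rightarrow> (nat \<Rightarrow> 'n \<Rightarrow> real \<Rightarrow> real^'n \<Rightarrow> real^'n) \<Rightarrow> bool" where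
  "involutive_limit A g l c \<eta>s V' t0 F \<longleftrightarrow>
     uniform_limit (V' \<times> {-t0..t0})
       (\<lambda>k (x, t). norm_3form (metric_coord A g c x) (wedge_ext_deriv (\<eta>s k) x)
                    * exp (averaged_ext_deriv l (\<eta>s k) (F k) x t))
       (\<lambda>_. 0) sequentially"

definition uniform_approximation_limit ::
  "('a, 'n::finite) chart set \<Rightarrow> ('a \<Rightarrow> ('a, 'n) tvec \<Rightarrow> ('a, 'n) tvec \<Rightarrow> real) \<Rightarrow> 'n
    \<Rightarrow> ('a, 'n) chart \<Rightarrow> (real^'n \<Rightarrow> real^'n) \<Rightarrow> (nat \<Rightarrow> real^'n \<Rightarrow> real^'n)
    \<Rightarrow> (real^'n) set \<Rightarrow> real \<Rightarrow> (nat \<Rightarrow> 'n \<Rightarrow> real \<Rightarrow> real^'n \<Rightarrow> real^'n) \<Rightarrow> bool" where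
  "uniform_approximation_limit A g l c \<eta> \<eta>s V' t0 F \<longleftrightarrow>
     uniform_limit (V' \<times> {-t0..t0})
       (\<lambda>k (x, t). norm_1form (metric_coord A g c x) (\<eta>s k x - \<eta> x)
                    * exp (averaged_ext_deriv l (\<eta>s k) (F k) x t))
       (\<lambda>_. 0) sequentially"

definition asymp_involutive_on_average ::
  "'a topology \<Rightarrow> ('a, 'n::finite) chart set \<Rightarrow> ('a \<Rightarrow> ('a, 'n) tvec \<Rightarrow> ('a, 'n) tvec \<Rightarrow> real)
    \<Rightarrow> 'n \<Rightarrow> ('a \<Rightarrow> ('a, 'n) tvec set) \<Rightarrow> bool" where
  "asymp_involutive_on_average M A g l \<Delta> \<longleftrightarrow>
     (\<forall>x0\<in>topspace M. \<exists>c \<eta> \<eta>s V' t0 F.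
        approximation_data A g l \<Delta> x0 c \<eta> \<eta>s V' t0 F \<and>
        involutive_limit A g l c \<eta>s V' t0 F)"

definition unif_asymp_involutive_on_average ::
  "'a topology \<Rightarrow> ('a, 'n::finite) chart set \<Rightarrow> ('a \<Rightarrow> ('a, 'n) tvec \<Rightarrow> ('a, 'n) tvec \<Rightarrow> real)
    \<Rightarrow> 'n \<Rightarrow> ('a \<Rightarrow> ('a, 'n) tvec set) \<Rightarrow> bool" where
  "unif_asymp_involutive_on_average M A g l \<Delta> \<longleftrightarrow>
     (\<forall>x0\<in>topspace M. \<exists>c \<eta> \<eta>s V' t0 F.
        approximation_data A g l \<Delta> x0 c \<eta> \<eta>s V' t0 F \<and>
        involutive_limit A g l c \<eta>s V' t0 F \<and>
        uniform_approximation_limit A g l c \<eta> \<eta>s V' t0 F)"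

end

theory Submission
  imports Defs "HOL-Complex_Analysis.Great_Picard"
begin

text \<open>Let \<open>a\<^sub>i = - \<eta>\<^sub>k(\<partial>/\<partial>x\<^sup>i)\<close> and \<open>X\<^sub>i = \<partial>/\<partial>x\<^sup>i + a\<^sub>i \<partial>/\<partial>x\<^sup>l\<close>, call the direction \<open>\<partial>/\<partial>x\<^sup>l\<close> vertical, and
  write \<open>F\<^sub>i\<close> for the flow of \<open>X\<^sub>i\<close>. As \<open>\<eta>\<^sub>k\<close> is normalised in the last coordinate, the coefficient of
  \<open>dx\<^sup>i \<and> dx\<^sup>l\<close> in \<open>d\<eta>\<^sub>k\<close> is \<open>\<partial>a\<^sub>i/\<partial>x\<^sup>l\<close>. Its integral along a flow line is the logarithm of the factor
  by which \<open>F\<^sub>i\<close> stretches vertical vectors (lemma \<open>vertical_variation\<close>). So the two hypotheses say that a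
  vertical vector of size \<open>\<parallel>\<eta>\<^sub>k \<and> d\<eta>\<^sub>k\<parallel>\<close>, respectively \<open>\<parallel>\<eta>\<^sub>k - \<eta>\<parallel>\<close>, stays small when the flows transport it
  for a time of at most \<open>t\<^sub>0\<close>, although the derivatives of the flows need not be bounded as \<open>k \<rightarrow> \<infinity>\<close>.

  Existence. The bracket of \<open>X\<^sub>i\<close> and \<open>X\<^sub>j\<close> is vertical and of size \<open>\<bar>d\<eta>\<^sub>k(X\<^sub>i, X\<^sub>j)\<bar>\<close>, which is bounded by a multiple
  of \<open>\<parallel>\<eta>\<^sub>k \<and> d\<eta>\<^sub>k\<parallel>\<close>. The surface \<open>W(s, t) = F\<^sub>j(t, F\<^sub>i(s, x\<^sub>0))\<close> is tangent to \<open>X\<^sub>j\<close>, and its derivative in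
  \<open>s\<close> differs from \<open>X\<^sub>i\<close> by the integral over \<open>\<tau>\<close> of the brackets at \<open>W(s, \<tau>)\<close>, transported by the flow
  \<open>F\<^sub>j\<close> for the remaining time \<open>t - \<tau>\<close> (lemma \<open>composed_flow_derivative\<close>). By hypothesis this error tends to \<open>0\<close>,
  so by Arzela-Ascoli a subsequence of the surfaces converges to a surface tangent to \<open>\<Delta>\<close>
  (lemma \<open>integral_surface\<close>), which is a graph over the coordinates other than \<open>x\<^sup>l\<close>.

  Uniqueness. Let \<open>\<gamma>\<close> be a curve tangent to \<open>\<Delta>\<close> that projects to a line in the direction \<open>x\<^sup>i\<close>. The curve
  \<open>s \<mapsto> F\<^sub>i(t - s, \<gamma>(s))\<close> joins \<open>F\<^sub>i(t, \<gamma>(0))\<close> to \<open>\<gamma>(t)\<close>, and its velocity is the vertical vector \<open>(\<eta>\<^sub>k - \<eta>)\<^sub>i\<close> at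
  \<open>\<gamma>(s)\<close>, transported for the time \<open>t - s\<close> (lemma \<open>curve_flow_comparison\<close>). So \<open>\<gamma>(t)\<close> is the limit of
  \<open>F\<^sub>i(t, \<gamma>(0))\<close> and depends only on \<open>\<gamma>(0)\<close> (lemma \<open>curve_limit\<close>). Every integral manifold is locally a graph over
  the coordinates other than \<open>x\<^sup>l\<close> (lemma \<open>integral_manifold_local_graph\<close>), and each of its points near \<open>p\<close> is
  reached from \<open>p\<close> by at most two such curves inside it.

  Both dimensions are treated at once, by two indices \<open>i\<close> and \<open>j\<close> that exhaust the indices other than \<open>l\<close>:
  in dimension 2 they are equal, and then the bracket vanishes.\<close>

section \<open>Differential equations with a C1 right-hand side\<close>

text \<open>A continuity argument: \<open>g\<close> would have to attain the value \<open>r\<close>, and \<open>step\<close> excludes this at the first such time.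
  It turns estimates that hold only while a solution stays in a given set into unconditional ones.\<close>

lemma no_exit:
  fixes g :: "real \<Rightarrow> real"
  assumes cont: "continuous_on {0..T} g" and "g 0 < r"
    and step: "\<And>t. t \<in> {0..T} \<Longrightarrow> (\<And>s. s \<in> {0..t} \<Longrightarrow> g s \<le> r) \<Longrightarrow> g t < r"
    and t: "t \<in> {0..T}"
  shows "g t < r"
proof (rule ccontr)
  assume "\<not> g t < r"
  define S where "S = {s \<in> {0..T}. r \<le> g s}"
  have "closed S" unfolding S_def
    by (intro continuous_closed_preimage_constant continuous_on_closed_Collect_le cont continuous_intros closed_atLeastAtMost)
  moreover have "bounded S" by (rule bounded_subset[of "{0..T}"]) (auto simp: S_def)
  ultimately have "compact S" by (simp add: compact_eq_bounded_closed)
  moreover have "t \<in> S" using t \<open>\<not> g t < r\<close> by (auto simp: S_def)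
  ultimately obtain m where m: "m \<in> S" "\<And>s. s \<in> S \<Longrightarrow> m \<le> s"
    using compact_attains_inf[of S] by blast
  have mT: "m \<in> {0..T}" "r \<le> g m" using m by (auto simp: S_def)
  have "\<exists>x\<ge>0. x \<le> m \<and> g x = r"
    by (rule IVT') (use mT assms(2) cont in \<open>auto intro: continuous_on_subset\<close>)
  then obtain x where x: "0 \<le> x" "x \<le> m" "g x = r" by blast
  then have "x = m" using m mT by (force simp: S_def)
  have "g s \<le> r" if "s \<in> {0..m}" for s
  proof (cases "s = m")
    case True then show ?thesis using x \<open>x = m\<close> by simp
  next
    case False
    then have "s \<notin> S" using m(2)[of s] that by auto
    then show ?thesis using that mT by (auto simp: S_def)
  qed
  from step[OF mT(1) this] show False using mT by simp
qed

text \<open>The Gronwall inequality is stated for the squared norm because this is differentiable even where \<open>f\<close>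
  vanishes. The constant \<open>2 L + 1\<close> comes from \<open>2 \<bar>f\<bar> \<epsilon> \<le> \<bar>f\<bar>\<^sup>2 + \<epsilon>\<^sup>2\<close>.\<close>

lemma gronwall_norm:
  fixes f :: "real \<Rightarrow> 'a::real_inner"
  assumes der: "\<And>t. t \<in> {0..T} \<Longrightarrow> (f has_vector_derivative f' t) (at t within {0..T})"
    and bound: "\<And>t. t \<in> {0..T} \<Longrightarrow> norm (f' t) \<le> L * norm (f t) + \<epsilon>"
    and "0 \<le> T" "0 \<le> L" "0 \<le> \<epsilon>"
  shows "(norm (f T))\<^sup>2 + \<epsilon>\<^sup>2 \<le> ((norm (f 0))\<^sup>2 + \<epsilon>\<^sup>2) * exp ((2*L+1) * T)"
proof -
  define \<phi> where "\<phi> t = (f t \<bullet> f t + \<epsilon>\<^sup>2) * exp (- (2*L+1) * t)" for t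
  have d: "(\<phi> has_real_derivative
        ((2 * (f t \<bullet> f' t) - (2*L+1) * (f t \<bullet> f t + \<epsilon>\<^sup>2)) * exp (- (2*L+1) * t))) (at t within {0..T})"
    if "t \<in> {0..T}" for t
  proof -
    have "((\<lambda>t. f t \<bullet> f t) has_derivative (\<lambda>h. f t \<bullet> (h *\<^sub>R f' t) + (h *\<^sub>R f' t) \<bullet> f t)) (at t within {0..T})"
      using der[OF that, unfolded has_vector_derivative_def] by (intro has_derivative_inner)
    then have "((\<lambda>t. f t \<bullet> f t) has_real_derivative 2 * (f t \<bullet> f' t)) (at t within {0..T})"
      unfolding has_field_derivative_def
      by (rule has_derivative_eq_rhs) (auto simp: inner_commute algebra_simps)
    then have 1: "((\<lambda>t. f t \<bullet> f t + \<epsilon>\<^sup>2) has_real_derivative 2 * (f t \<bullet> f' t) + 0) (at t within {0..T})"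
      by (rule DERIV_add) (rule DERIV_const)
    have alg: "(a + 0) * e + (e * - c) * b = (a - c * b) * e" for a b c e :: real
      by (simp add: algebra_simps)
    have 2: "((\<lambda>t. exp (- (2*L+1) * t)) has_real_derivative exp (- (2*L+1) * t) * (- (2*L+1))) (at t within {0..T})"
      by (auto intro!: derivative_eq_intros)
    show ?thesis unfolding \<phi>_def
      by (rule DERIV_cong[OF DERIV_mult[OF 1 2]], rule alg)
  qed
  have le: "2 * (f t \<bullet> f' t) - (2*L+1) * (f t \<bullet> f t + \<epsilon>\<^sup>2) \<le> 0" if "t \<in> {0..T}" for t
  proof -
    have "f t \<bullet> f' t \<le> norm (f t) * norm (f' t)" by (rule norm_cauchy_schwarz)
    also have "\<dots> \<le> norm (f t) * (L * norm (f t) + \<epsilon>)"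
      by (intro mult_left_mono bound that) auto
    finally have 1: "2 * (f t \<bullet> f' t) \<le> 2 * L * (norm (f t))\<^sup>2 + 2 * norm (f t) * \<epsilon>"
      by (simp add: algebra_simps power2_eq_square)
    have 2: "2 * norm (f t) * \<epsilon> \<le> (norm (f t))\<^sup>2 + \<epsilon>\<^sup>2"
      using sum_squares_bound by blast
    have 3: "0 \<le> 2 * L * \<epsilon>\<^sup>2" using assms by simp
    have "2 * L * (norm (f t))\<^sup>2 + (norm (f t))\<^sup>2 + \<epsilon>\<^sup>2 + 2 * L * \<epsilon>\<^sup>2
        = (2*L+1) * (f t \<bullet> f t + \<epsilon>\<^sup>2)"
      by (simp add: power2_norm_eq_inner distrib_right distrib_left)
    then show ?thesis using 1 2 3 by linarith
  qed
  have cont: "continuous_on {0..T} \<phi>"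
    by (rule DERIV_continuous_on) (rule d)
  have "\<phi> T \<le> \<phi> 0"
  proof (rule DERIV_nonpos_imp_decreasing_open[OF \<open>0 \<le> T\<close> _ cont])
    fix x assume x: "0 < x" "x < T"
    have x': "x \<in> {0..T}" using x by simp
    show "\<exists>y. (\<phi> has_real_derivative y) (at x) \<and> y \<le> 0"
      using d[OF x', unfolded at_within_Icc_at[OF x]] mult_nonpos_nonneg[OF le[OF x'] exp_ge_zero] by blast
  qed
  then have "\<phi> T * exp ((2*L+1) * T) \<le> \<phi> 0 * exp ((2*L+1) * T)"
    by (rule mult_right_mono) (rule exp_ge_zero)
  moreover have "\<phi> T * exp ((2*L+1) * T) = f T \<bullet> f T + \<epsilon>\<^sup>2"
    unfolding \<phi>_def mult.assoc exp_add[symmetric] by (simp add: algebra_simps)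
  moreover have "\<phi> 0 = f 0 \<bullet> f 0 + \<epsilon>\<^sup>2" by (simp add: \<phi>_def)
  ultimately show ?thesis by (simp only: power2_norm_eq_inner)
qed

text \<open>The Lipschitz bound and the linearisation are uniform along \<open>K\<close>, because \<open>X'\<close> is bounded and uniformly
  continuous on a compact neighbourhood of \<open>K\<close>. Later \<open>K\<close> is the trace of a solution.\<close>

lemma C1_estimates:
  fixes X :: "'a::euclidean_space \<Rightarrow> 'b::euclidean_space"
  assumes U: "open U" and der: "\<And>x. x \<in> U \<Longrightarrow> (X has_derivative blinfun_apply (X' x)) (at x)"
    and cont: "continuous_on U X'" and K: "compact K" "K \<subseteq> U"
  obtains r L where "r > 0" "L \<ge> 0"
    "\<And>x y. x \<in> K \<Longrightarrow> dist x y \<le> r \<Longrightarrow> y \<in> U \<and> norm (X y - X x) \<le> L * norm (y - x)"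
    "\<And>x. x \<in> K \<Longrightarrow> norm (X' x) \<le> L"
    "\<And>\<epsilon>. \<epsilon> > 0 \<Longrightarrow> \<exists>\<delta>>0. \<forall>x\<in>K. \<forall>y. dist x y \<le> \<delta> \<longrightarrow>
        norm (X y - X x - X' x (y - x)) \<le> \<epsilon> * norm (y - x)"
proof -
  obtain r where r: "r > 0" "(\<Union>x\<in>K. cball x r) \<subseteq> U"
    using compact_subset_open_imp_cball_epsilon_subset[OF K(1) U K(2)] by blast
  define T where "T = (\<Union>x\<in>K. cball x r)"
  have "T = {x + y | x y. x \<in> K \<and> y \<in> cball 0 r}"
  proof (intro set_eqI iffI)
    fix z assume "z \<in> T"
    then obtain x where "x \<in> K" "z \<in> cball x r" unfolding T_def by blast
    then show "z \<in> {x + y | x y. x \<in> K \<and> y \<in> cball 0 r}"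
      by (intro CollectI exI[of _ x] exI[of _ "z - x"]) (simp add: dist_norm norm_minus_commute)
  qed (force simp: T_def dist_norm)
  then have "compact T" using compact_sums[OF K(1), of "cball 0 r"] by simp
  have TU: "T \<subseteq> U" using r T_def by simp
  have contT: "continuous_on T X'" using cont TU continuous_on_subset by blast
  have "bounded (X' ` T)"
    by (intro compact_imp_bounded compact_continuous_image contT \<open>compact T\<close>)
  then obtain L where L: "\<And>x. x \<in> T \<Longrightarrow> norm (X' x) \<le> L" by (auto simp: bounded_iff)
  have seg: "closed_segment x y \<subseteq> T" if "x \<in> K" "dist x y \<le> r" for x y
  proof -
    have "closed_segment x y \<subseteq> cball x r"
      using that r by (intro closed_segment_subset) auto
    then show ?thesis using that T_def by blast
  qed
  have KT: "x \<in> T" if "x \<in> K" for x using that r by (force simp: T_def)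
  show ?thesis
  proof (rule that[of r "max L 0"])
    fix x y assume xy: "x \<in> K" "dist x y \<le> r"
    have "norm (X y - X x) \<le> max L 0 * norm (y - x)"
    proof (rule differentiable_bound[of "closed_segment x y" X "\<lambda>x. blinfun_apply (X' x)"])
      fix z assume "z \<in> closed_segment x y"
      then have z: "z \<in> T" using seg[OF xy] by blast
      then show "(X has_derivative blinfun_apply (X' z)) (at z within closed_segment x y)"
        using der TU has_derivative_at_withinI by blast
      show "onorm (blinfun_apply (X' z)) \<le> max L 0"
        using L[OF z] by (simp add: norm_blinfun.rep_eq)
    qed auto
    moreover have "y \<in> U" using seg[OF xy] TU by auto
    ultimately show "y \<in> U \<and> norm (X y - X x) \<le> max L 0 * norm (y - x)" by blast
  next
    fix \<epsilon> :: real assume "\<epsilon> > 0"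
    have "uniformly_continuous_on T X'"
      by (rule compact_uniformly_continuous[OF contT \<open>compact T\<close>])
    then obtain d where d: "d > 0" "\<And>x x'. x \<in> T \<Longrightarrow> x' \<in> T \<Longrightarrow> dist x' x < d \<Longrightarrow> dist (X' x') (X' x) < \<epsilon>"
      using \<open>\<epsilon> > 0\<close> unfolding uniformly_continuous_on_def by metis
    show "\<exists>\<delta>>0. \<forall>x\<in>K. \<forall>y. dist x y \<le> \<delta> \<longrightarrow>
        norm (X y - X x - X' x (y - x)) \<le> \<epsilon> * norm (y - x)"
    proof (intro exI[of _ "min r (d/2)"] conjI ballI allI impI)
      show "min r (d/2) > 0" using r d by simp
      fix x y assume xy: "x \<in> K" "dist x y \<le> min r (d/2)"
      have s: "closed_segment x y \<subseteq> T" using seg xy by simp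
      have "norm (X y - X x - X' x (y - x)) \<le> norm (y - x) * \<epsilon>"
      proof (rule differentiable_bound_linearization[where S="closed_segment x y" and f'="\<lambda>x. blinfun_apply (X' x)"])
        show "x + t *\<^sub>R (y - x) \<in> closed_segment x y" if "t \<in> {0..1}" for t
          using that by (auto simp: in_segment algebra_simps intro!: exI[of _ t])
        fix z assume zs: "z \<in> closed_segment x y"
        then have z: "z \<in> T" using s by blast
        then show "(X has_derivative blinfun_apply (X' z)) (at z within closed_segment x y)"
          using der TU has_derivative_at_withinI by blast
      next
        fix z assume zs: "z \<in> closed_segment x y"
        then have z: "z \<in> T" using s by blast
        have "dist z x \<le> dist x y" using zs segment_bound(1)[of z x y] by (simp add: dist_norm norm_minus_commute)
        then have "dist z x < d" using xy d by auto
        then have "norm (X' z - X' x) \<le> \<epsilon>"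
          using d(2)[OF KT[OF xy(1)] z] by (simp add: dist_norm)
        then show "onorm (blinfun_apply (X' z) - blinfun_apply (X' x)) \<le> \<epsilon>"
          by (simp add: norm_blinfun.rep_eq minus_blinfun.rep_eq fun_diff_def)
      qed auto
      then show "norm (X y - X x - X' x (y - x)) \<le> \<epsilon> * norm (y - x)" by (simp add: mult.commute)
    qed
  next
    show "norm (X' x) \<le> max L 0" if "x \<in> K" for x using L[OF KT[OF that]] by simp
  qed (use r in auto)
qed

definition solution :: "('a::real_normed_vector \<Rightarrow> 'a) \<Rightarrow> 'a set \<Rightarrow> real set \<Rightarrow> (real \<Rightarrow> 'a) \<Rightarrow> bool" where
  "solution X U J f \<longleftrightarrow>
     (\<forall>\<tau>\<in>J. f \<tau> \<in> U \<and> (f has_vector_derivative X (f \<tau>)) (at \<tau> within J))"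

lemma solution_subset: "solution X U J f \<Longrightarrow> J' \<subseteq> J \<Longrightarrow> solution X U J' f"
  unfolding solution_def by (meson has_vector_derivative_within_subset subsetD)

lemma has_vector_derivative_affine:
  assumes "(f has_vector_derivative v) (at (c + \<sigma> * \<tau>) within J)"
    and "\<And>s. s \<in> J' \<Longrightarrow> c + \<sigma> * s \<in> J"
  shows "((\<lambda>s. f (c + \<sigma> * s)) has_vector_derivative \<sigma> *\<^sub>R v) (at \<tau> within J')"
proof -
  have "((\<lambda>s. c + \<sigma> * s) has_vector_derivative \<sigma>) (at \<tau> within J')"
    unfolding has_vector_derivative_def by (auto intro!: derivative_eq_intros)
  moreover have "(f has_vector_derivative v) (at (c + \<sigma> * \<tau>) within (\<lambda>s. c + \<sigma> * s) ` J')"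
    using assms by (auto intro: has_vector_derivative_within_subset)
  ultimately show ?thesis
    using vector_diff_chain_within[of "\<lambda>s. c + \<sigma> * s" \<sigma> \<tau> J' f v] by (simp add: o_def)
qed

text \<open>With \<open>\<sigma> = -1\<close> this reverses time, so that it suffices to study solutions forward in time.\<close>

lemma solution_affine:
  assumes "solution X U J f" and "\<And>s. s \<in> J' \<Longrightarrow> c + \<sigma> * s \<in> J"
  shows "solution (\<lambda>x. \<sigma> *\<^sub>R X x) U J' (\<lambda>s. f (c + \<sigma> * s))"
  using assms unfolding solution_def by (auto intro!: has_vector_derivative_affine)

locale C1_field =
  fixes X :: "'a::euclidean_space \<Rightarrow> 'a" and X' :: "'a \<Rightarrow> 'a \<Rightarrow>\<^sub>L 'a" and U :: "'a set"
  assumes open_domain: "open U"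
    and derivative: "\<And>x. x \<in> U \<Longrightarrow> (X has_derivative blinfun_apply (X' x)) (at x)"
    and continuous_derivative: "continuous_on U X'"

lemma C1_field_scaleR:
  assumes "C1_field X X' U"
  shows "C1_field (\<lambda>x. \<sigma> *\<^sub>R X x) (\<lambda>x. \<sigma> *\<^sub>R X' x) U"
proof -
  interpret C1_field X X' U by fact
  have "((\<lambda>x. \<sigma> *\<^sub>R X x) has_derivative blinfun_apply (\<sigma> *\<^sub>R X' x)) (at x)" if "x \<in> U" for x
    using has_derivative_scaleR_right[OF derivative[OF that], of \<sigma>]
    by (simp add: scaleR_blinfun.rep_eq)
  then show ?thesis
    by unfold_locales (auto intro!: open_domain continuous_derivative continuous_intros)
qed

context C1_field
begin

lemma continuous_on_solution: "solution X U J f \<Longrightarrow> continuous_on J f"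
  unfolding solution_def using has_vector_derivative_continuous continuous_on_eq_continuous_within by blast

text \<open>Solutions starting close to \<open>f\<close> stay in the neighbourhood of the trace of \<open>f\<close> in which the Lipschitz bound
  holds, by \<open>no_exit\<close>, and there the Gronwall inequality applies to the difference.\<close>

lemma forward_dependence:
  assumes f: "solution X U {0..T} f" and "0 \<le> T"
  obtains r C where "r > 0" "C \<ge> 1"
    "\<And>g \<tau>. solution X U {0..T} g \<Longrightarrow> norm (g 0 - f 0) < r \<Longrightarrow> \<tau> \<in> {0..T}
       \<Longrightarrow> norm (g \<tau> - f \<tau>) \<le> C * norm (g 0 - f 0)"
proof -
  define K where "K = f ` {0..T}"
  have "compact K" unfolding K_def
    by (intro compact_continuous_image continuous_on_solution[OF f]) auto
  moreover have "K \<subseteq> U" using f by (auto simp: K_def solution_def)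
  ultimately obtain r L where rL: "r > 0" "L \<ge> 0"
    "\<And>x y. x \<in> K \<Longrightarrow> dist x y \<le> r \<Longrightarrow> y \<in> U \<and> norm (X y - X x) \<le> L * norm (y - x)"
    using C1_estimates[OF open_domain derivative continuous_derivative] by metis
  define C where "C = exp ((L + 1/2) * T)"
  have C2: "C\<^sup>2 = exp ((2*L+1) * T)"
    unfolding C_def by (simp add: power2_eq_square exp_add[symmetric] algebra_simps)
  have "C \<ge> 1" unfolding C_def using rL \<open>0 \<le> T\<close> by simp
  have bound: "norm (g \<tau> - f \<tau>) \<le> C * norm (g 0 - f 0)"
    if g: "solution X U {0..T} g" and \<tau>: "\<tau> \<in> {0..T}"
      and near: "\<And>s. s \<in> {0..\<tau>} \<Longrightarrow> norm (g s - f s) \<le> r" for g \<tau>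
  proof -
    have "(norm (g \<tau> - f \<tau>))\<^sup>2 + 0\<^sup>2 \<le> ((norm (g 0 - f 0))\<^sup>2 + 0\<^sup>2) * exp ((2*L+1) * \<tau>)"
    proof (rule gronwall_norm[where f'="\<lambda>s. X (g s) - X (f s)"])
      fix s assume s: "s \<in> {0..\<tau>}"
      have "{0..\<tau>} \<subseteq> {0..T}" using \<tau> by auto
      from solution_subset[OF f this] solution_subset[OF g this] s
      show "((\<lambda>s. g s - f s) has_vector_derivative X (g s) - X (f s)) (at s within {0..\<tau>})"
        unfolding solution_def by (auto intro!: has_vector_derivative_diff)
      have "f s \<in> K" using s \<tau> by (auto simp: K_def)
      then show "norm (X (g s) - X (f s)) \<le> L * norm (g s - f s) + 0"
        using rL(3) near[OF s] by (simp add: dist_norm norm_minus_commute)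
    qed (use \<tau> rL in auto)
    also have "\<dots> \<le> ((norm (g 0 - f 0))\<^sup>2) * exp ((2*L+1) * T)"
      using \<tau> rL by (auto intro!: mult_left_mono)
    finally have "(norm (g \<tau> - f \<tau>))\<^sup>2 \<le> (C * norm (g 0 - f 0))\<^sup>2"
      by (simp add: power_mult_distrib C2 mult.commute)
    then show ?thesis
      by (rule power2_le_imp_le) (use \<open>C \<ge> 1\<close> in auto)
  qed
  show ?thesis
  proof (rule that[of "r / C" C])
    show "r / C > 0" using rL \<open>C \<ge> 1\<close> by simp
    fix g \<tau> assume g: "solution X U {0..T} g" and n: "norm (g 0 - f 0) < r / C" and \<tau>: "\<tau> \<in> {0..T}"
    have n': "C * norm (g 0 - f 0) < r" using n \<open>C \<ge> 1\<close> by (simp add: field_simps)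
    have all: "norm (g t - f t) < r" if "t \<in> {0..T}" for t
    proof (rule no_exit[of T "\<lambda>t. norm (g t - f t)"])
      show "continuous_on {0..T} (\<lambda>t. norm (g t - f t))"
        by (intro continuous_intros continuous_on_solution f g)
      have "norm (g 0 - f 0) \<le> C * norm (g 0 - f 0)" using \<open>C \<ge> 1\<close> by (simp add: mult_le_cancel_right1)
      then show "norm (g 0 - f 0) < r" using n' by simp
      fix t assume "t \<in> {0..T}" "\<And>s. s \<in> {0..t} \<Longrightarrow> norm (g s - f s) \<le> r"
      then show "norm (g t - f t) < r" using bound[OF g] n' by fastforce
    qed fact
    show "norm (g \<tau> - f \<tau>) \<le> C * norm (g 0 - f 0)"
      by (rule bound[OF g \<tau>]) (use all \<tau> in \<open>auto intro: less_imp_le\<close>)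
  qed fact
qed

lemma forward_unique:
  assumes "solution X U {0..T} f" "solution X U {0..T} g" "f 0 = g 0" "t \<in> {0..T}"
  shows "f t = g t"
proof -
  have "0 \<le> T" using assms(4) by simp
  from forward_dependence[OF assms(1) this] obtain r C where rC: "r > 0"
    "\<And>g \<tau>. solution X U {0..T} g \<Longrightarrow> norm (g 0 - f 0) < r \<Longrightarrow> \<tau> \<in> {0..T}
       \<Longrightarrow> norm (g \<tau> - f \<tau>) \<le> C * norm (g 0 - f 0)" by metis
  from rC(2)[OF assms(2) _ assms(4)] assms(3) rC(1) show ?thesis by simp
qed

text \<open>The remainder \<open>\<rho> = G h - G 0 - h Z\<close> satisfies the variational equation up to the error of linearising \<open>X\<close>, which
  is \<open>o(h)\<close> uniformly in time, so the Gronwall inequality gives \<open>\<rho> = o(h)\<close>. The solution \<open>Z\<close> of the variational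
  equation is part of the data: in the applications it is known explicitly, and no existence theorem for
  differential equations is used.\<close>

lemma forward_variation:
  assumes G: "\<And>h. h \<in> S \<Longrightarrow> solution X U {0..T} (G h)" and S: "0 \<in> S" and T: "0 \<le> T"
    and init: "((\<lambda>h. G h 0) has_vector_derivative Z 0) (at 0 within S)"
    and Z: "\<And>\<tau>. \<tau> \<in> {0..T} \<Longrightarrow> (Z has_vector_derivative X' (G 0 \<tau>) (Z \<tau>)) (at \<tau> within {0..T})"
  shows "((\<lambda>h. G h T) has_vector_derivative Z T) (at 0 within S)"
proof -
  note G0 = G[OF S]
  define K where "K = G 0 ` {0..T}"
  have "compact K" unfolding K_def
    by (intro compact_continuous_image continuous_on_solution[OF G0]) auto
  moreover have "K \<subseteq> U" using G0 by (auto simp: K_def solution_def)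
  ultimately obtain L where L: "L \<ge> 0" "\<And>x. x \<in> K \<Longrightarrow> norm (X' x) \<le> L"
    and lin: "\<And>\<epsilon>. \<epsilon> > 0 \<Longrightarrow> \<exists>\<delta>>0. \<forall>x\<in>K. \<forall>y. dist x y \<le> \<delta> \<longrightarrow>
        norm (X y - X x - X' x (y - x)) \<le> \<epsilon> * norm (y - x)"
    using C1_estimates[OF open_domain derivative continuous_derivative] by metis
  obtain r C where r: "r > 0" and C: "C \<ge> 1"
    and dep: "\<And>g \<tau>. solution X U {0..T} g \<Longrightarrow> norm (g 0 - G 0 0) < r \<Longrightarrow> \<tau> \<in> {0..T}
       \<Longrightarrow> norm (g \<tau> - G 0 \<tau>) \<le> C * norm (g 0 - G 0 0)"
    using forward_dependence[OF G0 T] by metis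
  define M where "M = exp ((L + 1/2) * T)"
  have M2: "M\<^sup>2 = exp ((2*L+1) * T)"
    unfolding M_def by (simp add: power2_eq_square exp_add[symmetric] algebra_simps)
  have "M > 0" by (simp add: M_def)
  define R where "R = norm (Z 0) + 1"
  have "R > 0" unfolding R_def using norm_ge_zero[of "Z 0"] by linarith
  have init': "\<exists>d>0. \<forall>h\<in>S. \<bar>h\<bar> < d \<longrightarrow> norm (G h 0 - G 0 0 - h *\<^sub>R Z 0) \<le> e * \<bar>h\<bar>" if "e > 0" for e
    using init that unfolding has_vector_derivative_def has_derivative_within_alt by force
  show ?thesis
    unfolding has_vector_derivative_def has_derivative_within_alt
  proof (intro conjI allI impI)
    show "bounded_linear (\<lambda>x. x *\<^sub>R Z T)" by (rule bounded_linear_scaleR_left)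
    fix e :: real assume "e > 0"
    \<comment> \<open>\<open>a\<close> bounds the error at time 0 and \<open>b\<close> the linearisation error. They are chosen so that the Gronwall
      inequality yields \<open>\<bar>\<rho>\<bar>\<^sup>2 \<le> 2 (a M \<bar>h\<bar>)\<^sup>2 \<le> (e \<bar>h\<bar>)\<^sup>2\<close>.\<close>
    define a where "a = e / (2 * M)"
    define b where "b = e / (2 * M * C * R)"
    have "a > 0" "b > 0" using \<open>e > 0\<close> \<open>M > 0\<close> C \<open>R > 0\<close> by (auto simp: a_def b_def)
    obtain \<delta> where \<delta>: "\<delta> > 0" "\<And>x y. x \<in> K \<Longrightarrow> dist x y \<le> \<delta> \<Longrightarrow>
        norm (X y - X x - X' x (y - x)) \<le> b * norm (y - x)"
      using lin[OF \<open>b > 0\<close>] by blast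
    obtain d1 where d1: "d1 > 0" "\<And>h. h \<in> S \<Longrightarrow> \<bar>h\<bar> < d1 \<Longrightarrow> norm (G h 0 - G 0 0 - h *\<^sub>R Z 0) \<le> a * \<bar>h\<bar>"
      using init'[OF \<open>a > 0\<close>] by blast
    obtain d2 where d2: "d2 > 0" "\<And>h. h \<in> S \<Longrightarrow> \<bar>h\<bar> < d2 \<Longrightarrow> norm (G h 0 - G 0 0 - h *\<^sub>R Z 0) \<le> 1 * \<bar>h\<bar>"
      using init'[of 1] by auto
    define d where "d = min (min d1 d2) (min (r / R) (\<delta> / (C * R)))"
    have "d > 0" using d1 d2 r \<delta> C \<open>R > 0\<close> by (simp add: d_def)
    show "\<exists>d>0. \<forall>y\<in>S. norm (y - 0) < d \<longrightarrow>
        norm (G y T - G 0 T - (y - 0) *\<^sub>R Z T) \<le> e * norm (y - 0)"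
    proof (intro exI[of _ d] conjI ballI impI, fact)
      fix h assume h: "h \<in> S" and "norm (h - 0) < d"
      then have hd: "\<bar>h\<bar> < d1" "\<bar>h\<bar> < d2" "\<bar>h\<bar> < r / R" "\<bar>h\<bar> < \<delta> / (C * R)" by (auto simp: d_def)
      have "norm (G h 0 - G 0 0) \<le> norm (G h 0 - G 0 0 - h *\<^sub>R Z 0) + norm (h *\<^sub>R Z 0)"
        using norm_triangle_ineq[of "G h 0 - G 0 0 - h *\<^sub>R Z 0" "h *\<^sub>R Z 0"] by simp
      also have "\<dots> \<le> R * \<bar>h\<bar>"
        using d2(2)[OF h hd(2)] by (simp add: R_def algebra_simps)
      finally have G0h: "norm (G h 0 - G 0 0) \<le> R * \<bar>h\<bar>" .
      have "R * \<bar>h\<bar> < r" using hd(3) \<open>R > 0\<close> by (simp add: field_simps)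
      then have dh: "norm (G h \<tau> - G 0 \<tau>) \<le> C * R * \<bar>h\<bar>" if "\<tau> \<in> {0..T}" for \<tau>
        using dep[OF G[OF h] _ that] G0h C
        by (smt (verit) mult.assoc mult_left_mono)
      have CRh: "C * R * \<bar>h\<bar> < \<delta>" using hd(4) C \<open>R > 0\<close> by (simp add: field_simps)
      define \<rho> where "\<rho> \<tau> = G h \<tau> - G 0 \<tau> - h *\<^sub>R Z \<tau>" for \<tau>
      define \<rho>' where "\<rho>' \<tau> = X (G h \<tau>) - X (G 0 \<tau>) - h *\<^sub>R X' (G 0 \<tau>) (Z \<tau>)" for \<tau>
      define \<epsilon> where "\<epsilon> = b * (C * R * \<bar>h\<bar>)"
      have "\<epsilon> \<ge> 0" using \<open>b > 0\<close> C \<open>R > 0\<close> by (simp add: \<epsilon>_def)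
      have "(norm (\<rho> T))\<^sup>2 + \<epsilon>\<^sup>2 \<le> ((norm (\<rho> 0))\<^sup>2 + \<epsilon>\<^sup>2) * exp ((2*L+1) * T)"
      proof (rule gronwall_norm[where f'=\<rho>'])
        fix \<tau> assume \<tau>: "\<tau> \<in> {0..T}"
        have "((\<lambda>\<tau>. h *\<^sub>R Z \<tau>) has_vector_derivative h *\<^sub>R X' (G 0 \<tau>) (Z \<tau>)) (at \<tau> within {0..T})"
          using bounded_linear.has_vector_derivative[OF bounded_linear_scaleR_right Z[OF \<tau>]] .
        then show "(\<rho> has_vector_derivative \<rho>' \<tau>) (at \<tau> within {0..T})"
          unfolding \<rho>_def \<rho>'_def
          using G[OF h] G0 \<tau> unfolding solution_def
          by (intro has_vector_derivative_diff) auto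
        have K: "G 0 \<tau> \<in> K" using \<tau> by (auto simp: K_def)
        have "\<rho>' \<tau> = X' (G 0 \<tau>) (\<rho> \<tau>) + (X (G h \<tau>) - X (G 0 \<tau>) - X' (G 0 \<tau>) (G h \<tau> - G 0 \<tau>))"
          by (simp add: \<rho>_def \<rho>'_def blinfun.diff_right blinfun.scaleR_right)
        also have "norm \<dots> \<le> norm (X' (G 0 \<tau>) (\<rho> \<tau>)) + norm (X (G h \<tau>) - X (G 0 \<tau>) - X' (G 0 \<tau>) (G h \<tau> - G 0 \<tau>))"
          by (rule norm_triangle_ineq)
        also have "\<dots> \<le> L * norm (\<rho> \<tau>) + \<epsilon>"
        proof (rule add_mono)
          show "norm (X' (G 0 \<tau>) (\<rho> \<tau>)) \<le> L * norm (\<rho> \<tau>)"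
            by (rule order_trans[OF norm_blinfun mult_right_mono[OF L(2)[OF K]]]) simp
          have "norm (X (G h \<tau>) - X (G 0 \<tau>) - X' (G 0 \<tau>) (G h \<tau> - G 0 \<tau>)) \<le> b * norm (G h \<tau> - G 0 \<tau>)"
            using dh[OF \<tau>] CRh by (intro \<delta>(2)[OF K]) (simp add: dist_norm norm_minus_commute)
          also have "\<dots> \<le> \<epsilon>" unfolding \<epsilon>_def using \<open>b > 0\<close> dh[OF \<tau>] by (intro mult_left_mono) auto
          finally show "norm (X (G h \<tau>) - X (G 0 \<tau>) - X' (G 0 \<tau>) (G h \<tau> - G 0 \<tau>)) \<le> \<epsilon>" .
        qed
        finally show "norm (\<rho>' \<tau>) \<le> L * norm (\<rho> \<tau>) + \<epsilon>" .
      qed (use T L \<open>\<epsilon> \<ge> 0\<close> in auto)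
      also have "\<dots> \<le> ((a * \<bar>h\<bar>)\<^sup>2 + (a * \<bar>h\<bar>)\<^sup>2) * M\<^sup>2"
        unfolding M2
      proof (intro mult_right_mono add_mono power_mono)
        show "norm (\<rho> 0) \<le> a * \<bar>h\<bar>" using d1(2)[OF h hd(1)] by (simp add: \<rho>_def)
        have "b * C * R = a" using C \<open>R > 0\<close> by (simp add: a_def b_def)
        then show "\<epsilon> \<le> a * \<bar>h\<bar>" unfolding \<epsilon>_def by (simp add: mult.assoc[symmetric])
      qed (use \<open>\<epsilon> \<ge> 0\<close> in auto)
      also have "\<dots> = 2 * (a * M)\<^sup>2 * \<bar>h\<bar>\<^sup>2" by (simp add: power_mult_distrib algebra_simps)
      also have "a * M = e / 2" using \<open>M > 0\<close> by (simp add: a_def)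
      also have "2 * (e/2)\<^sup>2 * \<bar>h\<bar>\<^sup>2 \<le> (e * \<bar>h\<bar>)\<^sup>2" by (simp add: power_mult_distrib power_divide)
      finally have "(norm (\<rho> T))\<^sup>2 \<le> (e * \<bar>h\<bar>)\<^sup>2"
        using zero_le_power2[of \<epsilon>] by linarith
      then have "norm (\<rho> T) \<le> e * \<bar>h\<bar>"
        by (rule power2_le_imp_le) (use \<open>e > 0\<close> in auto)
      then show "norm (G h T - G 0 T - (h - 0) *\<^sub>R Z T) \<le> e * norm (h - 0)"
        by (simp add: \<rho>_def)
    qed
  qed
qed

end

lemma solution_unique:
  assumes "C1_field X X' U" "solution X U {a..b} f" "solution X U {a..b} g"
    and "c \<in> {a..b}" "f c = g c" "t \<in> {a..b}"
  shows "f t = g t"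
proof -
  have main: "f (c + \<sigma> * s) = g (c + \<sigma> * s)" if "s \<in> {0..T}" "\<And>s. s \<in> {0..T} \<Longrightarrow> c + \<sigma> * s \<in> {a..b}" for \<sigma> s T :: real
    using C1_field.forward_unique[OF C1_field_scaleR[OF assms(1)]
        solution_affine[OF assms(2) that(2)] solution_affine[OF assms(3) that(2)] _ that(1)] assms(5) by simp
  show ?thesis
  proof (cases "c \<le> t")
    case True
    then show ?thesis using main[of "t - c" "t - c" 1] assms by auto
  next
    case False
    then show ?thesis using main[of "c - t" "c - t" "-1"] assms by auto
  qed
qed

lemma solution_variation:
  assumes field: "C1_field X X' U"
    and G: "\<And>h. h \<in> S \<Longrightarrow> solution X U {a..b} (G h)" and S: "0 \<in> S" and t: "0 \<in> {a..b}" "t \<in> {a..b}"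
    and init: "((\<lambda>h. G h 0) has_vector_derivative Z 0) (at 0 within S)"
    and Z: "\<And>\<tau>. \<tau> \<in> {a..b} \<Longrightarrow> (Z has_vector_derivative X' (G 0 \<tau>) (Z \<tau>)) (at \<tau> within {a..b})"
  shows "((\<lambda>h. G h t) has_vector_derivative Z t) (at 0 within S)"
proof -
  have main: "((\<lambda>h. G h (0 + \<sigma> * T)) has_vector_derivative Z (0 + \<sigma> * T)) (at 0 within S)"
    if "0 \<le> T" and sub: "\<And>s. s \<in> {0..T} \<Longrightarrow> 0 + \<sigma> * s \<in> {a..b}" for \<sigma> T :: real
  proof (rule C1_field.forward_variation[OF C1_field_scaleR[OF field, of \<sigma>],
          where G="\<lambda>h s. G h (0 + \<sigma> * s)" and Z="\<lambda>s. Z (0 + \<sigma> * s)"])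
    show "solution (\<lambda>x. \<sigma> *\<^sub>R X x) U {0..T} (\<lambda>s. G h (0 + \<sigma> * s))" if "h \<in> S" for h
      by (rule solution_affine[OF G[OF that] sub])
    show "((\<lambda>s. Z (0 + \<sigma> * s)) has_vector_derivative
        (\<sigma> *\<^sub>R X' (G 0 (0 + \<sigma> * \<tau>))) (Z (0 + \<sigma> * \<tau>))) (at \<tau> within {0..T})"
      if "\<tau> \<in> {0..T}" for \<tau>
      unfolding blinfun.scaleR_left
      by (rule has_vector_derivative_affine[OF Z[OF sub[OF that]] sub])
  qed (use that S init in auto)
  show ?thesis
  proof (cases "0 \<le> t")
    case True
    then show ?thesis using main[of t 1] t by auto
  next
    case False
    then show ?thesis using main[of "-t" "-1"] t by auto
  qed
qed

section \<open>Normalised forms, their frames and the flows of the frames\<close>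

lemma Ck_on_1_blinfun:
  fixes f :: "'a::euclidean_space \<Rightarrow> 'b::real_normed_vector"
  assumes "Ck_on 1 f U"
  defines "f' \<equiv> \<lambda>x. Blinfun (frechet_derivative f (at x))"
  shows "\<And>x. x \<in> U \<Longrightarrow> blinfun_apply (f' x) = frechet_derivative f (at x)"
    and "\<And>x. x \<in> U \<Longrightarrow> (f has_derivative blinfun_apply (f' x)) (at x)"
    and "continuous_on U f'"
proof -
  have d: "(f has_derivative frechet_derivative f (at x)) (at x)" if "x \<in> U" for x
    using assms that frechet_derivative_works by auto
  show eq: "blinfun_apply (f' x) = frechet_derivative f (at x)" if "x \<in> U" for x
    unfolding f'_def by (rule bounded_linear_Blinfun_apply[OF has_derivative_bounded_linear[OF d[OF that]]])
  show "(f has_derivative blinfun_apply (f' x)) (at x)" if "x \<in> U" for x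
    using d[OF that] eq[OF that] by simp
  show "continuous_on U f'"
  proof (rule continuous_on_blinfun_componentwise)
    fix v :: 'a
    have "continuous_on U (\<lambda>x. frechet_derivative f (at x) v)" using assms by simp
    then show "continuous_on U (\<lambda>x. blinfun_apply (f' x) v)"
      by (rule continuous_on_eq) (simp add: eq)
  qed
qed

text \<open>Continuous dependence on the initial value is uniform in time; with the continuity in time of the one solution
  that starts at \<open>x\<close> it gives joint continuity at time 0.\<close>

lemma flow_continuous_at_0:
  assumes field: "C1_field X X' U" and x: "x \<in> V" and "0 < t0"
    and sol: "\<And>p. p \<in> V \<Longrightarrow> solution X U {-t0..t0} (G p)" and init: "\<And>p. p \<in> V \<Longrightarrow> G p 0 = p"
    and "0 < \<epsilon>"
  shows "\<exists>\<delta>>0. \<forall>p\<in>V. \<forall>r. norm (p - x) < \<delta> \<longrightarrow> \<bar>r\<bar> < \<delta> \<longrightarrow> norm (G p r - x) < \<epsilon>"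
proof -
  have one: "\<exists>\<delta>>0. \<forall>p\<in>V. \<forall>r. norm (p - x) < \<delta> \<longrightarrow> 0 \<le> r \<longrightarrow> r < \<delta> \<longrightarrow> norm (G p (\<sigma> * r) - x) < \<epsilon>"
    if "\<bar>\<sigma>\<bar> = 1" for \<sigma>
  proof -
    have sub: "0 + \<sigma> * s \<in> {-t0..t0}" if "s \<in> {0..t0}" for s
      using that \<open>\<bar>\<sigma>\<bar> = 1\<close> by (cases "\<sigma> = 1") (auto simp: abs_if split: if_splits)
    interpret S: C1_field "\<lambda>x. \<sigma> *\<^sub>R X x" "\<lambda>x. \<sigma> *\<^sub>R X' x" U
      by (rule C1_field_scaleR[OF field])
    have s: "solution (\<lambda>x. \<sigma> *\<^sub>R X x) U {0..t0} (\<lambda>s. G p (0 + \<sigma> * s))" if "p \<in> V" for p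
      by (rule solution_affine[OF sol[OF that] sub])
    obtain r C where rC: "r > 0" "C \<ge> 1"
      "\<And>g \<tau>. solution (\<lambda>x. \<sigma> *\<^sub>R X x) U {0..t0} g \<Longrightarrow> norm (g 0 - G x (0 + \<sigma> * 0)) < r \<Longrightarrow> \<tau> \<in> {0..t0}
       \<Longrightarrow> norm (g \<tau> - G x (0 + \<sigma> * \<tau>)) \<le> C * norm (g 0 - G x (0 + \<sigma> * 0))"
      using S.forward_dependence[OF s[OF x]] \<open>0 < t0\<close> by (metis less_imp_le)
    have "continuous_on {0..t0} (\<lambda>s. G x (0 + \<sigma> * s))" by (rule S.continuous_on_solution[OF s[OF x]])
    then have "\<exists>d>0. \<forall>s\<in>{0..t0}. dist s 0 < d \<longrightarrow> dist (G x (0 + \<sigma> * s)) (G x (0 + \<sigma> * 0)) < \<epsilon> / 2"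
      using \<open>0 < t0\<close> half_gt_zero[OF \<open>0 < \<epsilon>\<close>] unfolding continuous_on_iff by (meson atLeastAtMost_iff less_imp_le order_refl)
    then obtain d where d: "d > 0" "\<And>s. s \<in> {0..t0} \<Longrightarrow> \<bar>s\<bar> < d \<Longrightarrow> norm (G x (\<sigma> * s) - x) < \<epsilon> / 2"
      by (auto simp: dist_norm init[OF x])
    show ?thesis
    proof (intro exI[of _ "min (min d t0) (min r (\<epsilon> / (2 * C)))"] conjI ballI allI impI)
      show "0 < min (min d t0) (min r (\<epsilon> / (2 * C)))" using d rC \<open>0 < t0\<close> \<open>0 < \<epsilon>\<close> by simp
      fix p s assume p: "p \<in> V" "norm (p - x) < min (min d t0) (min r (\<epsilon> / (2 * C)))"
        "0 \<le> s" "s < min (min d t0) (min r (\<epsilon> / (2 * C)))"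
      have "norm (G p (0 + \<sigma> * s) - G x (0 + \<sigma> * s)) \<le> C * norm (p - x)"
        using rC(3)[OF s[OF p(1)], of s] p init x by auto
      also have "\<dots> < \<epsilon> / 2" using p rC by (auto simp: field_simps)
      finally have "norm (G p (\<sigma> * s) - G x (\<sigma> * s)) < \<epsilon> / 2" by simp
      moreover have "norm (G x (\<sigma> * s) - x) < \<epsilon> / 2" using d p by auto
      ultimately show "norm (G p (\<sigma> * s) - x) < \<epsilon>"
        using norm_triangle_lt[of "G p (\<sigma> * s) - G x (\<sigma> * s)" "G x (\<sigma> * s) - x" \<epsilon>] by simp
    qed
  qed
  obtain d1 where d1: "d1 > 0" "\<And>p r. p \<in> V \<Longrightarrow> norm (p - x) < d1 \<Longrightarrow> 0 \<le> r \<Longrightarrow> r < d1 \<Longrightarrow> norm (G p (1 * r) - x) < \<epsilon>"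
    using one[of 1] by auto
  obtain d2 where d2: "d2 > 0" "\<And>p r. p \<in> V \<Longrightarrow> norm (p - x) < d2 \<Longrightarrow> 0 \<le> r \<Longrightarrow> r < d2 \<Longrightarrow> norm (G p (-1 * r) - x) < \<epsilon>"
    using one[of "-1"] by auto
  show ?thesis
  proof (intro exI[of _ "min d1 d2"] conjI ballI allI impI)
    fix p r assume "p \<in> V" "norm (p - x) < min d1 d2" "\<bar>r\<bar> < min d1 d2"
    then show "norm (G p r - x) < \<epsilon>"
      using d1(2)[of p r] d2(2)[of p "-r"] by (cases "0 \<le> r") auto
  qed (use d1 d2 in auto)
qed

text \<open>A single \<open>C\<^sup>1\<close> form in the coordinates of a chart whose image is \<open>U\<close>; it stands for one of the approximating forms.\<close>

locale normalised_form =
  fixes \<eta> :: "real^'n::finite \<Rightarrow> real^'n" and U :: "(real^'n) set" and l :: 'n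
  assumes open_U: "open U" and C1: "Ck_on 1 \<eta> U" and normalised: "\<And>x. x \<in> U \<Longrightarrow> \<eta> x $ l = 1"
begin

definition D :: "real^'n \<Rightarrow> (real^'n) \<Rightarrow>\<^sub>L (real^'n)" where
  "D x = Blinfun (frechet_derivative \<eta> (at x))"

lemma D_eq: "x \<in> U \<Longrightarrow> frechet_derivative \<eta> (at x) = blinfun_apply (D x)"
  using Ck_on_1_blinfun(1)[OF C1] by (simp add: D_def)

lemma D: "x \<in> U \<Longrightarrow> (\<eta> has_derivative blinfun_apply (D x)) (at x)"
  using Ck_on_1_blinfun(2)[OF C1] by (simp add: D_def[abs_def])

lemma continuous_on_D: "continuous_on U D"
  using Ck_on_1_blinfun(3)[OF C1] by (simp add: D_def[abs_def])

lemma D_last: "x \<in> U \<Longrightarrow> D x u $ l = 0"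
proof -
  assume x: "x \<in> U"
  have "((\<lambda>y. \<eta> y \<bullet> axis l 1) has_derivative (\<lambda>u. D x u \<bullet> axis l 1)) (at x)"
    using D[OF x] by (rule has_derivative_inner_left)
  moreover have "((\<lambda>y. \<eta> y \<bullet> axis l 1) has_derivative (\<lambda>u. 0)) (at x)"
    by (rule has_derivative_transform_within_open[OF has_derivative_const open_U x, of 1])
       (simp add: inner_axis normalised)
  ultimately have "(\<lambda>u. D x u \<bullet> axis l 1) = (\<lambda>u. 0)" by (rule has_derivative_unique)
  then show ?thesis by (auto simp: inner_axis dest: fun_cong)
qed

lemma frame_field_eq: "x \<in> U \<Longrightarrow> frame_field l \<eta> i x = axis i 1 - (\<eta> x $ i) *\<^sub>R axis l 1"
  by (simp add: frame_field_def normalised)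

definition D_frame :: "'n \<Rightarrow> real^'n \<Rightarrow> (real^'n) \<Rightarrow>\<^sub>L (real^'n)" where
  "D_frame i x = Blinfun (\<lambda>u. - (D x u $ i) *\<^sub>R axis l 1)"

lemma D_frame_apply: "D_frame i x u = - (D x u $ i) *\<^sub>R axis l 1"
proof -
  have "bounded_linear (\<lambda>u. - (D x u \<bullet> axis i 1) *\<^sub>R (axis l 1 :: real^'n))"
    by (intro bounded_linear_scaleR_const bounded_linear_minus bounded_linear_inner_left_comp blinfun.bounded_linear_right)
  then show ?thesis
    unfolding D_frame_def by (subst bounded_linear_Blinfun_apply) (simp_all add: inner_axis)
qed

lemma C1_field_frame: "C1_field (frame_field l \<eta> i) (D_frame i) U"
proof
  show "(frame_field l \<eta> i has_derivative blinfun_apply (D_frame i x)) (at x)" if x: "x \<in> U" for x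
  proof (rule has_derivative_transform_within_open[OF _ open_U x])
    have "((\<lambda>y. axis i 1 - (\<eta> y \<bullet> axis i 1) *\<^sub>R axis l 1) has_derivative
        (\<lambda>u. 0 - (D x u \<bullet> axis i 1) *\<^sub>R axis l 1)) (at x)"
      by (intro has_derivative_diff has_derivative_const has_derivative_scaleR_left has_derivative_inner_left D x)
    then show "((\<lambda>y. axis i 1 - (\<eta> y $ i) *\<^sub>R axis l 1) has_derivative blinfun_apply (D_frame i x)) (at x)"
      by (simp add: inner_axis D_frame_apply[abs_def])
  qed (simp add: frame_field_eq)
  show "continuous_on U (D_frame i)"
    by (rule continuous_on_blinfun_componentwise)
       (auto simp: D_frame_apply intro!: continuous_intros continuous_on_D)
qed (rule open_U)

text \<open>The normalisation kills \<open>\<partial>\<eta>\<^sub>l/\<partial>x\<^sup>i\<close>, so the coefficient is the vertical derivative of the vertical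
  component of \<open>frame_field l \<eta> i\<close>.\<close>

lemma ext_deriv_coeff_eq: "x \<in> U \<Longrightarrow> ext_deriv_coeff \<eta> i l x = - (D x (axis l 1) $ i)"
  by (simp add: ext_deriv_coeff_def ext_deriv_def D_eq inner_axis D_last)

lemma ext_deriv_frame:
  "x \<in> U \<Longrightarrow> ext_deriv \<eta> x (frame_field l \<eta> i x) (frame_field l \<eta> j x) =
     D x (frame_field l \<eta> i x) $ j - D x (frame_field l \<eta> j x) $ i"
  by (simp add: ext_deriv_def D_eq frame_field_eq inner_diff_right inner_axis D_last)

text \<open>The frame fields lie in the kernel of \<open>\<eta>\<close>, so only the term with \<open>\<eta>(\<partial>/\<partial>x\<^sup>l) = 1\<close> survives.\<close>

lemma wedge_ext_deriv_frame:
  "x \<in> U \<Longrightarrow> wedge_ext_deriv \<eta> x (frame_field l \<eta> i x) (frame_field l \<eta> j x) (axis l 1) =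
     ext_deriv \<eta> x (frame_field l \<eta> i x) (frame_field l \<eta> j x)"
  by (simp add: wedge_ext_deriv_def frame_field_eq inner_diff_right inner_axis normalised)

end

locale form_flow = normalised_form \<eta> U l
  for \<eta> :: "real^'n::finite \<Rightarrow> real^'n" and U :: "(real^'n) set" and l :: 'n +
  fixes V :: "(real^'n) set" and t0 :: real and F :: "'n \<Rightarrow> real \<Rightarrow> real^'n \<Rightarrow> real^'n"
  assumes t0: "0 < t0" and open_V: "open V"
    and flow: "\<And>i. i \<noteq> l \<Longrightarrow> is_flow (frame_field l \<eta> i) U V t0 (F i)"
begin

abbreviation frame :: "'n \<Rightarrow> real^'n \<Rightarrow> real^'n" where "frame \<equiv> frame_field l \<eta>"
abbreviation avg :: "'n \<Rightarrow> real^'n \<Rightarrow> real \<Rightarrow> real" where "avg \<equiv> averaged_coeff l \<eta> F"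

lemma flow_0: "i \<noteq> l \<Longrightarrow> x \<in> V \<Longrightarrow> F i 0 x = x"
  using flow by (simp add: is_flow_def)

lemma flow_solution: "i \<noteq> l \<Longrightarrow> x \<in> V \<Longrightarrow> solution (frame i) U {-t0..t0} (\<lambda>\<tau>. F i \<tau> x)"
  using flow by (simp add: is_flow_def solution_def)

lemma flow_in_U: "i \<noteq> l \<Longrightarrow> x \<in> V \<Longrightarrow> \<tau> \<in> {-t0..t0} \<Longrightarrow> F i \<tau> x \<in> U"
  using flow by (simp add: is_flow_def)

lemma continuous_on_flow: "i \<noteq> l \<Longrightarrow> x \<in> V \<Longrightarrow> continuous_on {-t0..t0} (\<lambda>\<tau>. F i \<tau> x)"
  using C1_field.continuous_on_solution[OF C1_field_frame flow_solution] .

lemma continuous_on_flow_compose: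
  assumes "continuous_on U f" "i \<noteq> l" "x \<in> V"
  shows "continuous_on {-t0..t0} (\<lambda>\<tau>. f (F i \<tau> x))"
  using assms flow_in_U by (intro continuous_on_compose2[OF assms(1) continuous_on_flow]) auto

lemma avg_derivative:
  assumes "i \<noteq> l" "x \<in> V" "t \<in> {-t0..t0}"
  shows "(avg i x has_real_derivative ext_deriv_coeff \<eta> i l (F i t x)) (at t within {-t0..t0})"
proof -
  have "continuous_on {-t0..t0} (\<lambda>\<tau>. - (D (F i \<tau> x) (axis l 1) $ i))"
    using assms by (intro continuous_on_flow_compose continuous_intros continuous_on_D)
  then have "continuous_on {-t0..t0} (\<lambda>\<tau>. ext_deriv_coeff \<eta> i l (F i \<tau> x))"
    by (rule continuous_on_eq) (simp add: ext_deriv_coeff_eq flow_in_U assms)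
  from interval_integral_FTC2[OF _ _ this, of 0 t] t0 assms
  show ?thesis
    by (simp add: averaged_coeff_def[abs_def] has_real_derivative_iff_has_vector_derivative zero_ereal_def)
qed

lemma avg_0: "avg i x 0 = 0"
  by (simp add: averaged_coeff_def)

lemma flow_shift:
  assumes i: "i \<noteq> l" and x: "x \<in> V" "F i \<tau> x \<in> V"
    and t: "\<tau> \<in> {-t0..t0}" "s \<in> {-t0..t0}" "\<tau> + s \<in> {-t0..t0}"
  shows "F i s (F i \<tau> x) = F i (\<tau> + s) x"
proof -
  define a b where "a = max (-t0) (-t0 - \<tau>)" and "b = min t0 (t0 - \<tau>)"
  have sub: "\<tau> + 1 * r \<in> {-t0..t0}" "r \<in> {-t0..t0}" if "r \<in> {a..b}" for r
    using that by (auto simp: a_def b_def)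
  show ?thesis
  proof (rule solution_unique[OF C1_field_frame, of i a b _ _ 0 s])
    show "solution (frame i) U {a..b} (\<lambda>s. F i s (F i \<tau> x))"
      using sub by (intro solution_subset[OF flow_solution[OF i x(2)]]) auto
    show "solution (frame i) U {a..b} (\<lambda>s. F i (\<tau> + s) x)"
      using solution_affine[OF flow_solution[OF i x(1)], of "{a..b}" \<tau> 1] sub(1) by simp
  qed (use t t0 flow_0 i x in \<open>auto simp: a_def b_def\<close>)
qed

text \<open>The averaged coefficient is additive along flow lines: the stretching over the time \<open>\<tau> + s\<close> is the stretching
  over \<open>\<tau>\<close> followed by the stretching over \<open>s\<close> from the point reached.\<close>

lemma avg_shift:
  assumes i: "i \<noteq> l" and x: "x \<in> V" "F i \<tau> x \<in> V"
    and t: "\<tau> \<in> {-t0..t0}" "s \<in> {-t0..t0}" "\<tau> + s \<in> {-t0..t0}"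
  shows "avg i (F i \<tau> x) s = avg i x (\<tau> + s) - avg i x \<tau>"
proof -
  define J where "J = {max (-t0) (-t0 - \<tau>)..min t0 (t0 - \<tau>)}"
  have sub: "\<tau> + 1 * r \<in> {-t0..t0}" "r \<in> {-t0..t0}" if "r \<in> J" for r
    using that by (auto simp: J_def)
  have "\<exists>c. \<forall>r\<in>J. avg i (F i \<tau> x) r - avg i x (\<tau> + r) = c"
  proof (rule has_vector_derivative_zero_constant)
    show "convex J" by (simp add: J_def)
    fix r assume r: "r \<in> J"
    have 1: "(avg i (F i \<tau> x) has_vector_derivative ext_deriv_coeff \<eta> i l (F i r (F i \<tau> x))) (at r within J)"
      using avg_derivative[OF i x(2) sub(2)[OF r]] sub
      unfolding has_real_derivative_iff_has_vector_derivative
      by (auto intro: has_vector_derivative_within_subset)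
    have 2: "((\<lambda>r. avg i x (\<tau> + 1 * r)) has_vector_derivative 1 *\<^sub>R ext_deriv_coeff \<eta> i l (F i (\<tau> + 1 * r) x)) (at r within J)"
      using avg_derivative[OF i x(1) sub(1)[OF r]] sub
      unfolding has_real_derivative_iff_has_vector_derivative
      by (intro has_vector_derivative_affine[where J="{-t0..t0}"]) auto
    have 3: "F i r (F i \<tau> x) = F i (\<tau> + r) x" using sub[OF r] t by (intro flow_shift i x) auto
    show "((\<lambda>r. avg i (F i \<tau> x) r - avg i x (\<tau> + r)) has_vector_derivative 0) (at r within J)"
      using has_vector_derivative_diff[OF 1 2] 3 by simp
  qed blast
  moreover have "0 \<in> J" "s \<in> J" using t t0 by (auto simp: J_def)
  ultimately have "avg i (F i \<tau> x) s - avg i x (\<tau> + s) = avg i (F i \<tau> x) 0 - avg i x (\<tau> + 0)" by metis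
  then show ?thesis by (simp add: avg_0)
qed

end

section \<open>The two estimates for transported vertical vectors\<close>

lemma onorm_line:
  fixes v :: "'a::real_normed_vector"
  assumes "norm v \<le> B"
  shows "onorm (\<lambda>h::real. h *\<^sub>R v) \<le> B"
proof (rule onorm_le)
  show "norm (h *\<^sub>R v) \<le> B * norm h" for h :: real
    using mult_left_mono[OF assms, of "\<bar>h\<bar>"] by (simp add: mult.commute)
qed

context form_flow
begin

text \<open>The vertical vector field \<open>exp (avg i (q 0) t) \<partial>/\<partial>x\<^sup>l\<close> along the flow line solves the variational equation,
  since the horizontal components of the frame field are constant and the logarithmic derivative of this factor
  is the vertical derivative of the vertical component.\<close>

lemma vertical_variation:
  assumes i: "i \<noteq> l" and S: "0 \<in> S" and q: "\<And>h. h \<in> S \<Longrightarrow> q h \<in> V" and t: "t \<in> {-t0..t0}"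
    and dq: "(q has_vector_derivative c *\<^sub>R axis l 1) (at 0 within S)"
  shows "((\<lambda>h. F i t (q h)) has_vector_derivative (c * exp (avg i (q 0) t)) *\<^sub>R axis l 1) (at 0 within S)"
proof (rule solution_variation[OF C1_field_frame, where S=S and a="-t0" and b=t0 and Z="\<lambda>t. (c * exp (avg i (q 0) t)) *\<^sub>R axis l 1"])
  show "solution (frame i) U {-t0..t0} (\<lambda>\<tau>. F i \<tau> (q h))" if "h \<in> S" for h
    by (rule flow_solution[OF i q[OF that]])
  have "((\<lambda>h. F i 0 (q h)) has_vector_derivative c *\<^sub>R axis l 1) (at 0 within S)"
    by (rule has_vector_derivative_transform[OF S _ dq]) (simp add: flow_0[OF i q])
  then show "((\<lambda>h. F i 0 (q h)) has_vector_derivative (c * exp (avg i (q 0) 0)) *\<^sub>R axis l 1) (at 0 within S)"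
    by (simp add: avg_0)
  fix \<tau> assume \<tau>: "\<tau> \<in> {-t0..t0}"
  note B = avg_derivative[OF i q[OF S] \<tau>]
  have "((\<lambda>t. c * exp (avg i (q 0) t)) has_real_derivative
      c * (exp (avg i (q 0) \<tau>) * ext_deriv_coeff \<eta> i l (F i \<tau> (q 0)))) (at \<tau> within {-t0..t0})"
    by (rule DERIV_cmult[OF DERIV_chain2[OF DERIV_exp B]])
  from has_vector_derivative_scaleR[OF this has_vector_derivative_const[of "axis l 1 :: real^'n"]]
  show "((\<lambda>t. (c * exp (avg i (q 0) t)) *\<^sub>R axis l 1) has_vector_derivative
      D_frame i (F i \<tau> (q 0)) ((c * exp (avg i (q 0) \<tau>)) *\<^sub>R axis l 1)) (at \<tau> within {-t0..t0})"
    unfolding ext_deriv_coeff_eq[OF flow_in_U[OF i q[OF S] \<tau>]]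
    by (simp add: D_frame_apply blinfun.scaleR_right mult.assoc)
qed (use S t t0 in auto)

text \<open>The chain rule for \<open>(h, x) \<mapsto> F i (-h) x\<close> along the curve \<open>h \<mapsto> (h, p h)\<close>. At \<open>h = 0\<close> the flow is the identity, so
  only continuity of the flow at time 0 is needed.\<close>

lemma backward_flow_derivative:
  assumes i: "i \<noteq> l" and S: "0 \<in> S" and p: "\<And>h. h \<in> S \<Longrightarrow> p h \<in> V" and St: "S \<subseteq> {-t0..t0}"
    and dp: "(p has_vector_derivative v) (at 0 within S)"
  shows "((\<lambda>h. F i (-h) (p h)) has_vector_derivative v - frame i (p 0)) (at 0 within S)"
  unfolding has_vector_derivative_def has_derivative_within_alt
proof (intro conjI allI impI)
  define x where "x = p 0"
  have x: "x \<in> V" using p S by (simp add: x_def)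
  show "bounded_linear (\<lambda>h. h *\<^sub>R (v - frame i (p 0)))" by (rule bounded_linear_scaleR_left)
  fix e :: real assume "e > 0"
  have xU: "x \<in> U" using flow_in_U[OF i x, of 0] t0 flow_0[OF i x] by simp
  have "continuous (at x) (frame i)"
    using has_derivative_continuous[OF C1_field.derivative[OF C1_field_frame xU]] .
  then obtain d1 where d1: "d1 > 0" "\<And>y. norm (y - x) < d1 \<Longrightarrow> norm (frame i y - frame i x) < e/2"
    using half_gt_zero[OF \<open>e > 0\<close>] unfolding continuous_at_eps_delta dist_norm by blast
  obtain d2 where d2: "d2 > 0" "\<And>p r. p \<in> V \<Longrightarrow> norm (p - x) < d2 \<Longrightarrow> \<bar>r\<bar> < d2 \<Longrightarrow> norm (F i r p - x) < d1"
    using flow_continuous_at_0[OF C1_field_frame x t0 flow_solution[OF i] flow_0[OF i] d1(1)] by blast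
  obtain d3 where d3: "d3 > 0" "\<And>h. h \<in> S \<Longrightarrow> \<bar>h\<bar> < d3 \<Longrightarrow> norm (p h - x) < d2"
    using has_vector_derivative_continuous[OF dp] d2(1)
    unfolding continuous_within_eps_delta dist_norm x_def by auto
  obtain d4 where d4: "d4 > 0" "\<And>h. h \<in> S \<Longrightarrow> \<bar>h\<bar> < d4 \<Longrightarrow> norm (p h - x - h *\<^sub>R v) \<le> (e/2) * \<bar>h\<bar>"
    using dp half_gt_zero[OF \<open>e > 0\<close>] unfolding has_vector_derivative_def has_derivative_within_alt x_def by fastforce
  show "\<exists>d>0. \<forall>h\<in>S. norm (h - 0) < d \<longrightarrow>
      norm (F i (-h) (p h) - F i (-0) (p 0) - (h - 0) *\<^sub>R (v - frame i (p 0))) \<le> e * norm (h - 0)"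
  proof (intro exI[of _ "min d2 (min d3 d4)"] conjI ballI impI)
    show "0 < min d2 (min d3 d4)" using d2 d3 d4 by simp
    fix h assume h: "h \<in> S" "norm (h - 0) < min d2 (min d3 d4)"
    define f where "f r = F i r (p h) - r *\<^sub>R frame i x" for r
    have "norm (f 0 - f (-h)) \<le> (e/2) * norm (0 - (-h))"
    proof (rule differentiable_bound[of "closed_segment 0 (-h)" f "\<lambda>r s. s *\<^sub>R (frame i (F i r (p h)) - frame i x)"])
      fix r assume r: "r \<in> closed_segment 0 (-h)"
      then have rh: "\<bar>r\<bar> \<le> \<bar>h\<bar>" using segment_bound(1)[OF r] by simp
      have sub: "closed_segment 0 (-h) \<subseteq> {-t0..t0}"
        using h(1) St t0 by (intro closed_segment_subset) auto
      have "((\<lambda>r. F i r (p h)) has_vector_derivative frame i (F i r (p h))) (at r within closed_segment 0 (-h))"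
        using solution_subset[OF flow_solution[OF i p[OF h(1)]] sub] r by (simp add: solution_def)
      then have "(f has_vector_derivative frame i (F i r (p h)) - frame i x) (at r within closed_segment 0 (-h))"
        unfolding f_def by (rule has_vector_derivative_diff)
          (auto simp: has_vector_derivative_def intro!: derivative_eq_intros)
      then show "(f has_derivative (\<lambda>s. s *\<^sub>R (frame i (F i r (p h)) - frame i x))) (at r within closed_segment 0 (-h))"
        by (simp add: has_vector_derivative_def)
      have "norm (frame i (F i r (p h)) - frame i x) < e/2"
        using rh h by (intro d1 d2 p d3) auto
      then show "onorm (\<lambda>s. s *\<^sub>R (frame i (F i r (p h)) - frame i x)) \<le> e/2"
        by (intro onorm_line) simp
    qed auto
    then have 1: "norm (F i (-h) (p h) - p h + h *\<^sub>R frame i x) \<le> (e/2) * \<bar>h\<bar>"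
      by (simp add: f_def flow_0[OF i p[OF h(1)]] norm_minus_commute algebra_simps)
    have 2: "norm (p h - x - h *\<^sub>R v) \<le> (e/2) * \<bar>h\<bar>" using d4(2) h by auto
    have "F i (-h) (p h) - F i (-0) (p 0) - (h - 0) *\<^sub>R (v - frame i (p 0))
       = (F i (-h) (p h) - p h + h *\<^sub>R frame i x) + (p h - x - h *\<^sub>R v)"
      by (simp add: x_def[symmetric] flow_0[OF i x] algebra_simps)
    also have "norm \<dots> \<le> (e/2) * \<bar>h\<bar> + (e/2) * \<bar>h\<bar>" by (rule norm_triangle_mono[OF 1 2])
    finally show "norm (F i (-h) (p h) - F i (-0) (p 0) - (h - 0) *\<^sub>R (v - frame i (p 0))) \<le> e * norm (h - 0)"
      by simp
  qed
qed

text \<open>The curve \<open>w s = F i (t - s) (\<gamma> s)\<close> leads from \<open>F i t (\<gamma> 0)\<close> to \<open>\<gamma> t\<close>. Its velocity measures by how much \<open>\<gamma>\<close> deviates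
  from the flow line through \<open>\<gamma> s\<close>; this deviation is vertical, and the flow multiplies it by the exponential
  factor. Hence \<open>\<epsilon>\<close> bounds the speed of \<open>w\<close>.\<close>

lemma curve_flow_comparison:
  fixes \<eta>' :: "real^'n \<Rightarrow> real^'n"
  assumes i: "i \<noteq> l" and t: "t \<in> {-t0..t0}"
    and \<gamma>: "\<And>s. s \<in> closed_segment 0 t \<Longrightarrow> \<gamma> s \<in> V"
    and d\<gamma>: "\<And>s. s \<in> closed_segment 0 t \<Longrightarrow>
        (\<gamma> has_vector_derivative axis i 1 - (\<eta>' (\<gamma> s) $ i) *\<^sub>R axis l 1) (at s within closed_segment 0 t)"
    and small: "\<And>s. s \<in> closed_segment 0 t \<Longrightarrow>
        \<bar>(\<eta> (\<gamma> s) - \<eta>' (\<gamma> s)) $ i\<bar> * exp (avg i (\<gamma> s) (t - s)) \<le> \<epsilon>"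
  shows "norm (\<gamma> t - F i t (\<gamma> 0)) \<le> \<epsilon> * \<bar>t\<bar>"
proof -
  define I where "I = closed_segment 0 t"
  define w where "w s = F i (t - s) (\<gamma> s)" for s
  define c where "c s = (\<eta> (\<gamma> s) - \<eta>' (\<gamma> s)) $ i" for s
  have I: "\<bar>s - s'\<bar> \<le> \<bar>t\<bar>" if "s \<in> I" "s' \<in> I" for s s'
    using that unfolding I_def by (auto simp: closed_segment_eq_real_ivl split: if_splits)
  have tI: "0 \<in> I" "t \<in> I" by (auto simp: I_def)
  have dw: "(w has_vector_derivative (c s * exp (avg i (\<gamma> s) (t - s))) *\<^sub>R axis l 1) (at s within I)"
    if s: "s \<in> I" for s
  proof -
    define S where "S = {h. s + 1 * h \<in> I}"
    define p where "p h = \<gamma> (s + 1 * h)" for h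
    have V: "\<gamma> s \<in> V" using \<gamma> s by (simp add: I_def)
    have pV: "p h \<in> V" if "h \<in> S" for h using that \<gamma> by (auto simp: S_def p_def I_def)
    have S0: "0 \<in> S" using s by (simp add: S_def)
    have St: "\<bar>h\<bar> \<le> \<bar>t\<bar>" if "h \<in> S" for h using I[of s "s + h"] that s by (auto simp: S_def)
    have tt: "\<bar>t\<bar> \<le> t0" using t by auto
    have St0: "S \<subseteq> {-t0..t0}" using St tt by force
    have dp: "(p has_vector_derivative 1 *\<^sub>R (axis i 1 - (\<eta>' (\<gamma> s) $ i) *\<^sub>R axis l 1)) (at 0 within S)"
      unfolding p_def using d\<gamma>[of s] s
      by (intro has_vector_derivative_affine[where J=I]) (auto simp: S_def I_def)
    \<comment> \<open>By the group law \<open>w (s + h) = F i (t - s) (q h)\<close>, so that the outer flow time does not depend on \<open>h\<close>. The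
      horizontal parts of \<open>\<gamma>\<close> and of the flow cancel in \<open>q\<close>, which starts with a vertical velocity.\<close>
    define q where "q h = F i (-h) (p h)" for h
    have \<gamma>U: "\<gamma> s \<in> U" using flow_in_U[OF i V, of 0] t0 flow_0[OF i V] by simp
    have dq: "(q has_vector_derivative c s *\<^sub>R axis l 1) (at 0 within S)"
      using backward_flow_derivative[OF i S0 pV St0 dp]
      unfolding q_def by (simp add: p_def frame_field_eq[OF \<gamma>U] c_def algebra_simps)
    have q0: "q 0 = \<gamma> s" by (simp add: q_def p_def flow_0[OF i V])
    obtain e where e: "e > 0" "\<And>y. dist y (\<gamma> s) < e \<Longrightarrow> y \<in> V"
      using open_V V unfolding open_dist by blast
    obtain d where d: "d > 0" "\<And>h. h \<in> S \<Longrightarrow> \<bar>h\<bar> < d \<Longrightarrow> q h \<in> V"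
      using has_vector_derivative_continuous[OF dq] e
      unfolding continuous_within_eps_delta q0[symmetric] by (auto simp: dist_norm)
    \<comment> \<open>The flow is defined on \<open>V\<close> only, and \<open>q h\<close> is known to lie in \<open>V\<close> only for small \<open>h\<close>.\<close>
    define S' where "S' = S \<inter> {-d<..<d}"
    have at: "at 0 within S = at 0 within S'"
      by (rule at_within_nhd[of _ "{-d<..<d}"]) (use d in \<open>auto simp: S'_def\<close>)
    have "((\<lambda>h. F i (t - s) (q h)) has_vector_derivative (c s * exp (avg i (q 0) (t - s))) *\<^sub>R axis l 1) (at 0 within S')"
    proof (rule vertical_variation[OF i])
      show "0 \<in> S'" using S0 d by (simp add: S'_def)
      show "q h \<in> V" if "h \<in> S'" for h using d(2)[of h] that by (auto simp: S'_def)
      show "t - s \<in> {-t0..t0}" using I[OF s tI(2)] tt by auto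
      show "(q has_vector_derivative c s *\<^sub>R axis l 1) (at 0 within S')"
        using dq at by simp
    qed
    then have "((\<lambda>h. w (s + h)) has_vector_derivative (c s * exp (avg i (q 0) (t - s))) *\<^sub>R axis l 1) (at 0 within S')"
    proof (rule has_vector_derivative_transform[rotated 2])
      show "0 \<in> S'" using S0 d by (simp add: S'_def)
      fix h assume h: "h \<in> S'"
      then have hS: "h \<in> S" "\<bar>h\<bar> < d" by (auto simp: S'_def)
      have "F i (t - s) (F i (-h) (p h)) = F i (-h + (t - s)) (p h)"
      proof (rule flow_shift[OF i])
        show "p h \<in> V" by (rule pV[OF hS(1)])
        show "F i (-h) (p h) \<in> V" using d(2)[OF hS] by (simp add: q_def)
        show "-h \<in> {-t0..t0}" using St[OF hS(1)] tt by auto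
        show "t - s \<in> {-t0..t0}" using I[OF s tI(2)] tt by auto
        show "-h + (t - s) \<in> {-t0..t0}" using I[of "s+h" t] tt hS tI by (auto simp: S_def)
      qed
      then show "w (s + h) = F i (t - s) (q h)"
        by (simp add: w_def q_def p_def algebra_simps)
    qed
    then have "((\<lambda>h. w (s + h)) has_vector_derivative (c s * exp (avg i (\<gamma> s) (t - s))) *\<^sub>R axis l 1) (at (-s + 1 * s) within S)"
      using at q0 by simp
    from has_vector_derivative_affine[OF this, of I] show ?thesis by (simp add: S_def)
  qed
  have "norm (w t - w 0) \<le> \<epsilon> * norm (t - 0)"
  proof (rule differentiable_bound[of I w])
    show "(w has_derivative (\<lambda>h. h *\<^sub>R (c s * exp (avg i (\<gamma> s) (t - s))) *\<^sub>R axis l 1)) (at s within I)" if "s \<in> I" for s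
      using dw[OF that] by (simp add: has_vector_derivative_def)
    show "onorm (\<lambda>h::real. h *\<^sub>R (c s * exp (avg i (\<gamma> s) (t - s))) *\<^sub>R (axis l 1 :: real^'n)) \<le> \<epsilon>" if "s \<in> I" for s
      using small[of s] that
      by (intro onorm_line) (simp add: I_def c_def abs_mult norm_axis_1)
  qed (auto simp: I_def)
  moreover have "w t = \<gamma> t" using flow_0[OF i \<gamma>[of t]] by (simp add: w_def)
  ultimately show ?thesis by (simp add: w_def)
qed

text \<open>The defect \<open>E\<close> between the derivative in \<open>s\<close> and the frame field \<open>frame i\<close> solves a linear equation, whose
  homogeneous part is the vertical part of the variational equation and whose source is the bracket of the two
  frame fields. By variation of constants, \<open>E\<close> is the integral of the brackets along the flow line, each
  multiplied by the stretching factor for the remaining time \<open>t - \<tau>\<close>.\<close>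

lemma composed_flow_derivative:
  assumes i: "i \<noteq> l" and j: "j \<noteq> l" and x: "x \<in> V"
    and S: "S \<subseteq> {-t0..t0}" "\<And>s. s \<in> S \<Longrightarrow> F i s x \<in> V" and s: "s \<in> S" and t: "t \<in> {-t0..t0}"
    and small: "\<And>\<tau>. \<tau> \<in> closed_segment 0 t \<Longrightarrow>
        F j \<tau> (F i s x) \<in> V \<and>
        \<bar>ext_deriv \<eta> (F j \<tau> (F i s x)) (frame i (F j \<tau> (F i s x))) (frame j (F j \<tau> (F i s x)))\<bar>
          * exp (avg j (F j \<tau> (F i s x)) (t - \<tau>)) \<le> \<epsilon>"
  shows "\<exists>E. ((\<lambda>s. F j t (F i s x)) has_vector_derivative
            frame i (F j t (F i s x)) + E *\<^sub>R axis l 1) (at s within S) \<and> \<bar>E\<bar> \<le> \<epsilon> * \<bar>t\<bar>"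
proof -
  define p where "p = F i s x"
  define q where "q \<tau> = F j \<tau> p" for \<tau>
  define B where "B = avg j p"
  define c where "c \<tau> = - ext_deriv \<eta> (q \<tau>) (frame i (q \<tau>)) (frame j (q \<tau>))" for \<tau>
  have p: "p \<in> V" using S s by (simp add: p_def)
  have qU: "q \<tau> \<in> U" if "\<tau> \<in> {-t0..t0}" for \<tau> using flow_in_U[OF j p that] by (simp add: q_def)
  \<comment> \<open>Variation of constants: \<open>exp (B \<tau>)\<close> solves the homogeneous equation.\<close>
  define J where "J \<tau> = (LBINT r=ereal 0..ereal \<tau>. c r * exp (- B r))" for \<tau>
  define E where "E \<tau> = exp (B \<tau>) * J \<tau>" for \<tau>
  have contf: "continuous_on U (frame k)" for k
    by (intro continuous_at_imp_continuous_on ballI has_derivative_continuous[OF C1_field.derivative[OF C1_field_frame]])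
  have contB: "continuous_on {-t0..t0} B"
    unfolding B_def by (rule DERIV_continuous_on) (rule avg_derivative[OF j p])
  have "continuous_on {-t0..t0} (\<lambda>\<tau>. - (D (q \<tau>) (frame i (q \<tau>)) $ j - D (q \<tau>) (frame j (q \<tau>)) $ i))"
    unfolding q_def
    by (intro continuous_on_flow_compose[OF _ j p] continuous_intros continuous_on_D contf)
  then have "continuous_on {-t0..t0} c"
    by (rule continuous_on_eq) (simp add: c_def ext_deriv_frame qU)
  then have "continuous_on {-t0..t0} (\<lambda>r. c r * exp (- B r))"
    by (intro continuous_intros contB)
  then have dJ: "(J has_vector_derivative c \<tau> * exp (- B \<tau>)) (at \<tau> within {-t0..t0})" if "\<tau> \<in> {-t0..t0}" for \<tau>
    using interval_integral_FTC2[of "-t0" 0 t0 "\<lambda>r. c r * exp (- B r)" \<tau>] t0 that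
    unfolding J_def by (simp add: zero_ereal_def)
  have J0: "J 0 = 0" by (simp add: J_def)
  have dB: "(B has_real_derivative ext_deriv_coeff \<eta> j l (q \<tau>)) (at \<tau> within {-t0..t0})" if "\<tau> \<in> {-t0..t0}" for \<tau>
    using avg_derivative[OF j p that] by (simp add: B_def q_def)
  have dE: "(E has_real_derivative - (D (q \<tau>) (axis l 1) $ j) * E \<tau> + c \<tau>) (at \<tau> within {-t0..t0})" if "\<tau> \<in> {-t0..t0}" for \<tau>
  proof -
    have "(E has_real_derivative exp (B \<tau>) * ext_deriv_coeff \<eta> j l (q \<tau>) * J \<tau> + c \<tau> * exp (- B \<tau>) * exp (B \<tau>)) (at \<tau> within {-t0..t0})"
      unfolding E_def[abs_def]
      by (rule DERIV_mult[OF DERIV_chain2[OF DERIV_exp dB[OF that]]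
            dJ[OF that, unfolded has_real_derivative_iff_has_vector_derivative[symmetric]]])
    moreover have "exp (B \<tau>) * ext_deriv_coeff \<eta> j l (q \<tau>) * J \<tau> + c \<tau> * exp (- B \<tau>) * exp (B \<tau>)
        = - (D (q \<tau>) (axis l 1) $ j) * E \<tau> + c \<tau>"
    proof -
      have "exp (- B \<tau>) * exp (B \<tau>) = 1" unfolding exp_add[symmetric] by simp
      then show ?thesis by (simp add: ext_deriv_coeff_eq[OF qU[OF that]] E_def mult.assoc)
    qed
    ultimately show ?thesis by (simp only:)
  qed
  define Sh where "Sh = {h. s + 1 * h \<in> S}"
  have var: "((\<lambda>h. F j t (F i (s + 1 * h) x)) has_vector_derivative frame i (q t) + E t *\<^sub>R axis l 1) (at 0 within Sh)"
  proof (rule solution_variation[OF C1_field_frame, where S=Sh and a="-t0" and b=t0 and Z="\<lambda>\<tau>. frame i (q \<tau>) + E \<tau> *\<^sub>R axis l 1"])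
    show sol: "solution (frame j) U {-t0..t0} (\<lambda>\<tau>. F j \<tau> (F i (s + 1 * h) x))" if "h \<in> Sh" for h
      using that S by (intro flow_solution j) (auto simp: Sh_def)
    show "0 \<in> Sh" using s by (simp add: Sh_def)
    have "((\<lambda>h. F i (s + 1 * h) x) has_vector_derivative 1 *\<^sub>R frame i p) (at 0 within Sh)"
      by (rule has_vector_derivative_affine[where J=S])
         (use flow_solution[OF i x] S s in \<open>auto simp: solution_def p_def Sh_def intro: has_vector_derivative_within_subset\<close>)
    then show "((\<lambda>h. F j 0 (F i (s + 1 * h) x)) has_vector_derivative frame i (q 0) + E 0 *\<^sub>R axis l 1) (at 0 within Sh)"
      by (rule has_vector_derivative_transform[rotated 2, THEN has_vector_derivative_eq_rhs])
         (use S s p in \<open>auto simp: Sh_def flow_0[OF j] E_def J0 q_def\<close>)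
    fix \<tau> assume \<tau>: "\<tau> \<in> {-t0..t0}"
    have "(q has_vector_derivative frame j (q \<tau>)) (at \<tau> within {-t0..t0})"
      using flow_solution[OF j p] \<tau> unfolding solution_def q_def[abs_def] by blast
    then have "((\<lambda>\<tau>. frame i (q \<tau>)) has_vector_derivative D_frame i (q \<tau>) (frame j (q \<tau>))) (at \<tau> within {-t0..t0})"
      using has_derivative_compose[of q "\<lambda>h. h *\<^sub>R frame j (q \<tau>)" \<tau> "{-t0..t0}" "frame i" "D_frame i (q \<tau>)"]
        C1_field.derivative[OF C1_field_frame, of "q \<tau>" i] qU[OF \<tau>]
      by (simp add: has_vector_derivative_def blinfun.scaleR_right)
    moreover have "((\<lambda>\<tau>. E \<tau> *\<^sub>R (axis l 1 :: real^'n)) has_vector_derivative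
        (- (D (q \<tau>) (axis l 1) $ j) * E \<tau> + c \<tau>) *\<^sub>R axis l 1) (at \<tau> within {-t0..t0})"
      using has_vector_derivative_scaleR[OF dE[OF \<tau>] has_vector_derivative_const[of "axis l 1 :: real^'n"]] by simp
    ultimately have "((\<lambda>\<tau>. frame i (q \<tau>) + E \<tau> *\<^sub>R axis l 1) has_vector_derivative
        D_frame i (q \<tau>) (frame j (q \<tau>)) + (- (D (q \<tau>) (axis l 1) $ j) * E \<tau> + c \<tau>) *\<^sub>R axis l 1) (at \<tau> within {-t0..t0})"
      by (rule has_vector_derivative_add)
    moreover have "D_frame i (q \<tau>) (frame j (q \<tau>)) + (- (D (q \<tau>) (axis l 1) $ j) * E \<tau> + c \<tau>) *\<^sub>R axis l 1
        = D_frame j (q \<tau>) (frame i (q \<tau>) + E \<tau> *\<^sub>R axis l 1)"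
    proof -
      have "c \<tau> = D (q \<tau>) (frame j (q \<tau>)) $ i - D (q \<tau>) (frame i (q \<tau>)) $ j"
        by (simp add: c_def ext_deriv_frame[OF qU[OF \<tau>]])
      then have "- (D (q \<tau>) (frame j (q \<tau>)) $ i) + (- (D (q \<tau>) (axis l 1) $ j) * E \<tau> + c \<tau>)
          = - (D (q \<tau>) (frame i (q \<tau>) + E \<tau> *\<^sub>R axis l 1) $ j)"
        by (simp add: blinfun.add_right blinfun.scaleR_right mult.commute)
      then show ?thesis unfolding D_frame_apply scaleR_add_left[symmetric] by (rule arg_cong)
    qed
    ultimately show "((\<lambda>\<tau>. frame i (q \<tau>) + E \<tau> *\<^sub>R axis l 1) has_vector_derivative
        D_frame j (F j \<tau> (F i (s + 1 * 0) x)) (frame i (q \<tau>) + E \<tau> *\<^sub>R axis l 1)) (at \<tau> within {-t0..t0})"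
      by (simp add: p_def[symmetric] q_def[symmetric])
  qed (use t t0 in auto)
  have "((\<lambda>s. F j t (F i s x)) has_vector_derivative frame i (q t) + E t *\<^sub>R axis l 1) (at s within S)"
    using has_vector_derivative_affine[of "\<lambda>h. F j t (F i (s + 1 * h) x)" _ "-s" 1 s Sh S] var
    by (simp add: Sh_def)
  moreover have "\<bar>E t\<bar> \<le> \<epsilon> * \<bar>t\<bar>"
  proof -
    have sub: "closed_segment 0 t \<subseteq> {-t0..t0}" using t t0 by (intro closed_segment_subset) auto
    have "norm (J t - J 0) \<le> (\<epsilon> * exp (- B t)) * norm (t - 0)"
    proof (rule differentiable_bound[of "closed_segment 0 t" J])
      fix \<tau> assume \<tau>: "\<tau> \<in> closed_segment 0 t"
      then have \<tau>0: "\<tau> \<in> {-t0..t0}" using sub by blast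
      show "(J has_derivative (\<lambda>h. h *\<^sub>R (c \<tau> * exp (- B \<tau>)))) (at \<tau> within closed_segment 0 t)"
        using has_vector_derivative_within_subset[OF dJ[OF \<tau>0] sub] by (simp add: has_vector_derivative_def)
      have "F j \<tau> p \<in> V" using small[OF \<tau>] by (simp add: p_def)
      moreover have "t - \<tau> \<in> {-t0..t0}"
        using \<tau> t by (auto simp: closed_segment_eq_real_ivl split: if_splits)
      ultimately have "avg j (q \<tau>) (t - \<tau>) = B t - B \<tau>"
        using avg_shift[OF j p _ \<tau>0, of "t - \<tau>"] t by (simp add: q_def B_def)
      then have "\<bar>c \<tau>\<bar> * exp (B t - B \<tau>) \<le> \<epsilon>" using small[OF \<tau>] by (simp add: c_def q_def p_def)
      then have "\<bar>c \<tau>\<bar> * exp (B t - B \<tau>) * exp (- B t) \<le> \<epsilon> * exp (- B t)" by (rule mult_right_mono) simp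
      moreover have "exp (B t - B \<tau>) * exp (- B t) = exp (- B \<tau>)" unfolding exp_add[symmetric] by simp
      ultimately have *: "\<bar>c \<tau>\<bar> * exp (- B \<tau>) \<le> \<epsilon> * exp (- B t)" by (simp only: mult.assoc)
      show "onorm (\<lambda>h. h *\<^sub>R (c \<tau> * exp (- B \<tau>))) \<le> \<epsilon> * exp (- B t)"
        using * by (intro onorm_line) (simp only: real_norm_def abs_mult abs_exp_cancel)
    qed (rule convex_closed_segment ends_in_segment)+
    then have J: "\<bar>J t\<bar> \<le> \<epsilon> * exp (- B t) * \<bar>t\<bar>" by (simp only: J0 real_norm_def diff_0_right)
    have alg: "a * (e * b * c) = (a * b) * (e * c)" for a b c e :: real by (simp add: mult_ac)
    from J have "exp (B t) * \<bar>J t\<bar> \<le> exp (B t) * (\<epsilon> * exp (- B t) * \<bar>t\<bar>)"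
      by (rule mult_left_mono) (rule exp_ge_zero)
    also have "\<dots> = (exp (B t) * exp (- B t)) * (\<epsilon> * \<bar>t\<bar>)"
      by (rule alg)
    also have "exp (B t) * exp (- B t) = 1" unfolding exp_add[symmetric] by simp
    finally show ?thesis by (simp only: E_def abs_mult abs_exp_cancel mult_1)
  qed
  ultimately show ?thesis by (auto simp: q_def p_def)
qed

end

section \<open>Norms of forms on compact sets\<close>

text \<open>The components of a continuous Riemannian metric in a chart with image \<open>U\<close>.\<close>

locale coordinate_metric =
  fixes G :: "real^'n::finite \<Rightarrow> real^'n \<Rightarrow> real^'n \<Rightarrow> real" and U :: "(real^'n) set"
  assumes bilinear: "\<And>x. x \<in> U \<Longrightarrow> bilinear (G x)"
    and positive: "\<And>x u. x \<in> U \<Longrightarrow> u \<noteq> 0 \<Longrightarrow> 0 < G x u u"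
    and continuous: "\<And>u v. continuous_on U (\<lambda>x. G x u v)"
begin

lemma scale: "x \<in> U \<Longrightarrow> G x (a *\<^sub>R u) (a *\<^sub>R u) = a\<^sup>2 * G x u u"
  using bilinear by (simp add: bilinear_lmul bilinear_rmul power2_eq_square)

lemma upper_bound:
  assumes K: "compact K" "K \<subseteq> U"
  obtains C where "C > 0" "\<And>x u. x \<in> K \<Longrightarrow> G x u u \<le> (C * norm u)\<^sup>2"
proof -
  define f where "f x = (\<Sum>(a, b)\<in>Basis \<times> Basis. \<bar>G x a b\<bar>)" for x
  have "continuous_on K f"
    unfolding f_def split_def using continuous K by (intro continuous_intros) (auto intro: continuous_on_subset)
  then have "bounded (f ` K)" by (intro compact_imp_bounded compact_continuous_image K)
  then obtain m where m: "\<And>x. x \<in> K \<Longrightarrow> f x \<le> m"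
    unfolding bounded_iff real_norm_def using abs_le_D1 by blast
  show ?thesis
  proof (rule that[of "sqrt (\<bar>m\<bar> + 1)"])
    fix x u assume x: "x \<in> K"
    have "G x u u = G x (\<Sum>a\<in>Basis. (u \<bullet> a) *\<^sub>R a) (\<Sum>b\<in>Basis. (u \<bullet> b) *\<^sub>R b)"
      by (simp add: euclidean_representation)
    also have "\<dots> = (\<Sum>(a, b)\<in>Basis \<times> Basis. (u \<bullet> a) * ((u \<bullet> b) * G x a b))"
      using bilinear[of x] x K
      by (subst bilinear_sum) (auto simp: bilinear_lmul bilinear_rmul)
    also have "\<dots> \<le> (\<Sum>(a, b)\<in>Basis \<times> Basis. (norm u)\<^sup>2 * \<bar>G x a b\<bar>)"
    proof (intro sum_mono, clarify)
      fix a b :: "real^'n" assume ab: "a \<in> Basis" "b \<in> Basis"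
      have "(u \<bullet> a) * ((u \<bullet> b) * G x a b) \<le> \<bar>u \<bullet> a\<bar> * (\<bar>u \<bullet> b\<bar> * \<bar>G x a b\<bar>)"
        by (simp add: abs_mult[symmetric])
      also have "\<dots> \<le> norm u * (norm u * \<bar>G x a b\<bar>)"
        by (intro mult_mono Basis_le_norm ab) auto
      finally show "(u \<bullet> a) * ((u \<bullet> b) * G x a b) \<le> (norm u)\<^sup>2 * \<bar>G x a b\<bar>"
        by (simp add: power2_eq_square mult.assoc)
    qed
    also have "\<dots> = (norm u)\<^sup>2 * f x" by (simp add: f_def sum_distrib_left split_def)
    also have "\<dots> \<le> (norm u)\<^sup>2 * (\<bar>m\<bar> + 1)" using m[OF x] by (intro mult_left_mono) auto
    finally show "G x u u \<le> (sqrt (\<bar>m\<bar> + 1) * norm u)\<^sup>2"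
      by (simp add: power_mult_distrib mult.commute)
  qed simp
qed

text \<open>By compactness of the Euclidean unit sphere. This makes the suprema defining the norms of forms finite,
  so that they really are upper bounds.\<close>

lemma unit_ball_bounded:
  assumes x: "x \<in> U"
  obtains R where "R > 0" "\<And>u. G x u u \<le> 1 \<Longrightarrow> norm u \<le> R"
proof -
  have "bounded_bilinear (G x)" using bilinear[OF x] by (simp add: bilinear_conv_bounded_bilinear)
  then have cont: "continuous_on (sphere 0 1) (\<lambda>u. G x u u)"
    by (rule bounded_bilinear.continuous_on[OF _ continuous_on_id continuous_on_id])
  have ne: "sphere 0 1 \<noteq> ({} :: (real^'n) set)"
    using norm_axis_1 by (metis empty_iff mem_sphere_0)
  obtain v where v: "v \<in> sphere 0 1" "\<And>u. u \<in> sphere 0 1 \<Longrightarrow> G x v v \<le> G x u u"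
    using continuous_attains_inf[OF compact_sphere ne cont] by blast
  define m where "m = G x v v"
  have "m > 0" unfolding m_def by (rule positive[OF x]) (use v in auto)
  have lower: "m * (norm u)\<^sup>2 \<le> G x u u" for u
  proof (cases "u = 0")
    case True then show ?thesis using bilinear[OF x] by (simp add: bilinear_lzero)
  next
    case False
    have "m \<le> G x ((1 / norm u) *\<^sub>R u) ((1 / norm u) *\<^sub>R u)"
      unfolding m_def by (rule v(2)) (use False in simp)
    also have "\<dots> = (1 / norm u)\<^sup>2 * G x u u" by (rule scale[OF x])
    finally show ?thesis using False by (simp add: field_simps power2_eq_square)
  qed
  show ?thesis
  proof (rule that[of "1 / sqrt m"])
    fix u assume "G x u u \<le> 1"
    then have "m * (norm u)\<^sup>2 \<le> 1" using lower[of u] by simp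
    then have "(norm u)\<^sup>2 \<le> (1 / sqrt m)\<^sup>2" using \<open>m > 0\<close> by (simp add: field_simps power_divide)
    then show "norm u \<le> 1 / sqrt m" by (rule power2_le_imp_le) (use \<open>m > 0\<close> in simp)
  qed (use \<open>m > 0\<close> in simp)
qed

lemma norm_1form_upper:
  assumes x: "x \<in> U" and u: "G x u u \<le> 1"
  shows "\<bar>\<alpha> \<bullet> u\<bar> \<le> norm_1form (G x) \<alpha>"
  unfolding norm_1form_def
proof (rule cSup_upper)
  obtain R where R: "R > 0" "\<And>u. G x u u \<le> 1 \<Longrightarrow> norm u \<le> R" using unit_ball_bounded[OF x] by metis
  show "bdd_above {\<bar>\<alpha> \<bullet> u\<bar> |u. G x u u \<le> 1}"
  proof (rule bdd_aboveI)
    fix y assume "y \<in> {\<bar>\<alpha> \<bullet> u\<bar> |u. G x u u \<le> 1}"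
    then obtain u where u: "y = \<bar>\<alpha> \<bullet> u\<bar>" "G x u u \<le> 1" by blast
    have "y \<le> norm \<alpha> * norm u" unfolding u by (rule Cauchy_Schwarz_ineq2)
    also have "\<dots> \<le> norm \<alpha> * R" by (intro mult_left_mono R u) simp
    finally show "y \<le> norm \<alpha> * R" .
  qed
qed (use u in blast)

lemma norm_1form_nonneg: "x \<in> U \<Longrightarrow> 0 \<le> norm_1form (G x) \<alpha>"
  using norm_1form_upper[of x 0 \<alpha>] bilinear[of x] by (simp add: bilinear_lzero)

lemma norm_1form_bound:
  assumes x: "x \<in> U" and C: "C > 0" "G x u u \<le> (C * norm u)\<^sup>2"
  shows "\<bar>\<alpha> \<bullet> u\<bar> \<le> C * norm u * norm_1form (G x) \<alpha>"
proof (cases "u = 0")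
  case False
  have "G x ((1 / (C * norm u)) *\<^sub>R u) ((1 / (C * norm u)) *\<^sub>R u) \<le> 1"
    unfolding scale[OF x] using C False by (simp add: field_simps)
  from norm_1form_upper[OF x this, of \<alpha>] show ?thesis
    using C False by (simp add: field_simps abs_mult)
qed simp

lemma norm_3form_upper:
  assumes x: "x \<in> U" and B: "\<And>u v w. \<bar>\<omega> u v w\<bar> \<le> B * (norm u * norm v * norm w)"
    and u: "G x u u \<le> 1" "G x v v \<le> 1" "G x w w \<le> 1"
  shows "\<bar>\<omega> u v w\<bar> \<le> norm_3form (G x) \<omega>"
  unfolding norm_3form_def
proof (rule cSup_upper)
  obtain R where R: "R > 0" "\<And>u. G x u u \<le> 1 \<Longrightarrow> norm u \<le> R" using unit_ball_bounded[OF x] by metis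
  show "bdd_above {\<bar>\<omega> u v w\<bar> |u v w. G x u u \<le> 1 \<and> G x v v \<le> 1 \<and> G x w w \<le> 1}"
  proof (rule bdd_aboveI)
    fix y assume "y \<in> {\<bar>\<omega> u v w\<bar> |u v w. G x u u \<le> 1 \<and> G x v v \<le> 1 \<and> G x w w \<le> 1}"
    then obtain u v w where u: "y = \<bar>\<omega> u v w\<bar>" "G x u u \<le> 1" "G x v v \<le> 1" "G x w w \<le> 1" by blast
    have "y \<le> B * (norm u * norm v * norm w)" unfolding u by (rule B)
    also have "\<dots> \<le> \<bar>B\<bar> * (norm u * norm v * norm w)" by (intro mult_right_mono) auto
    also have "\<dots> \<le> \<bar>B\<bar> * (R * R * R)" using R by (intro mult_left_mono mult_mono R u) auto
    finally show "y \<le> \<bar>B\<bar> * (R * R * R)" .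
  qed
qed (use u in blast)

text \<open>With \<open>upper_bound\<close>, which gives one constant \<open>C\<close> for all points of a compact set, this controls the values of
  a form uniformly on that set, although the metric may degenerate towards the boundary of \<open>U\<close>.\<close>

lemma norm_3form_bound:
  assumes x: "x \<in> U" and B: "\<And>u v w. \<bar>\<omega> u v w\<bar> \<le> B * (norm u * norm v * norm w)"
    and homogeneous: "\<And>a b c u v w. \<omega> (a *\<^sub>R u) (b *\<^sub>R v) (c *\<^sub>R w) = a * b * c * \<omega> u v w"
    and C: "C > 0" "\<And>u. G x u u \<le> (C * norm u)\<^sup>2"
  shows "\<bar>\<omega> u v w\<bar> \<le> C ^ 3 * norm u * norm v * norm w * norm_3form (G x) \<omega>"
proof (cases "u = 0 \<or> v = 0 \<or> w = 0")
  case True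
  then have "\<omega> u v w = 0"
    using homogeneous[of 0 u 1 v 1 w] homogeneous[of 1 u 0 v 1 w] homogeneous[of 1 u 1 v 0 w] by auto
  then show ?thesis using True by auto
next
  case False
  have unit: "G x ((1 / (C * norm u)) *\<^sub>R u) ((1 / (C * norm u)) *\<^sub>R u) \<le> 1" if "u \<noteq> 0" for u
    unfolding scale[OF x] using C(1) C(2)[of u] that by (simp add: field_simps)
  have "\<bar>\<omega> ((1 / (C * norm u)) *\<^sub>R u) ((1 / (C * norm v)) *\<^sub>R v) ((1 / (C * norm w)) *\<^sub>R w)\<bar> \<le> norm_3form (G x) \<omega>"
    by (rule norm_3form_upper[OF x B]) (use unit False in auto)
  then show ?thesis
    unfolding homogeneous using C(1) False by (simp add: field_simps abs_mult power3_eq_cube)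
qed

end

lemma (in normalised_form) wedge_bounded:
  assumes x: "x \<in> U"
  obtains B where "\<And>u v w. \<bar>wedge_ext_deriv \<eta> x u v w\<bar> \<le> B * (norm u * norm v * norm w)"
proof -
  have dd: "\<bar>D x v \<bullet> w\<bar> \<le> norm (D x) * (norm v * norm w)" for v w
  proof -
    have "\<bar>D x v \<bullet> w\<bar> \<le> norm (D x v) * norm w" by (rule Cauchy_Schwarz_ineq2)
    also have "\<dots> \<le> (norm (D x) * norm v) * norm w" by (intro mult_right_mono norm_blinfun) simp
    finally show ?thesis by (simp add: mult.assoc)
  qed
  have ext: "\<bar>ext_deriv \<eta> x v w\<bar> \<le> 2 * norm (D x) * (norm v * norm w)" for v w
    using dd[of v w] dd[of w v] unfolding ext_deriv_def D_eq[OF x] by (simp add: mult.commute mult.left_commute)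
  have part: "\<bar>(\<eta> x \<bullet> u) * ext_deriv \<eta> x v w\<bar> \<le> 2 * norm (\<eta> x) * norm (D x) * (norm u * norm v * norm w)" for u v w
  proof -
    have "\<bar>\<eta> x \<bullet> u\<bar> * \<bar>ext_deriv \<eta> x v w\<bar> \<le> (norm (\<eta> x) * norm u) * (2 * norm (D x) * (norm v * norm w))"
      by (intro mult_mono Cauchy_Schwarz_ineq2 ext) auto
    then show ?thesis by (simp add: abs_mult mult_ac)
  qed
  show ?thesis
  proof (rule that[of "6 * norm (\<eta> x) * norm (D x)"])
    fix u v w
    have "\<bar>wedge_ext_deriv \<eta> x u v w\<bar> \<le> \<bar>(\<eta> x \<bullet> u) * ext_deriv \<eta> x v w\<bar> + \<bar>(\<eta> x \<bullet> v) * ext_deriv \<eta> x w u\<bar>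
        + \<bar>(\<eta> x \<bullet> w) * ext_deriv \<eta> x u v\<bar>"
      unfolding wedge_ext_deriv_def by linarith
    also have "\<dots> \<le> 2 * norm (\<eta> x) * norm (D x) * (norm u * norm v * norm w)
        + 2 * norm (\<eta> x) * norm (D x) * (norm v * norm w * norm u)
        + 2 * norm (\<eta> x) * norm (D x) * (norm w * norm u * norm v)"
      by (intro add_mono part)
    also have "\<dots> = 6 * norm (\<eta> x) * norm (D x) * (norm u * norm v * norm w)" by (simp add: mult_ac)
    finally show "\<bar>wedge_ext_deriv \<eta> x u v w\<bar> \<le> 6 * norm (\<eta> x) * norm (D x) * (norm u * norm v * norm w)" .
  qed
qed

lemma (in normalised_form) wedge_homogeneous:
  assumes x: "x \<in> U"
  shows "wedge_ext_deriv \<eta> x (a *\<^sub>R u) (b *\<^sub>R v) (c *\<^sub>R w) = a * b * c * wedge_ext_deriv \<eta> x u v w"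
proof -
  have ext: "ext_deriv \<eta> x (a *\<^sub>R u) (b *\<^sub>R v) = a * b * ext_deriv \<eta> x u v" for a b u v
    by (simp add: ext_deriv_def D_eq[OF x] blinfun.scaleR_right algebra_simps)
  show ?thesis unfolding wedge_ext_deriv_def ext by (simp add: algebra_simps)
qed

section \<open>Limits of approximately tangent surfaces\<close>

text \<open>The bounds on the partial derivatives make the surfaces equicontinuous, so a subsequence converges uniformly by
  Arzela-Ascoli. Along each coordinate line the derivatives then converge uniformly to the values of the fields
  on the limit surface, and so differentiation may be exchanged with the limit.\<close>

lemma limit_surface:
  fixes W :: "nat \<Rightarrow> real \<times> real \<Rightarrow> 'a::euclidean_space"
  assumes I: "I = {-r..r}" "0 < r" and K: "compact K"
    and WK: "\<And>k s t. s \<in> I \<Longrightarrow> t \<in> I \<Longrightarrow> W k (s, t) \<in> K"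
    and dS: "\<And>k s t. s \<in> I \<Longrightarrow> t \<in> I \<Longrightarrow> ((\<lambda>s. W k (s, t)) has_vector_derivative A k s t) (at s within I)"
    and dT: "\<And>k s t. s \<in> I \<Longrightarrow> t \<in> I \<Longrightarrow> ((\<lambda>t. W k (s, t)) has_vector_derivative B k s t) (at t within I)"
    and bound: "\<And>k s t. s \<in> I \<Longrightarrow> t \<in> I \<Longrightarrow> norm (A k s t) \<le> M"
      "\<And>k s t. s \<in> I \<Longrightarrow> t \<in> I \<Longrightarrow> norm (B k s t) \<le> M"
    and limA: "\<And>e. 0 < e \<Longrightarrow> \<forall>\<^sub>F k in sequentially. \<forall>s\<in>I. \<forall>t\<in>I. norm (A k s t - X (W k (s, t))) \<le> e"
    and limB: "\<And>e. 0 < e \<Longrightarrow> \<forall>\<^sub>F k in sequentially. \<forall>s\<in>I. \<forall>t\<in>I. norm (B k s t - Y (W k (s, t))) \<le> e"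
    and X: "continuous_on K X" and Y: "continuous_on K Y"
  obtains Z \<phi> where "continuous_on (I \<times> I) Z" "strict_mono (\<phi> :: nat \<Rightarrow> nat)"
    "\<And>s t. s \<in> I \<Longrightarrow> t \<in> I \<Longrightarrow> (\<lambda>n. W (\<phi> n) (s, t)) \<longlonglongrightarrow> Z (s, t)"
    "\<And>s t. s \<in> I \<Longrightarrow> t \<in> I \<Longrightarrow> Z (s, t) \<in> K"
    "\<And>s t. s \<in> I \<Longrightarrow> t \<in> I \<Longrightarrow> ((\<lambda>s. Z (s, t)) has_vector_derivative X (Z (s, t))) (at s within I)"
    "\<And>s t. s \<in> I \<Longrightarrow> t \<in> I \<Longrightarrow> ((\<lambda>t. Z (s, t)) has_vector_derivative Y (Z (s, t))) (at t within I)"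
proof -
  have "0 \<in> I" using I by simp
  then have "0 \<le> M" using bound(1)[of 0 0 0] norm_ge_zero order_trans by blast
  have "convex I" by (simp add: I)
  have lipS: "norm (W k (s, t) - W k (s', t)) \<le> M * norm (s - s')" if "s \<in> I" "s' \<in> I" "t \<in> I" for k s s' t
    by (rule differentiable_bound[OF \<open>convex I\<close>, of "\<lambda>s. W k (s, t)" "\<lambda>s h. h *\<^sub>R A k s t"])
       (use that dS bound in \<open>auto intro!: onorm_line simp: has_vector_derivative_def\<close>)
  have lipT: "norm (W k (s, t) - W k (s, t')) \<le> M * norm (t - t')" if "s \<in> I" "t' \<in> I" "t \<in> I" for k s t t'
    by (rule differentiable_bound[OF \<open>convex I\<close>, of "\<lambda>t. W k (s, t)" "\<lambda>t h. h *\<^sub>R B k s t"])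
       (use that dT bound in \<open>auto intro!: onorm_line simp: has_vector_derivative_def\<close>)
  have lip: "norm (W k p - W k p') \<le> 2 * M * norm (p - p')" if "p \<in> I \<times> I" "p' \<in> I \<times> I" for k p p'
  proof -
    obtain s t s' t' where p: "p = (s, t)" "p' = (s', t')" by (cases p, cases p')
    have mem: "s \<in> I" "t \<in> I" "s' \<in> I" "t' \<in> I" using that p by auto
    have "norm (W k p - W k p') \<le> norm (W k (s, t) - W k (s', t)) + norm (W k (s', t) - W k (s', t'))"
      unfolding p using norm_triangle_ineq[of "W k (s, t) - W k (s', t)" "W k (s', t) - W k (s', t')"] by simp
    also have "\<dots> \<le> M * norm (s - s') + M * norm (t - t')" by (intro add_mono lipS lipT mem)
    also have "\<dots> \<le> M * norm (p - p') + M * norm (p - p')"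
      using norm_fst_le[of "s - s'" "t - t'"] norm_snd_le[of "t - t'" "s - s'"] \<open>0 \<le> M\<close>
      by (intro add_mono mult_left_mono) (auto simp: p)
    finally show ?thesis by simp
  qed
  obtain m where m: "\<And>x. x \<in> K \<Longrightarrow> norm x \<le> m" using compact_imp_bounded[OF K] by (auto simp: bounded_iff)
  obtain Z \<phi> where Z: "continuous_on (I \<times> I) Z" and \<phi>: "strict_mono (\<phi> :: nat \<Rightarrow> nat)"
    and conv: "\<And>e. 0 < e \<Longrightarrow> \<exists>N. \<forall>n x. n \<ge> N \<and> x \<in> I \<times> I \<longrightarrow> norm (W (\<phi> n) x - Z x) < e"
  proof (rule Arzela_Ascoli[of "I \<times> I" W m])
    show "compact (I \<times> I)" by (simp add: I compact_Times)
    show "norm (W n x) \<le> m" if "x \<in> I \<times> I" for n x using m WK that by (cases x) auto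
    fix x and e :: real assume x: "x \<in> I \<times> I" "0 < e"
    show "\<exists>d>0. \<forall>n y. y \<in> I \<times> I \<and> norm (x - y) < d \<longrightarrow> norm (W n x - W n y) < e"
    proof (intro exI[of _ "e / (2 * M + 1)"] conjI allI impI)
      show "0 < e / (2 * M + 1)" using x \<open>0 \<le> M\<close> by simp
      fix n y assume y: "y \<in> I \<times> I \<and> norm (x - y) < e / (2 * M + 1)"
      have "norm (W n x - W n y) \<le> 2 * M * norm (x - y)" using lip x y by blast
      also have "\<dots> \<le> (2 * M + 1) * norm (x - y)" by (intro mult_right_mono) auto
      also have "\<dots> < e" using y \<open>0 \<le> M\<close> by (simp add: field_simps)
      finally show "norm (W n x - W n y) < e" .
    qed
  qed blast
  have lim: "(\<lambda>n. W (\<phi> n) (s, t)) \<longlonglongrightarrow> Z (s, t)" if "s \<in> I" "t \<in> I" for s t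
    unfolding LIMSEQ_iff using conv that by (meson mem_Times_iff SigmaI)
  have ZK: "Z (s, t) \<in> K" if "s \<in> I" "t \<in> I" for s t
    using Lim_in_closed_set[OF compact_imp_closed[OF K] _ _ lim[OF that]] WK that by auto
  have close: "\<forall>\<^sub>F n in sequentially. \<forall>s\<in>I. \<forall>t\<in>I. norm (A' (\<phi> n) s t - X' (Z (s, t))) \<le> e"
    if e: "0 < e" and X': "continuous_on K X'"
      and A': "\<And>e. 0 < e \<Longrightarrow> \<forall>\<^sub>F k in sequentially. \<forall>s\<in>I. \<forall>t\<in>I. norm (A' k s t - X' (W k (s, t))) \<le> e"
    for e and X' :: "'a \<Rightarrow> 'a" and A'
  proof -
    obtain d where d: "d > 0" "\<And>x y. x \<in> K \<Longrightarrow> y \<in> K \<Longrightarrow> norm (y - x) < d \<Longrightarrow> norm (X' y - X' x) < e/2"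
      using compact_uniformly_continuous[OF X' K] half_gt_zero[OF e]
      unfolding uniformly_continuous_on_def dist_norm by metis
    obtain N where N: "\<And>n x. n \<ge> N \<Longrightarrow> x \<in> I \<times> I \<Longrightarrow> norm (W (\<phi> n) x - Z x) < d" using conv[OF d(1)] by blast
    have "\<forall>\<^sub>F n in sequentially. \<forall>s\<in>I. \<forall>t\<in>I. norm (A' (\<phi> n) s t - X' (W (\<phi> n) (s, t))) \<le> e/2"
      by (rule eventually_subseq[OF \<phi> A'[OF half_gt_zero[OF e]]])
    then show ?thesis using eventually_ge_at_top[of N]
    proof eventually_elim
      case (elim n)
      show ?case
      proof (intro ballI)
        fix s t assume st: "s \<in> I" "t \<in> I"
        have "norm (X' (W (\<phi> n) (s, t)) - X' (Z (s, t))) < e/2"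
          using st N[of n "(s, t)"] elim by (intro d ZK WK) auto
        moreover have "norm (A' (\<phi> n) s t - X' (W (\<phi> n) (s, t))) \<le> e/2" using elim st by blast
        ultimately have "norm ((A' (\<phi> n) s t - X' (W (\<phi> n) (s, t))) + (X' (W (\<phi> n) (s, t)) - X' (Z (s, t)))) \<le> e/2 + e/2"
          by (intro norm_triangle_mono) auto
        then show "norm (A' (\<phi> n) s t - X' (Z (s, t))) \<le> e" by simp
      qed
    qed
  qed
  have key: "(z has_vector_derivative v s) (at s within I)"
    if s: "s \<in> I" and d: "\<And>n s. s \<in> I \<Longrightarrow> (f n has_vector_derivative f' n s) (at s within I)"
      and lf: "\<And>s. s \<in> I \<Longrightarrow> (\<lambda>n. f n s) \<longlonglongrightarrow> z s"
      and lf': "\<And>e. 0 < e \<Longrightarrow> \<forall>\<^sub>F n in sequentially. \<forall>s\<in>I. norm (f' n s - v s) \<le> e"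
    for z v :: "real \<Rightarrow> 'a" and s and f f' :: "nat \<Rightarrow> real \<Rightarrow> 'a"
  proof -
    have "\<exists>g. \<forall>x\<in>I. (\<lambda>n. f n x) \<longlonglongrightarrow> g x \<and> (g has_derivative (\<lambda>h. h *\<^sub>R v x)) (at x within I)"
    proof (rule has_derivative_sequence[where f=f and f'="\<lambda>n x h. h *\<^sub>R f' n x" and g'="\<lambda>x h. h *\<^sub>R v x",
          OF \<open>convex I\<close> _ _ s])
      show "(\<lambda>n. f n s) \<longlonglongrightarrow> z s" by (rule lf[OF s])
      show "(f n has_derivative (\<lambda>h. h *\<^sub>R f' n x)) (at x within I)" if "x \<in> I" for n x
        using d[OF that] by (simp add: has_vector_derivative_def)
      fix e :: real assume "0 < e"
      from lf'[OF this] show "\<forall>\<^sub>F n in sequentially. \<forall>x\<in>I. \<forall>h. norm (h *\<^sub>R f' n x - h *\<^sub>R v x) \<le> e * norm h"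
        by eventually_elim
           (auto simp: scaleR_diff_right[symmetric] mult.commute[of e] intro!: mult_left_mono)
    qed
    then obtain g where g: "\<And>x. x \<in> I \<Longrightarrow> (\<lambda>n. f n x) \<longlonglongrightarrow> g x"
      "\<And>x. x \<in> I \<Longrightarrow> (g has_vector_derivative v x) (at x within I)"
      by (auto simp: has_vector_derivative_def)
    show ?thesis
      by (rule has_vector_derivative_transform[OF s _ g(2)[OF s]])
         (use LIMSEQ_unique[OF lf g(1)] in auto)
  qed
  show ?thesis
  proof (rule that[OF Z \<phi> lim ZK])
    fix s t assume st: "s \<in> I" "t \<in> I"
    show "((\<lambda>s. Z (s, t)) has_vector_derivative X (Z (s, t))) (at s within I)"
    proof (rule key[OF st(1), where f="\<lambda>n s. W (\<phi> n) (s, t)" and f'="\<lambda>n s. A (\<phi> n) s t" and v="\<lambda>s. X (Z (s, t))"])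
      show "\<forall>\<^sub>F n in sequentially. \<forall>s\<in>I. norm (A (\<phi> n) s t - X (Z (s, t))) \<le> e" if "0 < e" for e
        using close[OF that X limA] st by (auto elim: eventually_mono)
    qed (use st dS lim in auto)
    show "((\<lambda>t. Z (s, t)) has_vector_derivative Y (Z (s, t))) (at t within I)"
    proof (rule key[OF st(2), where f="\<lambda>n t. W (\<phi> n) (s, t)" and f'="\<lambda>n t. B (\<phi> n) s t" and v="\<lambda>t. Y (Z (s, t))"])
      show "\<forall>\<^sub>F n in sequentially. \<forall>t\<in>I. norm (B (\<phi> n) s t - Y (Z (s, t))) \<le> e" if "0 < e" for e
        using close[OF that Y limB] st by (auto elim: eventually_mono)
    qed (use st dT lim in auto)
  qed
qed

section \<open>Approximating sequences in a chart\<close>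

text \<open>The hypothesis on \<open>M\<close> bounds the speed only inside the ball; \<open>room\<close> prevents the solution from leaving it.\<close>

lemma solution_stays_forward:
  fixes X :: "'a::real_normed_vector \<Rightarrow> 'a"
  assumes f: "solution X U {0..T} f" and T: "0 \<le> T" and M: "0 \<le> M"
    and bound: "\<And>y. y \<in> cball c \<rho> \<Longrightarrow> y \<in> U \<Longrightarrow> norm (X y) \<le> M"
    and room: "dist c (f 0) + M * T < \<rho>"
  shows "f T \<in> cball c \<rho>" and "dist c (f T) \<le> dist c (f 0) + M * T"
proof -
  have cont: "continuous_on {0..T} f"
    using f unfolding solution_def
    by (intro continuous_on_vector_derivative[of _ _ "\<lambda>\<tau>. X (f \<tau>)"]) auto
  have step: "dist c (f t) \<le> dist c (f 0) + M * t"
    if t: "t \<in> {0..T}" and near: "\<And>s. s \<in> {0..t} \<Longrightarrow> dist c (f s) \<le> \<rho>" for t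
  proof -
    have "norm (f t - f 0) \<le> M * norm (t - 0)"
    proof (rule differentiable_bound[of "{0..t}" f "\<lambda>s h. h *\<^sub>R X (f s)"])
      fix s assume s: "s \<in> {0..t}"
      have sub: "{0..t} \<subseteq> {0..T}" using t by auto
      show "(f has_derivative (\<lambda>h. h *\<^sub>R X (f s))) (at s within {0..t})"
        using solution_subset[OF f sub] s by (simp add: solution_def has_vector_derivative_def)
      have "f s \<in> U" using f s t by (simp add: solution_def)
      then show "onorm (\<lambda>h. h *\<^sub>R X (f s)) \<le> M" using near[OF s] by (intro onorm_line bound) auto
    qed (use t in auto)
    then show ?thesis using dist_triangle[of c "f t" "f 0"] t by (simp add: dist_norm norm_minus_commute)
  qed
  have all: "dist c (f t) < \<rho>" if "t \<in> {0..T}" for t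
  proof (rule no_exit[of T "\<lambda>t. dist c (f t)"])
    show "continuous_on {0..T} (\<lambda>t. dist c (f t))" by (intro continuous_intros cont)
    have "0 \<le> M * T" using M T by simp
    then show "dist c (f 0) < \<rho>" using room by linarith
    fix t assume t: "t \<in> {0..T}" "\<And>s. s \<in> {0..t} \<Longrightarrow> dist c (f s) \<le> \<rho>"
    have "M * t \<le> M * T" using t M by (intro mult_left_mono) auto
    then show "dist c (f t) < \<rho>" using step[OF t] room by linarith
  qed fact
  show "f T \<in> cball c \<rho>" using all[of T] T by simp
  show "dist c (f T) \<le> dist c (f 0) + M * T"
    by (rule step) (use all T in \<open>auto intro: less_imp_le\<close>)
qed

lemma solution_stays:
  fixes X :: "'a::real_normed_vector \<Rightarrow> 'a"
  assumes f: "solution X U {a..b} f" and t: "0 \<in> {a..b}" "t \<in> {a..b}" and M: "0 \<le> M"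
    and bound: "\<And>y. y \<in> cball c \<rho> \<Longrightarrow> y \<in> U \<Longrightarrow> norm (X y) \<le> M"
    and room: "dist c (f 0) + M * \<bar>t\<bar> < \<rho>"
  shows "f t \<in> cball c \<rho> \<and> dist c (f t) \<le> dist c (f 0) + M * \<bar>t\<bar>"
proof -
  define \<sigma> :: real where "\<sigma> = (if 0 \<le> t then 1 else -1)"
  have \<sigma>: "\<sigma> * \<bar>t\<bar> = t" "\<bar>\<sigma>\<bar> = 1" by (auto simp: \<sigma>_def)
  have g: "solution (\<lambda>x. \<sigma> *\<^sub>R X x) U {0..\<bar>t\<bar>} (\<lambda>s. f (0 + \<sigma> * s))"
    by (rule solution_affine[OF f]) (use t in \<open>auto simp: \<sigma>_def split: if_splits\<close>)
  have "norm (\<sigma> *\<^sub>R X y) \<le> M" if "y \<in> cball c \<rho>" "y \<in> U" for y using bound[OF that] \<sigma> by simp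
  from solution_stays_forward[OF g _ M this, of c \<rho>] room \<sigma> show ?thesis by simp
qed

lemma (in form_flow) flow_component:
  assumes i: "i \<noteq> l" and x: "x \<in> V" and t: "t \<in> {-t0..t0}" and m: "m \<noteq> l"
  shows "F i t x $ m = x $ m + t * axis i 1 $ m"
proof -
  have "\<exists>c. \<forall>\<tau>\<in>{-t0..t0}. (F i \<tau> x - \<tau> *\<^sub>R axis i 1) \<bullet> axis m 1 = c"
  proof (rule has_vector_derivative_zero_constant)
    fix \<tau> assume \<tau>: "\<tau> \<in> {-t0..t0}"
    have "((\<lambda>\<tau>. F i \<tau> x) has_vector_derivative frame i (F i \<tau> x)) (at \<tau> within {-t0..t0})"
      using flow_solution[OF i x] \<tau> unfolding solution_def by blast
    moreover have "((\<lambda>\<tau>. \<tau> *\<^sub>R (axis i 1 :: real^'n)) has_vector_derivative axis i 1) (at \<tau> within {-t0..t0})"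
      by (simp add: has_vector_derivative_def bounded_linear_scaleR_left bounded_linear_imp_has_derivative)
    ultimately have "((\<lambda>\<tau>. F i \<tau> x - \<tau> *\<^sub>R axis i 1) has_vector_derivative frame i (F i \<tau> x) - axis i 1) (at \<tau> within {-t0..t0})"
      by (rule has_vector_derivative_diff)
    from bounded_linear.has_vector_derivative[OF bounded_linear_inner_left[of "axis m 1"] this]
    show "((\<lambda>\<tau>. (F i \<tau> x - \<tau> *\<^sub>R axis i 1) \<bullet> axis m 1) has_vector_derivative 0) (at \<tau> within {-t0..t0})"
      using m by (simp add: frame_field_eq[OF flow_in_U[OF i x \<tau>]] inner_axis_axis)
  qed auto
  then obtain c where c: "\<And>\<tau>. \<tau> \<in> {-t0..t0} \<Longrightarrow> (F i \<tau> x - \<tau> *\<^sub>R axis i 1) \<bullet> axis m 1 = c" by blast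
  have "(F i t x - t *\<^sub>R axis i 1) \<bullet> axis m 1 = (F i 0 x - 0 *\<^sub>R axis i 1) \<bullet> axis m 1"
    using c[OF t] c[of 0] t0 by simp
  then show ?thesis using flow_0[OF i x] by (simp add: inner_axis)
qed

text \<open>The data of the definition of asymptotic involutivity in the coordinates of one chart: \<open>U\<close> is the image of the
  chart, \<open>V\<close> the smaller neighbourhood on which the flows are defined, and \<open>\<eta>\<close> the limit of the forms \<open>\<eta>s k\<close>.\<close>

locale approximating_flows = coordinate_metric G U
  for G :: "real^'n::finite \<Rightarrow> real^'n \<Rightarrow> real^'n \<Rightarrow> real" and U :: "(real^'n) set" +
  fixes V :: "(real^'n) set" and l :: 'n and \<eta> :: "real^'n \<Rightarrow> real^'n" and \<eta>s :: "nat \<Rightarrow> real^'n \<Rightarrow> real^'n"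
    and t0 :: real and F :: "nat \<Rightarrow> 'n \<Rightarrow> real \<Rightarrow> real^'n \<Rightarrow> real^'n"
  assumes open_U: "open U" and continuous_form: "continuous_on U \<eta>"
    and C1: "\<And>k. Ck_on 1 (\<eta>s k) U" and normalised: "\<And>k x. x \<in> U \<Longrightarrow> \<eta>s k x $ l = 1"
    and convergence: "uniform_limit U (\<lambda>k x. norm_1form (G x) (\<eta>s k x - \<eta> x)) (\<lambda>_. 0) sequentially"
    and open_V: "open V" and V_U: "V \<subseteq> U" and t0: "0 < t0"
    and flows: "\<forall>\<^sub>F k in sequentially. \<forall>i. i \<noteq> l \<longrightarrow> is_flow (frame_field l (\<eta>s k) i) U V t0 (F k i)"
begin

abbreviation bracket_limit :: bool where
  "bracket_limit \<equiv> uniform_limit (V \<times> {-t0..t0})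
     (\<lambda>k (x, t). norm_3form (G x) (wedge_ext_deriv (\<eta>s k) x) * exp (averaged_ext_deriv l (\<eta>s k) (F k) x t))
     (\<lambda>_. 0) sequentially"

abbreviation approximation_limit :: bool where
  "approximation_limit \<equiv> uniform_limit (V \<times> {-t0..t0})
     (\<lambda>k (x, t). norm_1form (G x) (\<eta>s k x - \<eta> x) * exp (averaged_ext_deriv l (\<eta>s k) (F k) x t))
     (\<lambda>_. 0) sequentially"

lemma normalised_form: "normalised_form (\<eta>s k) U l"
  by (intro normalised_form.intro open_U C1 normalised)

lemma form_flows: "\<forall>\<^sub>F k in sequentially. form_flow (\<eta>s k) U l V t0 (F k)"
  using flows
proof eventually_elim
  case (elim k)
  then show ?case
    by (intro form_flow.intro normalised_form form_flow_axioms.intro t0 open_V) auto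
qed

lemma components_converge:
  assumes K: "compact K" "K \<subseteq> U" and "0 < \<epsilon>"
  shows "\<forall>\<^sub>F k in sequentially. \<forall>x\<in>K. \<forall>i. \<bar>(\<eta>s k x - \<eta> x) $ i\<bar> \<le> \<epsilon>"
proof -
  obtain C where C: "C > 0" "\<And>x u. x \<in> K \<Longrightarrow> G x u u \<le> (C * norm u)\<^sup>2" using upper_bound[OF K] by metis
  have "\<forall>\<^sub>F k in sequentially. \<forall>x\<in>U. dist (norm_1form (G x) (\<eta>s k x - \<eta> x)) 0 < \<epsilon> / C"
    by (rule uniform_limitD[OF convergence]) (use C \<open>0 < \<epsilon>\<close> in simp)
  then show ?thesis
  proof eventually_elim
    case (elim k)
    show ?case
    proof (intro ballI allI)
      fix x i assume x: "x \<in> K"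
      then have xU: "x \<in> U" using K by blast
      have "\<bar>(\<eta>s k x - \<eta> x) \<bullet> axis i 1\<bar> \<le> C * norm (axis i 1 :: real^'n) * norm_1form (G x) (\<eta>s k x - \<eta> x)"
        by (rule norm_1form_bound[OF xU C(1) C(2)[OF x]])
      also have "\<dots> \<le> C * (\<epsilon> / C)"
      proof -
        have "norm_1form (G x) (\<eta>s k x - \<eta> x) \<le> \<epsilon> / C" using bspec[OF elim xU] by (simp add: dist_norm)
        then show ?thesis unfolding norm_axis_1 mult_1_right using C by (intro mult_left_mono) auto
      qed
      finally show "\<bar>(\<eta>s k x - \<eta> x) $ i\<bar> \<le> \<epsilon>" using C by (simp add: inner_axis)
    qed
  qed
qed

text \<open>Convergence of the forms at the single point \<open>x\<close> passes the normalisation to the limit.\<close>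

lemma limit_normalised:
  assumes x: "x \<in> U"
  shows "\<eta> x $ l = 1"
proof -
  have "\<bar>1 - \<eta> x $ l\<bar> \<le> \<epsilon>" if "0 < \<epsilon>" for \<epsilon>
  proof -
    have "\<forall>\<^sub>F k in sequentially. \<forall>y\<in>{x}. \<forall>i. \<bar>(\<eta>s k y - \<eta> y) $ i\<bar> \<le> \<epsilon>"
      by (rule components_converge) (use x that in auto)
    then obtain k where "\<bar>(\<eta>s k x - \<eta> x) $ l\<bar> \<le> \<epsilon>" by (auto simp: eventually_sequentially)
    then show ?thesis using normalised[OF x] by simp
  qed
  then have "\<bar>1 - \<eta> x $ l\<bar> \<le> 0" by (rule field_le_epsilon) simp
  then show ?thesis by simp
qed

abbreviation limit_frame :: "'n \<Rightarrow> real^'n \<Rightarrow> real^'n" where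
  "limit_frame i x \<equiv> axis i 1 - (\<eta> x $ i) *\<^sub>R axis l 1"

lemma continuous_limit_frame: "K \<subseteq> U \<Longrightarrow> continuous_on K (limit_frame i)"
  by (intro continuous_intros continuous_on_subset[OF continuous_form])

lemma frames_converge:
  assumes K: "compact K" "K \<subseteq> U" and "0 < \<epsilon>"
  shows "\<forall>\<^sub>F k in sequentially. \<forall>x\<in>K. \<forall>i. norm (frame_field l (\<eta>s k) i x - limit_frame i x) \<le> \<epsilon>"
  using components_converge[OF assms]
proof eventually_elim
  case (elim k)
  show ?case
  proof (intro ballI allI)
    fix x i assume x: "x \<in> K"
    then have "x \<in> U" using K by blast
    then have "frame_field l (\<eta>s k) i x - limit_frame i x = - ((\<eta>s k x - \<eta> x) $ i) *\<^sub>R axis l 1"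
      by (simp add: normalised_form.frame_field_eq[OF normalised_form] scaleR_diff_left)
    then show "norm (frame_field l (\<eta>s k) i x - limit_frame i x) \<le> \<epsilon>"
      using elim x by (simp add: norm_axis_1 abs_minus_commute)
  qed
qed

lemma frames_bounded:
  assumes K: "compact K" "K \<subseteq> U"
  obtains M where "M > 0" "\<forall>\<^sub>F k in sequentially. \<forall>x\<in>K. \<forall>i. norm (frame_field l (\<eta>s k) i x) \<le> M"
proof -
  have "bounded (\<eta> ` K)"
    by (intro compact_imp_bounded compact_continuous_image continuous_on_subset[OF continuous_form] K)
  then obtain m where m: "\<And>x. x \<in> K \<Longrightarrow> norm (\<eta> x) \<le> m" by (auto simp: bounded_iff)
  have lf: "norm (limit_frame i x) \<le> 1 + \<bar>m\<bar>" if "x \<in> K" for i x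
  proof -
    have "norm (limit_frame i x) \<le> norm (axis i 1 :: real^'n) + norm ((\<eta> x $ i) *\<^sub>R (axis l 1 :: real^'n))"
      by (rule norm_triangle_ineq4)
    also have "\<dots> = 1 + \<bar>\<eta> x $ i\<bar>" by (simp add: norm_axis_1)
    also have "\<bar>\<eta> x $ i\<bar> \<le> \<bar>m\<bar>" using component_le_norm_cart[of "\<eta> x" i] m[OF that] by simp
    finally show ?thesis by simp
  qed
  show ?thesis
  proof (rule that[of "2 + \<bar>m\<bar>"])
    show "\<forall>\<^sub>F k in sequentially. \<forall>x\<in>K. \<forall>i. norm (frame_field l (\<eta>s k) i x) \<le> 2 + \<bar>m\<bar>"
      using frames_converge[OF K zero_less_one]
    proof eventually_elim
      case (elim k)
      show ?case
      proof (intro ballI allI)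
        fix x i assume x: "x \<in> K"
        have "norm (frame_field l (\<eta>s k) i x - limit_frame i x) \<le> 1" using elim x by blast
        then have "norm ((frame_field l (\<eta>s k) i x - limit_frame i x) + limit_frame i x) \<le> 1 + (1 + \<bar>m\<bar>)"
          by (rule norm_triangle_mono[OF _ lf[OF x]])
        then show "norm (frame_field l (\<eta>s k) i x) \<le> 2 + \<bar>m\<bar>" by simp
      qed
    qed
  qed simp
qed

lemma averaged_coeff_le: "i \<noteq> l \<Longrightarrow> averaged_coeff l \<eta>' F' i x t \<le> averaged_ext_deriv l \<eta>' F' x t"
  unfolding averaged_ext_deriv_def by (rule Max_ge) auto

text \<open>The curve \<open>\<gamma>\<close> is thus determined by its starting point, since the flows on the left do not depend on it.\<close>

lemma curve_limit:
  assumes limit: approximation_limit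
    and i: "i \<noteq> l" and t: "t \<in> {-t0..t0}" and K: "compact K" "K \<subseteq> V"
    and \<gamma>: "\<And>s. s \<in> closed_segment 0 t \<Longrightarrow> \<gamma> s \<in> K"
    and d\<gamma>: "\<And>s. s \<in> closed_segment 0 t \<Longrightarrow>
        (\<gamma> has_vector_derivative limit_frame i (\<gamma> s)) (at s within closed_segment 0 t)"
  shows "(\<lambda>k. F k i t (\<gamma> 0)) \<longlonglongrightarrow> \<gamma> t"
proof -
  have KU: "K \<subseteq> U" using K V_U by blast
  obtain C where C: "C > 0" "\<And>x u. x \<in> K \<Longrightarrow> G x u u \<le> (C * norm u)\<^sup>2" using upper_bound[OF K(1) KU] by metis
  show ?thesis
    unfolding tendsto_iff
  proof (intro allI impI)
    fix e :: real assume "0 < e"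
    define \<epsilon> where "\<epsilon> = e / (2 * t0)"
    have "0 < \<epsilon>" using \<open>0 < e\<close> t0 by (simp add: \<epsilon>_def)
    have "\<forall>\<^sub>F k in sequentially. \<forall>y\<in>V \<times> {-t0..t0}. dist (case y of (x, t) \<Rightarrow>
        norm_1form (G x) (\<eta>s k x - \<eta> x) * exp (averaged_ext_deriv l (\<eta>s k) (F k) x t)) 0 < \<epsilon> / C"
      by (rule uniform_limitD[OF limit]) (use C \<open>0 < \<epsilon>\<close> in simp)
    then show "\<forall>\<^sub>F k in sequentially. dist (F k i t (\<gamma> 0)) (\<gamma> t) < e"
      using form_flows
    proof eventually_elim
      case (elim k)
      interpret form_flow "\<eta>s k" U l V t0 "F k" by (rule elim(2))
      have "norm (\<gamma> t - F k i t (\<gamma> 0)) \<le> \<epsilon> * \<bar>t\<bar>"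
      proof (rule curve_flow_comparison[OF i t _ d\<gamma>])
        fix s assume s: "s \<in> closed_segment 0 t"
        then show V: "\<gamma> s \<in> V" using \<gamma> K by blast
        then have U: "\<gamma> s \<in> U" using V_U by blast
        have ts: "t - s \<in> {-t0..t0}" using s t by (auto simp: closed_segment_eq_real_ivl split: if_splits)
        have "\<bar>(\<eta>s k (\<gamma> s) - \<eta> (\<gamma> s)) \<bullet> axis i 1\<bar> \<le> C * norm (axis i 1 :: real^'n) * norm_1form (G (\<gamma> s)) (\<eta>s k (\<gamma> s) - \<eta> (\<gamma> s))"
          by (rule norm_1form_bound[OF U C(1) C(2)[OF \<gamma>[OF s]]])
        then have "\<bar>(\<eta>s k (\<gamma> s) - \<eta> (\<gamma> s)) $ i\<bar> * exp (avg i (\<gamma> s) (t - s))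
            \<le> (C * norm_1form (G (\<gamma> s)) (\<eta>s k (\<gamma> s) - \<eta> (\<gamma> s))) * exp (averaged_ext_deriv l (\<eta>s k) (F k) (\<gamma> s) (t - s))"
          by (intro mult_mono) (auto simp: inner_axis norm_axis_1 averaged_coeff_le i norm_1form_nonneg[OF U] less_imp_le[OF C(1)])
        also have "\<dots> \<le> C * (\<epsilon> / C)"
          unfolding mult.assoc
        proof (rule mult_left_mono)
          have "(\<gamma> s, t - s) \<in> V \<times> {-t0..t0}" using V ts by simp
          from bspec[OF elim(1) this]
          show "norm_1form (G (\<gamma> s)) (\<eta>s k (\<gamma> s) - \<eta> (\<gamma> s)) * exp (averaged_ext_deriv l (\<eta>s k) (F k) (\<gamma> s) (t - s)) \<le> \<epsilon> / C"
            by (simp add: dist_norm)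
        qed (use C in simp)
        finally show "\<bar>(\<eta>s k (\<gamma> s) - \<eta> (\<gamma> s)) $ i\<bar> * exp (avg i (\<gamma> s) (t - s)) \<le> \<epsilon>" using C by simp
      qed
      also have "\<dots> \<le> \<epsilon> * t0" using t \<open>0 < \<epsilon>\<close> by (intro mult_left_mono) auto
      also have "\<dots> < e" using t0 \<open>0 < e\<close> by (simp add: \<epsilon>_def)
      finally show ?case by (simp add: dist_norm norm_minus_commute)
    qed
  qed
qed

text \<open>The bracket of the frame fields is the value of \<open>\<eta>\<^sub>k \<and> d\<eta>\<^sub>k\<close> on the two fields and \<open>\<partial>/\<partial>x\<^sup>l\<close>, and the frame fields
  are bounded on \<open>K\<close> uniformly in \<open>k\<close>.\<close>

lemma bracket_converges:
  assumes limit: bracket_limit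
    and j: "j \<noteq> l" and K: "compact K" "K \<subseteq> V" and "0 < \<epsilon>"
  shows "\<forall>\<^sub>F k in sequentially. \<forall>x\<in>K. \<forall>t\<in>{-t0..t0}.
     \<bar>ext_deriv (\<eta>s k) x (frame_field l (\<eta>s k) i x) (frame_field l (\<eta>s k) j x)\<bar>
       * exp (averaged_coeff l (\<eta>s k) (F k) j x t) \<le> \<epsilon>"
proof -
  have KU: "K \<subseteq> U" using K V_U by blast
  obtain C where C: "C > 0" "\<And>x u. x \<in> K \<Longrightarrow> G x u u \<le> (C * norm u)\<^sup>2" using upper_bound[OF K(1) KU] by metis
  obtain M where M: "M > 0" "\<forall>\<^sub>F k in sequentially. \<forall>x\<in>K. \<forall>i. norm (frame_field l (\<eta>s k) i x) \<le> M"
    by (rule frames_bounded[OF K(1) KU])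
  define R where "R = C ^ 3 * M * M"
  have "R > 0" using C M by (simp add: R_def)
  have "\<forall>\<^sub>F k in sequentially. \<forall>y\<in>V \<times> {-t0..t0}. dist (case y of (x, t) \<Rightarrow>
      norm_3form (G x) (wedge_ext_deriv (\<eta>s k) x) * exp (averaged_ext_deriv l (\<eta>s k) (F k) x t)) 0 < \<epsilon> / R"
    by (rule uniform_limitD[OF limit]) (use \<open>R > 0\<close> \<open>0 < \<epsilon>\<close> in simp)
  then show ?thesis using M(2)
  proof eventually_elim
    case (elim k)
    interpret N: normalised_form "\<eta>s k" U l by (rule normalised_form)
    let ?X = "frame_field l (\<eta>s k)"
    show ?case
    proof (intro ballI)
      fix x t assume x: "x \<in> K" and t: "t \<in> {-t0..t0}"
      have xU: "x \<in> U" and xV: "x \<in> V" using x KU K by auto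
      let ?w = "norm_3form (G x) (wedge_ext_deriv (\<eta>s k) x)"
      obtain B where B: "\<And>u v w. \<bar>wedge_ext_deriv (\<eta>s k) x u v w\<bar> \<le> B * (norm u * norm v * norm w)"
        using N.wedge_bounded[OF xU] by metis
      have w0: "0 \<le> ?w"
        using norm_3form_upper[OF xU B, of 0 0 0] bilinear[OF xU] by (simp add: bilinear_lzero)
      have "\<bar>wedge_ext_deriv (\<eta>s k) x (?X i x) (?X j x) (axis l 1)\<bar>
          \<le> C ^ 3 * norm (?X i x) * norm (?X j x) * norm (axis l 1 :: real^'n) * ?w"
        by (rule norm_3form_bound[OF xU B N.wedge_homogeneous[OF xU] C(1) C(2)[OF x]])
      also have "\<dots> \<le> R * ?w"
        unfolding R_def norm_axis_1 mult_1_right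
      proof (rule mult_right_mono[OF mult_mono[OF mult_left_mono] w0])
        show "norm (?X i x) \<le> M" "norm (?X j x) \<le> M" using elim(2) x by blast+
        show "0 \<le> C ^ 3" "0 \<le> C ^ 3 * M" using C M by simp_all
      qed simp
      finally have "\<bar>ext_deriv (\<eta>s k) x (?X i x) (?X j x)\<bar> \<le> R * ?w"
        by (simp only: N.wedge_ext_deriv_frame[OF xU])
      then have "\<bar>ext_deriv (\<eta>s k) x (?X i x) (?X j x)\<bar> * exp (averaged_coeff l (\<eta>s k) (F k) j x t)
          \<le> (R * ?w) * exp (averaged_ext_deriv l (\<eta>s k) (F k) x t)"
        by (intro mult_mono) (use averaged_coeff_le[OF j] \<open>R > 0\<close> w0 in auto)
      also have "\<dots> \<le> R * (\<epsilon> / R)"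
        unfolding mult.assoc
      proof (rule mult_left_mono)
        have "(x, t) \<in> V \<times> {-t0..t0}" using xV t by simp
        from bspec[OF elim(1) this]
        show "?w * exp (averaged_ext_deriv l (\<eta>s k) (F k) x t) \<le> \<epsilon> / R" by (simp add: dist_norm)
      qed (use \<open>R > 0\<close> in simp)
      finally show "\<bar>ext_deriv (\<eta>s k) x (?X i x) (?X j x)\<bar> * exp (averaged_coeff l (\<eta>s k) (F k) j x t) \<le> \<epsilon>"
        using \<open>R > 0\<close> by simp
    qed
  qed
qed

end

section \<open>Existence of integral graphs in a chart\<close>

definition cylinder :: "'n \<Rightarrow> real^'n::finite \<Rightarrow> real \<Rightarrow> (real^'n) set" where
  "cylinder l x0 r = {x. \<forall>m. m \<noteq> l \<longrightarrow> \<bar>x $ m - x0 $ m\<bar> < r}"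

definition graph_point :: "'n \<Rightarrow> (real^'n::finite \<Rightarrow> real) \<Rightarrow> real^'n \<Rightarrow> real^'n" where
  "graph_point l w x = x + (w x - x $ l) *\<^sub>R axis l 1"

text \<open>The function \<open>w\<close> of the coordinates other than the last one is encoded as a function on the whole space that
  is constant in the vertical direction; \<open>graph_point l w x\<close> is then the vertical projection of \<open>x\<close> to the graph.
  For a form \<open>\<eta>\<close> with \<open>\<eta>\<^sub>l = 1\<close>, the formula for \<open>w'\<close> says that the graph is tangent to the kernel of \<open>\<eta>\<close>.\<close>

definition integral_graph ::
  "'n \<Rightarrow> (real^'n \<Rightarrow> real^'n) \<Rightarrow> (real^'n) set \<Rightarrow> real^'n \<Rightarrow> real \<Rightarrow> (real^'n \<Rightarrow> real)
    \<Rightarrow> (real^'n \<Rightarrow> real^'n::finite \<Rightarrow> real) \<Rightarrow> bool" where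
  "integral_graph l \<eta> U x0 r w w' \<longleftrightarrow>
     0 < r \<and> w x0 = x0 $ l \<and> (\<forall>x a. w (x + a *\<^sub>R axis l 1) = w x) \<and>
     (\<forall>x\<in>cylinder l x0 r. (w has_derivative w' x) (at x) \<and> graph_point l w x \<in> U \<and>
        (\<forall>u. w' x u = u $ l - \<eta> (graph_point l w x) \<bullet> u))"

context approximating_flows
begin

text \<open>The surface is the limit of the surfaces swept out by the flow in the direction \<open>j\<close> of the flow lines in the
  direction \<open>i\<close>. The case \<open>i = j\<close> is allowed.\<close>

lemma integral_surface:
  assumes limit: bracket_limit
    and ij: "i \<noteq> l" "j \<noteq> l" and x0: "x0 \<in> V"
  obtains r Z where "0 < r" "continuous_on ({-r..r} \<times> {-r..r}) Z" "Z (0, 0) = x0"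
    "\<And>s t. s \<in> {-r..r} \<Longrightarrow> t \<in> {-r..r} \<Longrightarrow> Z (s, t) \<in> U"
    "\<And>s t. s \<in> {-r..r} \<Longrightarrow> t \<in> {-r..r} \<Longrightarrow>
       ((\<lambda>s. Z (s, t)) has_vector_derivative limit_frame i (Z (s, t))) (at s within {-r..r})"
    "\<And>s t. s \<in> {-r..r} \<Longrightarrow> t \<in> {-r..r} \<Longrightarrow>
       ((\<lambda>t. Z (s, t)) has_vector_derivative limit_frame j (Z (s, t))) (at t within {-r..r})"
    "\<And>s t m. s \<in> {-r..r} \<Longrightarrow> t \<in> {-r..r} \<Longrightarrow> m \<noteq> l \<Longrightarrow>
       Z (s, t) $ m = x0 $ m + s * axis i 1 $ m + t * axis j 1 $ m"
proof -
  obtain \<rho> where \<rho>: "0 < \<rho>" "cball x0 \<rho> \<subseteq> V"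
    using open_V x0 open_contains_cball by blast
  define K where "K = cball x0 \<rho>"
  have K: "compact K" "K \<subseteq> V" "K \<subseteq> U" using \<rho> V_U by (auto simp: K_def)
  obtain M where M: "M > 0" "\<forall>\<^sub>F k in sequentially. \<forall>x\<in>K. \<forall>i. norm (frame_field l (\<eta>s k) i x) \<le> M"
    by (rule frames_bounded[OF K(1,3)])
  \<comment> \<open>Two flows of speed at most \<open>M\<close>, each for a time of at most \<open>r\<close>, do not leave the ball \<open>K\<close> of radius \<open>\<rho>\<close>.\<close>
  define r where "r = min t0 (\<rho> / (3 * M))"
  have r: "0 < r" "r \<le> t0" "2 * (M * r) < \<rho>"
  proof -
    show "0 < r" "r \<le> t0" using t0 \<rho> M by (auto simp: r_def)
    have "2 * (M * r) \<le> 2 * (M * (\<rho> / (3 * M)))" using M by (intro mult_left_mono) (auto simp: r_def)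
    also have "\<dots> < \<rho>" using M \<rho> by (simp add: field_simps)
    finally show "2 * (M * r) < \<rho>" .
  qed
  define I where "I = {-r..r}"
  have It0: "I \<subseteq> {-t0..t0}" using r by (auto simp: I_def)
  have "0 \<in> I" using r by (simp add: I_def)
  define Q where "Q k \<epsilon> \<longleftrightarrow> (\<forall>x\<in>K. \<forall>t\<in>{-t0..t0}.
     \<bar>ext_deriv (\<eta>s k) x (frame_field l (\<eta>s k) i x) (frame_field l (\<eta>s k) j x)\<bar>
       * exp (averaged_coeff l (\<eta>s k) (F k) j x t) \<le> \<epsilon>)" for k \<epsilon>
  have Q: "\<forall>\<^sub>F k in sequentially. Q k \<epsilon>" if "0 < \<epsilon>" for \<epsilon>
    unfolding Q_def by (rule bracket_converges[OF limit ij(2) K(1,2) that])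
  have "\<forall>\<^sub>F k in sequentially. form_flow (\<eta>s k) U l V t0 (F k) \<and>
      (\<forall>x\<in>K. \<forall>i. norm (frame_field l (\<eta>s k) i x) \<le> M) \<and> Q k 1"
    by (intro eventually_conj form_flows M(2) Q) simp
  then obtain k0 where k0: "\<And>k. k \<ge> k0 \<Longrightarrow> form_flow (\<eta>s k) U l V t0 (F k)"
    "\<And>k x i. k \<ge> k0 \<Longrightarrow> x \<in> K \<Longrightarrow> norm (frame_field l (\<eta>s k) i x) \<le> M" "\<And>k. k \<ge> k0 \<Longrightarrow> Q k 1"
    unfolding eventually_sequentially by blast
  \<comment> \<open>The sequences are shifted by \<open>k0\<close>, so that the bounds hold for all indices.\<close>
  define X where "X k i = frame_field l (\<eta>s (k + k0)) i" for k i
  define p where "p k s = F (k + k0) i s x0" for k s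
  define W where "W k = (\<lambda>(s, t). F (k + k0) j t (p k s))" for k
  have ff: "form_flow (\<eta>s (k + k0)) U l V t0 (F (k + k0))" for k by (rule k0) simp
  have stay: "F (k + k0) m t q \<in> K \<and> dist x0 (F (k + k0) m t q) \<le> dist x0 q + M * r"
    if "m \<noteq> l" "q \<in> V" "t \<in> I" "dist x0 q + M * r < \<rho>" for k m t q
  proof -
    interpret form_flow "\<eta>s (k + k0)" U l V t0 "F (k + k0)" by (rule ff)
    have Mt: "M * \<bar>t\<bar> \<le> M * r" using that(3) M by (auto simp: I_def)
    have "F (k + k0) m t q \<in> cball x0 \<rho> \<and> dist x0 (F (k + k0) m t q) \<le> dist x0 (F (k + k0) m 0 q) + M * \<bar>t\<bar>"
    proof (rule solution_stays[OF flow_solution[OF that(1,2)]])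
      show "dist x0 (F (k + k0) m 0 q) + M * \<bar>t\<bar> < \<rho>" using Mt that flow_0 by simp
      show "norm (frame m y) \<le> M" if "y \<in> cball x0 \<rho>" for y using k0(2) that by (simp add: K_def)
    qed (use It0 that t0 M in auto)
    then show ?thesis using Mt flow_0[OF that(1,2)] by (auto simp: K_def)
  qed
  have Mr: "0 < M * r" "M * r < \<rho>" "2 * (M * r) < \<rho>"
    using mult_pos_pos[OF M(1) r(1)] r(3) by linarith+
  have p: "p k s \<in> K" "dist x0 (p k s) \<le> M * r" if "s \<in> I" for k s
    using stay[OF ij(1) x0 that, of k] Mr by (auto simp: p_def)
  have W: "W k (s, t) \<in> K" if "s \<in> I" "t \<in> I" for k s t
    using stay[OF ij(2) _ that(2), of "p k s" k] p[OF that(1), of k] K(2) Mr by (auto simp: W_def)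
  have dT: "((\<lambda>t. W k (s, t)) has_vector_derivative X k j (W k (s, t))) (at t within I)"
    if "s \<in> I" "t \<in> I" for k s t
  proof -
    interpret form_flow "\<eta>s (k + k0)" U l V t0 "F (k + k0)" by (rule ff)
    have "p k s \<in> V" using p(1) that K(2) by blast
    from solution_subset[OF flow_solution[OF ij(2) this] It0] that
    show ?thesis by (simp add: solution_def W_def X_def)
  qed
  have dS_ex: "\<exists>E. ((\<lambda>s. W k (s, t)) has_vector_derivative X k i (W k (s, t)) + E *\<^sub>R axis l 1) (at s within I)
      \<and> \<bar>E\<bar> \<le> \<epsilon> * \<bar>t\<bar>" if st: "s \<in> I" "t \<in> I" and q: "Q (k + k0) \<epsilon>" for k s t \<epsilon>
  proof -
    interpret form_flow "\<eta>s (k + k0)" U l V t0 "F (k + k0)" by (rule ff)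
    have "\<exists>E. ((\<lambda>s. F (k + k0) j t (F (k + k0) i s x0)) has_vector_derivative
            frame i (F (k + k0) j t (F (k + k0) i s x0)) + E *\<^sub>R axis l 1) (at s within I) \<and> \<bar>E\<bar> \<le> \<epsilon> * \<bar>t\<bar>"
    proof (rule composed_flow_derivative[OF ij x0 It0 _ st(1)])
      show "F (k + k0) i s x0 \<in> V" if "s \<in> I" for s using p(1)[OF that] K(2) by (auto simp: p_def)
      show "t \<in> {-t0..t0}" using st It0 by blast
      fix \<tau> assume \<tau>: "\<tau> \<in> closed_segment 0 t"
      then have \<tau>I: "\<tau> \<in> I" using st by (auto simp: I_def closed_segment_eq_real_ivl split: if_splits)
      have t\<tau>: "t - \<tau> \<in> {-t0..t0}" using \<tau> st It0 by (auto simp: I_def closed_segment_eq_real_ivl split: if_splits)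
      have "F (k + k0) j \<tau> (F (k + k0) i s x0) \<in> K" using W[OF st(1) \<tau>I, of k] by (simp add: W_def p_def)
      then show "F (k + k0) j \<tau> (F (k + k0) i s x0) \<in> V \<and>
        \<bar>ext_deriv (\<eta>s (k + k0)) (F (k + k0) j \<tau> (F (k + k0) i s x0)) (frame i (F (k + k0) j \<tau> (F (k + k0) i s x0)))
           (frame j (F (k + k0) j \<tau> (F (k + k0) i s x0)))\<bar>
          * exp (avg j (F (k + k0) j \<tau> (F (k + k0) i s x0)) (t - \<tau>)) \<le> \<epsilon>"
        using q t\<tau> K(2) unfolding Q_def by blast
    qed
    then show ?thesis by (simp add: W_def p_def X_def)
  qed
  \<comment> \<open>The defect is bounded with different \<open>\<epsilon>\<close>, so the derivative is fixed first, independently of \<open>\<epsilon>\<close>.\<close>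
  define A where "A k s t = vector_derivative (\<lambda>s. W k (s, t)) (at s within I)" for k s t
  have A: "((\<lambda>s. W k (s, t)) has_vector_derivative A k s t) (at s within I) \<and>
      norm (A k s t - X k i (W k (s, t))) \<le> \<epsilon> * r"
    if st: "s \<in> I" "t \<in> I" and q: "Q (k + k0) \<epsilon>" and "0 < \<epsilon>" for k s t \<epsilon>
  proof -
    obtain E where E: "((\<lambda>s. W k (s, t)) has_vector_derivative X k i (W k (s, t)) + E *\<^sub>R axis l 1) (at s within I)"
      "\<bar>E\<bar> \<le> \<epsilon> * \<bar>t\<bar>" using dS_ex[OF st q] by blast
    have "A k s t = X k i (W k (s, t)) + E *\<^sub>R axis l 1"
      unfolding A_def I_def
      by (rule vector_derivative_within_closed_interval) (use E(1) st r in \<open>auto simp: I_def\<close>)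
    moreover have "\<epsilon> * \<bar>t\<bar> \<le> \<epsilon> * r" using st \<open>0 < \<epsilon>\<close> by (intro mult_left_mono) (auto simp: I_def)
    ultimately show ?thesis using E by (simp add: norm_axis_1)
  qed
  have A1: "((\<lambda>s. W k (s, t)) has_vector_derivative A k s t) (at s within I)"
    "norm (A k s t - X k i (W k (s, t))) \<le> r" if "s \<in> I" "t \<in> I" for k s t
    using A[OF that k0(3) zero_less_one, of k] by auto
  have Xb: "norm (X k m y) \<le> M" if "y \<in> K" for k m y using k0(2)[of "k + k0"] that by (simp add: X_def)
  have conv: "\<forall>\<^sub>F k in sequentially. \<forall>y\<in>K. \<forall>m. norm (X k m y - limit_frame m y) \<le> e" if "0 < e" for e
    using frames_converge[OF K(1,3) that] unfolding X_def
    by (subst eventually_sequentially_seg[where k=k0 and P="\<lambda>k. \<forall>y\<in>K. \<forall>m. norm (frame_field l (\<eta>s k) m y - limit_frame m y) \<le> e"])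
  obtain Z \<phi> where Z: "continuous_on (I \<times> I) Z" "strict_mono (\<phi> :: nat \<Rightarrow> nat)"
    "\<And>s t. s \<in> I \<Longrightarrow> t \<in> I \<Longrightarrow> (\<lambda>n. W (\<phi> n) (s, t)) \<longlonglongrightarrow> Z (s, t)"
    "\<And>s t. s \<in> I \<Longrightarrow> t \<in> I \<Longrightarrow> Z (s, t) \<in> K"
    "\<And>s t. s \<in> I \<Longrightarrow> t \<in> I \<Longrightarrow> ((\<lambda>s. Z (s, t)) has_vector_derivative limit_frame i (Z (s, t))) (at s within I)"
    "\<And>s t. s \<in> I \<Longrightarrow> t \<in> I \<Longrightarrow> ((\<lambda>t. Z (s, t)) has_vector_derivative limit_frame j (Z (s, t))) (at t within I)"
  proof (rule limit_surface[of I r K W A "\<lambda>k s t. X k j (W k (s, t))" "M + r" "limit_frame i" "limit_frame j"])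
    show "I = {-r..r}" "0 < r" "compact K" using I_def r K by auto
    show "W k (s, t) \<in> K" if "s \<in> I" "t \<in> I" for k s t by (rule W[OF that])
    show "((\<lambda>s. W k (s, t)) has_vector_derivative A k s t) (at s within I)" if "s \<in> I" "t \<in> I" for k s t
      by (rule A1(1)[OF that])
    show "((\<lambda>t. W k (s, t)) has_vector_derivative X k j (W k (s, t))) (at t within I)"
      if "s \<in> I" "t \<in> I" for k s t by (rule dT[OF that])
    show "norm (A k s t) \<le> M + r" if "s \<in> I" "t \<in> I" for k s t
      using norm_triangle_mono[OF A1(2)[OF that, of k] Xb[OF W[OF that, of k], of k i]] by simp
    show "norm (X k j (W k (s, t))) \<le> M + r" if "s \<in> I" "t \<in> I" for k s t
      using Xb[OF W[OF that, of k], of k j] r by simp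
    show "continuous_on K (limit_frame i)" "continuous_on K (limit_frame j)"
      by (rule continuous_limit_frame[OF K(3)])+
    show "\<forall>\<^sub>F k in sequentially. \<forall>s\<in>I. \<forall>t\<in>I. norm (X k j (W k (s, t)) - limit_frame j (W k (s, t))) \<le> e"
      if "0 < e" for e
      using conv[OF that] by eventually_elim (use W in blast)
    show "\<forall>\<^sub>F k in sequentially. \<forall>s\<in>I. \<forall>t\<in>I. norm (A k s t - limit_frame i (W k (s, t))) \<le> e"
      if "0 < e" for e
    proof -
      have pos: "0 < e / 2" "0 < e / (2 * r)" using that r by auto
      have "\<forall>\<^sub>F k in sequentially. Q (k + k0) (e / (2 * r))"
        using Q[OF pos(2)] by (subst eventually_sequentially_seg)
      with conv[OF pos(1)] show ?thesis
      proof eventually_elim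
        case (elim k)
        show ?case
        proof (intro ballI)
          fix s t assume st: "s \<in> I" "t \<in> I"
          have "norm (A k s t - X k i (W k (s, t))) \<le> e / (2 * r) * r"
            using A[OF st elim(2) pos(2)] by blast
          also have "\<dots> = e / 2" using r by simp
          finally have 1: "norm (A k s t - X k i (W k (s, t))) \<le> e / 2" .
          have 2: "norm (X k i (W k (s, t)) - limit_frame i (W k (s, t))) \<le> e / 2"
            using elim(1) W[OF st] by blast
          show "norm (A k s t - limit_frame i (W k (s, t))) \<le> e"
            using norm_diff_triangle_le[OF 1 2] by (simp only: field_sum_of_halves)
        qed
      qed
    qed
  qed blast
  have Wm: "W k (s, t) $ m = x0 $ m + s * axis i 1 $ m + t * axis j 1 $ m" if "s \<in> I" "t \<in> I" "m \<noteq> l" for k s t m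
  proof -
    interpret form_flow "\<eta>s (k + k0)" U l V t0 "F (k + k0)" by (rule ff)
    have "p k s \<in> V" using p(1) that K(2) by blast
    moreover have "s \<in> {-t0..t0}" "t \<in> {-t0..t0}" using that It0 by auto
    ultimately show ?thesis
      using flow_component[OF ij(2), of "p k s" t m] flow_component[OF ij(1) x0, of s m] that(3)
      by (simp add: W_def p_def)
  qed
  show ?thesis
  proof (rule that[of r Z])
    have "W k (0, 0) = x0" for k
      using form_flow.flow_0[OF ff ij(1) x0, of k] form_flow.flow_0[OF ff ij(2) x0, of k]
      by (simp add: W_def p_def)
    then show "Z (0, 0) = x0" using LIMSEQ_unique[OF Z(3)[OF \<open>0 \<in> I\<close> \<open>0 \<in> I\<close>]] by simp
    show "Z (s, t) $ m = x0 $ m + s * axis i 1 $ m + t * axis j 1 $ m"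
      if "s \<in> {-r..r}" "t \<in> {-r..r}" "m \<noteq> l" for s t m
      using LIMSEQ_unique[OF tendsto_vec_nth[OF Z(3)[of s t], of m]] Wm that by (simp add: I_def)
    show "Z (s, t) \<in> U" if "s \<in> {-r..r}" "t \<in> {-r..r}" for s t
      using Z(4)[of s t] that K(3) by (auto simp: I_def)
  qed (use Z r in \<open>auto simp: I_def\<close>)
qed

text \<open>The function \<open>w\<close> is the last coordinate of the limit surface.\<close>

theorem local_integral_graph:
  assumes limit: bracket_limit
    and ij: "UNIV = {i, j, l}" "i \<noteq> l" "j \<noteq> l" and x0: "x0 \<in> V"
  obtains r w w' where "integral_graph l \<eta> U x0 r w w'"
proof -
  obtain r Z where r: "0 < r" and Zc: "continuous_on ({-r..r} \<times> {-r..r}) Z" and Z0: "Z (0, 0) = x0"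
    and ZU: "\<And>s t. s \<in> {-r..r} \<Longrightarrow> t \<in> {-r..r} \<Longrightarrow> Z (s, t) \<in> U"
    and dS: "\<And>s t. s \<in> {-r..r} \<Longrightarrow> t \<in> {-r..r} \<Longrightarrow>
       ((\<lambda>s. Z (s, t)) has_vector_derivative limit_frame i (Z (s, t))) (at s within {-r..r})"
    and dT: "\<And>s t. s \<in> {-r..r} \<Longrightarrow> t \<in> {-r..r} \<Longrightarrow>
       ((\<lambda>t. Z (s, t)) has_vector_derivative limit_frame j (Z (s, t))) (at t within {-r..r})"
    and Zm: "\<And>s t m. s \<in> {-r..r} \<Longrightarrow> t \<in> {-r..r} \<Longrightarrow> m \<noteq> l \<Longrightarrow>
       Z (s, t) $ m = x0 $ m + s * axis i 1 $ m + t * axis j 1 $ m"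
    by (rule integral_surface[OF limit ij(2,3) x0]) blast
  define J where "J = {-r<..<r}"
  have J: "J \<subseteq> {-r..r}" "open J" "convex J" by (auto simp: J_def)
  have JI: "s \<in> {-r..r}" if "s \<in> J" for s using that J(1) by blast
  have dZ: "(Z has_derivative (\<lambda>h. fst h *\<^sub>R limit_frame i (Z (s, t)) + snd h *\<^sub>R limit_frame j (Z (s, t)))) (at (s, t))"
    if st: "s \<in> J" "t \<in> J" for s t
  proof -
    have "((\<lambda>(s, t). Z (s, t)) has_derivative
        (\<lambda>(a, b). a *\<^sub>R limit_frame i (Z (s, t)) + blinfun_scaleR_left (limit_frame j (Z (s, t))) b)) (at (s, t) within J \<times> J)"
    proof (rule has_derivative_partialsI[where f="\<lambda>s t. Z (s, t)" and fy="\<lambda>s t. blinfun_scaleR_left (limit_frame j (Z (s, t)))"])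
      show "((\<lambda>s. Z (s, t)) has_derivative (\<lambda>a. a *\<^sub>R limit_frame i (Z (s, t)))) (at s within J)"
        using has_vector_derivative_within_subset[OF dS[OF JI[OF st(1)] JI[OF st(2)]] J(1)]
        by (simp add: has_vector_derivative_def)
      show "((\<lambda>t. Z (s, t)) has_derivative blinfun_scaleR_left (limit_frame j (Z (s, t)))) (at t within J)"
        if "s \<in> J" "t \<in> J" for s t
        using has_vector_derivative_within_subset[OF dT[OF JI[OF that(1)] JI[OF that(2)]] J(1)]
        by (simp add: has_vector_derivative_def blinfun_scaleR_left.rep_eq)
      have "continuous_on ({-r..r} \<times> {-r..r}) (\<lambda>p. limit_frame j (Z p))"
        by (rule continuous_on_compose2[OF continuous_limit_frame[OF order_refl] Zc]) (use ZU in auto)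
      then have "continuous_on (J \<times> J) (\<lambda>p. blinfun_scaleR_left (limit_frame j (Z p)))"
        using J(1) by (intro bounded_linear.continuous_on[OF bounded_linear_blinfun_scaleR_left])
          (auto intro: continuous_on_subset)
      then show "continuous (at (s, t) within J \<times> J) (\<lambda>(x, y). blinfun_scaleR_left (limit_frame j (Z (x, y))))"
        using st by (simp add: continuous_on_eq_continuous_within split_def)
    qed (use st J in auto)
    moreover have "at (s, t) within J \<times> J = at (s, t)"
      by (rule at_within_open) (use st J in \<open>auto intro: open_Times\<close>)
    ultimately show ?thesis by (simp add: split_def)
  qed
  \<comment> \<open>The surface parameters belonging to a displacement \<open>u\<close>. If \<open>i = j\<close> the second parameter is redundant, and it is
    kept at 0 lest the displacement be counted twice.\<close>
  define \<pi> where "\<pi> u = (u $ i, if i = j then 0 else u $ j)" for u :: "real^'n"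
  have lin: "bounded_linear \<pi>"
    unfolding \<pi>_def by (cases "i = j") (simp_all add: bounded_linear_Pair bounded_linear_vec_nth bounded_linear_zero)
  then have \<pi>diff: "\<pi> (x - y) = \<pi> x - \<pi> y" for x y by (simp add: linear_diff bounded_linear.linear)
  define w where "w x = Z (\<pi> (x - x0)) $ l" for x
  define w' where "w' x u = (fst (\<pi> u) *\<^sub>R limit_frame i (Z (\<pi> (x - x0))) + snd (\<pi> u) *\<^sub>R limit_frame j (Z (\<pi> (x - x0)))) $ l" for x u
  have mem: "fst (\<pi> (x - x0)) \<in> J" "snd (\<pi> (x - x0)) \<in> J" if "x \<in> cylinder l x0 r" for x
    using that ij r unfolding cylinder_def by (auto simp: \<pi>_def J_def abs_less_iff)
  have P: "graph_point l w x = Z (\<pi> (x - x0))" if x: "x \<in> cylinder l x0 r" for x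
    unfolding vec_eq_iff
  proof
    fix m
    obtain s t where st: "\<pi> (x - x0) = (s, t)" by (cases "\<pi> (x - x0)")
    show "graph_point l w x $ m = Z (\<pi> (x - x0)) $ m"
    proof (cases "m = l")
      case True then show ?thesis by (simp add: graph_point_def w_def)
    next
      case False
      then have m: "m = i \<or> m = j" using ij(1) by blast
      have "s \<in> {-r..r}" "t \<in> {-r..r}" using mem[OF x] J(1) st by auto
      from Zm[OF this False] show ?thesis
        using False m st by (auto simp: graph_point_def axis_def \<pi>_def split: if_splits)
    qed
  qed
  have tangent: "(w has_derivative w' x) (at x) \<and> graph_point l w x \<in> U \<and>
      (\<forall>u. w' x u = u $ l - \<eta> (graph_point l w x) \<bullet> u)" if x: "x \<in> cylinder l x0 r" for x
  proof (intro conjI allI)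
    have "((\<lambda>x. \<pi> (x - x0)) has_derivative \<pi>) (at x)"
      unfolding \<pi>diff by (auto intro!: derivative_eq_intros bounded_linear_imp_has_derivative lin)
    from has_derivative_compose[OF this, of Z] dZ[OF mem[OF x]]
    have "((\<lambda>x. Z (\<pi> (x - x0))) has_derivative
        (\<lambda>u. fst (\<pi> u) *\<^sub>R limit_frame i (Z (\<pi> (x - x0))) + snd (\<pi> u) *\<^sub>R limit_frame j (Z (\<pi> (x - x0))))) (at x)"
      by simp
    then show "(w has_derivative w' x) (at x)"
      unfolding w_def[abs_def] w'_def[abs_def] by (rule bounded_linear.has_derivative[OF bounded_linear_vec_nth])
    have "Z (\<pi> (x - x0)) \<in> U"
      using ZU[OF JI[OF mem(1)[OF x]] JI[OF mem(2)[OF x]]] by simp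
    then show PU: "graph_point l w x \<in> U" using P[OF x] by simp
    fix u
    define z where "z = Z (\<pi> (x - x0))"
    have "\<eta> z $ l = 1" using PU P[OF x] limit_normalised by (simp add: z_def)
    moreover have "\<eta> z \<bullet> u = (\<Sum>m\<in>{i, j, l}. \<eta> z $ m * u $ m)"
      unfolding inner_vec_def ij(1) by simp
    ultimately have "w' x u = u $ l - \<eta> z \<bullet> u"
      using ij(2,3) unfolding w'_def z_def[symmetric] by (cases "i = j") (auto simp: \<pi>_def axis_def)
    then show "w' x u = u $ l - \<eta> (graph_point l w x) \<bullet> u"
      using P[OF x] by (simp add: z_def)
  qed
  have "w x0 = x0 $ l" using Z0 by (simp add: w_def \<pi>_def zero_prod_def)
  moreover have "w (x + a *\<^sub>R axis l 1) = w x" for x a using ij by (simp add: w_def \<pi>_def axis_def)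
  ultimately have "integral_graph l \<eta> U x0 r w w'"
    unfolding integral_graph_def using r tangent by blast
  then show ?thesis by (rule that)
qed

end

section \<open>Charts, tangent vectors and graphs as integral manifolds\<close>

lemma Ck_on_1I:
  fixes f :: "'a::euclidean_space \<Rightarrow> 'b::real_normed_vector"
  assumes d: "\<And>x. x \<in> S \<Longrightarrow> (f has_derivative f' x) (at x)"
    and c: "\<And>v. continuous_on S (\<lambda>x. f' x v)"
  shows "Ck_on 1 f S"
proof -
  have "continuous_on S (\<lambda>x. frechet_derivative f (at x) v)" for v
    by (rule continuous_on_eq[OF c]) (simp add: frechet_derivative_at[OF d, symmetric])
  moreover have "f differentiable (at x)" if "x \<in> S" for x
    using d[OF that] unfolding differentiable_def by blast
  ultimately show ?thesis by simp
qed

lemma Ck_on_cong: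
  fixes f g :: "'a::euclidean_space \<Rightarrow> 'b::real_normed_vector"
  assumes "open T" "T \<subseteq> S" "\<And>x. x \<in> T \<Longrightarrow> f x = g x" "Ck_on k f S"
  shows "Ck_on k g T"
  using assms(3,4)
proof (induction k arbitrary: f g)
  case 0
  have "continuous_on S f" using 0(2) by simp
  then have "continuous_on T f" by (rule continuous_on_subset[OF _ assms(2)])
  from continuous_on_eq[OF this 0(1)] show ?case by simp
next
  case (Suc k)
  have d: "(g has_derivative frechet_derivative f (at x)) (at x)" if x: "x \<in> T" for x
  proof (rule has_derivative_transform_within_open[OF _ assms(1) x])
    have "x \<in> S" using x assms(2) by blast
    then show "(f has_derivative frechet_derivative f (at x)) (at x)"
      using Suc.prems(2) frechet_derivative_works by auto
  qed (rule Suc.prems(1))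
  have "Ck_on k (\<lambda>x. frechet_derivative g (at x) v) T" for v
  proof (rule Suc.IH)
    show "Ck_on k (\<lambda>x. frechet_derivative f (at x) v) S" using Suc.prems(2) by simp
    show "frechet_derivative f (at x) v = frechet_derivative g (at x) v" if "x \<in> T" for x
      using frechet_derivative_at[OF d[OF that]] by simp
  qed
  moreover have "g differentiable (at x)" if "x \<in> T" for x
    using d[OF that] unfolding differentiable_def by blast
  ultimately show ?case by simp
qed

lemma smooth_on_cong:
  "open T \<Longrightarrow> T \<subseteq> S \<Longrightarrow> (\<And>x. x \<in> T \<Longrightarrow> f x = g x) \<Longrightarrow> smooth_on f S \<Longrightarrow> smooth_on g T"
  unfolding smooth_on_def using Ck_on_cong by blast

locale manifold =
  fixes M :: "'a topology" and A :: "('a, 'n::finite) chart set"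
  assumes manifold: "smooth_manifold M A"
begin

lemma chart: "c \<in> A \<Longrightarrow> is_chart M c"
  using manifold by (auto simp: smooth_manifold_def)

lemma openin_chart: "c \<in> A \<Longrightarrow> openin M (fst c)"
  using chart by (auto simp: is_chart_def)

lemma open_image: "c \<in> A \<Longrightarrow> open (chart_image c)"
  using chart by (auto simp: is_chart_def chart_image_def)

lemma chart_homeomorphic:
  "c \<in> A \<Longrightarrow> homeomorphic_map (subtopology M (fst c)) (top_of_set (chart_image c)) (snd c)"
  using chart by (auto simp: is_chart_def chart_image_def)

lemma topspace_chart: "c \<in> A \<Longrightarrow> topspace (subtopology M (fst c)) = fst c"
  by (rule topspace_subtopology_subset[OF openin_subset[OF openin_chart]])

lemma chart_inj: "c \<in> A \<Longrightarrow> inj_on (snd c) (fst c)"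
  using homeomorphic_imp_injective_map[OF chart_homeomorphic, of c] topspace_chart[of c] by (simp only:)

lemma chart_inv_chart: "c \<in> A \<Longrightarrow> p \<in> fst c \<Longrightarrow> chart_inv c (snd c p) = p"
  using chart_inj by (simp add: chart_inv_def)

lemma chart_chart_inv: "x \<in> chart_image c \<Longrightarrow> snd c (chart_inv c x) = x"
  by (simp add: chart_inv_def chart_image_def f_inv_into_f)

lemma chart_inv_mem: "x \<in> chart_image c \<Longrightarrow> chart_inv c x \<in> fst c"
  by (simp add: chart_inv_def chart_image_def inv_into_into)

lemma chart_mem: "p \<in> fst c \<Longrightarrow> snd c p \<in> chart_image c"
  by (simp add: chart_image_def)

lemma openin_preimage:
  assumes c: "c \<in> A" and T: "open T"
  shows "openin M {p \<in> fst c. snd c p \<in> T}"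
proof -
  have "continuous_map (subtopology M (fst c)) (top_of_set (chart_image c)) (snd c)"
    using chart_homeomorphic[OF c] by (rule homeomorphic_imp_continuous_map)
  then have "openin (subtopology M (fst c)) {p \<in> topspace (subtopology M (fst c)). snd c p \<in> chart_image c \<inter> T}"
    by (rule openin_continuous_map_preimage) (simp add: T openin_open_Int)
  moreover have "{p \<in> topspace (subtopology M (fst c)). snd c p \<in> chart_image c \<inter> T} = {p \<in> fst c. snd c p \<in> T}"
    unfolding topspace_chart[OF c] by (auto intro: chart_mem)
  ultimately show ?thesis using openin_trans_full openin_chart[OF c] by metis
qed

lemma open_image_Int:
  assumes c: "c \<in> A" and W: "openin M W"
  shows "open (snd c ` (fst c \<inter> W))"
proof -
  have "openin (subtopology M (fst c)) (fst c \<inter> W)"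
    using W by (simp add: openin_subtopology_Int2)
  then have "openin (top_of_set (chart_image c)) (snd c ` (fst c \<inter> W))"
    using homeomorphic_imp_open_map[OF chart_homeomorphic[OF c]] by (simp add: open_map_def)
  then show ?thesis using openin_open_eq[OF open_image[OF c]] by blast
qed

lemma continuous_chart_inv:
  assumes c: "c \<in> A"
  shows "continuous_map (top_of_set (chart_image c)) M (chart_inv c)"
proof -
  obtain h where h: "homeomorphic_maps (subtopology M (fst c)) (top_of_set (chart_image c)) (snd c) h"
    using chart_homeomorphic[OF c] by (auto simp: homeomorphic_map_maps)
  have "continuous_map (top_of_set (chart_image c)) M h"
    using h by (auto simp: homeomorphic_maps_def continuous_map_in_subtopology)
  moreover have "h x = chart_inv c x" if "x \<in> chart_image c" for x
  proof -
    have "h (snd c (chart_inv c x)) = chart_inv c x"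
      using h chart_inv_mem[OF that] topspace_chart[OF c] unfolding homeomorphic_maps_def by blast
    then show ?thesis by (simp add: chart_chart_inv[OF that])
  qed
  ultimately show ?thesis by (auto intro: continuous_map_eq)
qed

definition overlap :: "('a, 'n) chart \<Rightarrow> ('a, 'n) chart \<Rightarrow> (real^'n) set" where
  "overlap c d = snd c ` (fst c \<inter> fst d)"

lemma open_overlap: "c \<in> A \<Longrightarrow> d \<in> A \<Longrightarrow> open (overlap c d)"
  unfolding overlap_def by (intro open_image_Int openin_chart)

lemma transition_smooth: "c \<in> A \<Longrightarrow> d \<in> A \<Longrightarrow> smooth_on (transition c d) (overlap c d)"
  using manifold unfolding smooth_manifold_def compatible_def overlap_def by blast

lemma transition_chart: "c \<in> A \<Longrightarrow> p \<in> fst c \<Longrightarrow> transition c d (snd c p) = snd d p"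
  by (simp add: transition_def chart_inv_chart)

lemma transition_C1: "c \<in> A \<Longrightarrow> d \<in> A \<Longrightarrow> Ck_on 1 (transition c d) (overlap c d)"
  using transition_smooth unfolding smooth_on_def by blast

abbreviation DT :: "('a, 'n) chart \<Rightarrow> ('a, 'n) chart \<Rightarrow> real^'n \<Rightarrow> real^'n \<Rightarrow> real^'n" where
  "DT c d x \<equiv> frechet_derivative (transition c d) (at x)"

lemma DT:
  assumes "c \<in> A" "d \<in> A" "x \<in> overlap c d"
  shows "(transition c d has_derivative DT c d x) (at x)"
  using transition_C1[OF assms(1,2)] assms(3) frechet_derivative_works by auto

lemma DT_compose:
  assumes cde: "c \<in> A" "d \<in> A" "e \<in> A" and p: "p \<in> fst c" "p \<in> fst d" "p \<in> fst e"
  shows "DT d e (snd d p) (DT c d (snd c p) u) = DT c e (snd c p) u"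
proof -
  have x: "snd c p \<in> overlap c d" "snd c p \<in> overlap c e" and y: "snd d p \<in> overlap d e"
    using p by (auto simp: overlap_def)
  have "(transition d e has_derivative DT d e (snd d p)) (at (transition c d (snd c p)))"
    using DT[OF cde(2,3) y] transition_chart[OF cde(1) p(1)] by simp
  from has_derivative_compose[OF DT[OF cde(1,2) x(1)] this]
  have "((\<lambda>x. transition d e (transition c d x)) has_derivative (\<lambda>u. DT d e (snd d p) (DT c d (snd c p) u))) (at (snd c p))" .
  then have "(transition c e has_derivative (\<lambda>u. DT d e (snd d p) (DT c d (snd c p) u))) (at (snd c p))"
  proof (rule has_derivative_transform_within_open)
    show "open (snd c ` (fst c \<inter> (fst d \<inter> fst e)))"
      using cde by (intro open_image_Int openin_Int openin_chart)
    show "snd c p \<in> snd c ` (fst c \<inter> (fst d \<inter> fst e))" using p by blast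
    fix z assume "z \<in> snd c ` (fst c \<inter> (fst d \<inter> fst e))"
    then obtain q where "z = snd c q" "q \<in> fst c" "q \<in> fst d" "q \<in> fst e" by blast
    then show "transition d e (transition c d z) = transition c e z" using cde by (simp add: transition_chart)
  qed
  from fun_cong[OF has_derivative_unique[OF this DT[OF cde(1,3) x(2)]]] show ?thesis .
qed

lemma DT_self:
  assumes c: "c \<in> A" and p: "p \<in> fst c"
  shows "DT c c (snd c p) u = u"
proof -
  have x: "snd c p \<in> overlap c c" using p by (auto simp: overlap_def)
  have "(transition c c has_derivative (\<lambda>u. u)) (at (snd c p))"
    by (rule has_derivative_transform_within_open[OF has_derivative_ident open_overlap[OF c c] x])
       (auto simp: overlap_def transition_chart[OF c])
  from fun_cong[OF has_derivative_unique[OF this DT[OF c c x]], of u] show ?thesis by simp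
qed

lemma coord_vec_tangent:
  assumes c: "c \<in> A" and p: "p \<in> fst c"
  shows "coord_vec A c p u \<in> tangent_space A p" "coord_vec A c p u c = u"
  using assms by (auto simp: coord_vec_def tangent_space_def DT_compose DT_self)

text \<open>The restriction is compatible with every chart, so it belongs to the maximal atlas.\<close>

lemma restricted_chart:
  assumes c: "c \<in> A" and T: "open T"
  defines "c' \<equiv> ({p \<in> fst c. snd c p \<in> T}, snd c)"
  shows "c' \<in> A" "chart_image c' = chart_image c \<inter> T"
proof -
  show img: "chart_image c' = chart_image c \<inter> T" by (auto simp: chart_image_def c'_def)
  have sub: "fst c' \<subseteq> fst c" by (auto simp: c'_def)
  have op: "openin M (fst c')" using openin_preimage[OF c T] by (simp add: c'_def)
  have inj: "inj_on (snd c) (fst c')" using chart_inj[OF c] sub inj_on_subset by blast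
  have hom: "homeomorphic_map (subtopology M (fst c')) (top_of_set (chart_image c')) (snd c')"
  proof -
    have t: "topspace (subtopology M (fst c)) \<inter> fst c' = fst c'" using topspace_chart[OF c] sub by auto
    have "homeomorphic_map (subtopology (subtopology M (fst c)) (fst c'))
       (subtopology (top_of_set (chart_image c)) (chart_image c')) (snd c)"
    proof (rule homeomorphic_map_subtopologies[OF chart_homeomorphic[OF c]])
      show "snd c ` (topspace (subtopology M (fst c)) \<inter> fst c') = topspace (top_of_set (chart_image c)) \<inter> chart_image c'"
        unfolding t using img by (auto simp: chart_image_def c'_def)
    qed
    then show ?thesis using sub img by (simp add: subtopology_subtopology c'_def Int_absorb1 inf.absorb2 Int_absorb2)
  qed
  have chart': "is_chart M c'"
    unfolding is_chart_def using op hom img open_image[OF c] T by (auto simp: chart_image_def)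
  have inv: "chart_inv c' x = chart_inv c x" if x: "x \<in> chart_image c'" for x
  proof -
    obtain q where q: "q \<in> fst c'" "x = snd c q"
      using x by (auto simp: chart_image_def c'_def)
    have "chart_inv c' x = q" unfolding chart_inv_def q(2) using inj q(1) by (simp add: c'_def)
    moreover have "chart_inv c x = q" unfolding q(2) using chart_inv_chart[OF c] q(1) sub by auto
    ultimately show ?thesis by simp
  qed
  have "compatible c' d" if d: "d \<in> A" for d
    unfolding compatible_def
  proof
    have "openin M (fst c' \<inter> fst d)" using op openin_chart[OF d] by blast
    then have "open (snd c ` (fst c \<inter> (fst c' \<inter> fst d)))" by (rule open_image_Int[OF c])
    moreover have "fst c \<inter> (fst c' \<inter> fst d) = fst c' \<inter> fst d" using sub by blast
    ultimately have "open (snd c' ` (fst c' \<inter> fst d))" by (simp add: c'_def)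
    then show "smooth_on (transition c' d) (snd c' ` (fst c' \<inter> fst d))"
    proof (rule smooth_on_cong[OF _ _ _ transition_smooth[OF c d]])
      show "snd c' ` (fst c' \<inter> fst d) \<subseteq> overlap c d" using sub by (auto simp: overlap_def c'_def)
      show "transition c d x = transition c' d x" if "x \<in> snd c' ` (fst c' \<inter> fst d)" for x
        using inv[of x] that by (auto simp: transition_def chart_image_def)
    qed
    have "open (snd d ` (fst d \<inter> fst c'))" by (rule open_image_Int[OF d op])
    then have "open (snd d ` (fst c' \<inter> fst d))" by (simp add: Int_commute)
    then show "smooth_on (transition d c') (snd d ` (fst c' \<inter> fst d))"
    proof (rule smooth_on_cong[OF _ _ _ transition_smooth[OF d c]])
      show "snd d ` (fst c' \<inter> fst d) \<subseteq> overlap d c" using sub by (auto simp: overlap_def)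
    qed (simp add: transition_def c'_def)
  qed
  then show "c' \<in> A" using manifold chart' unfolding smooth_manifold_def by blast
qed

text \<open>A curve given in one chart has the right velocity in every chart, because the components of a tangent
  vector transform by the derivatives of the transition maps.\<close>

lemma curve_tangent:
  assumes c: "c \<in> A" and p: "p \<in> fst c" and v: "v \<in> tangent_space A p" and "0 < \<epsilon>"
    and y: "y 0 = snd c p" "continuous_on {-\<epsilon><..<\<epsilon>} y" "(y has_vector_derivative v c) (at 0)"
    and img: "\<And>t. t \<in> {-\<epsilon><..<\<epsilon>} \<Longrightarrow> y t \<in> chart_image c \<and> chart_inv c (y t) \<in> N"
  shows "v \<in> submanifold_tangent_space M A N p"
proof -
  define \<gamma> where "\<gamma> t = chart_inv c (y t)" for t
  have "continuous_map (top_of_set {-\<epsilon><..<\<epsilon>}) (top_of_set (chart_image c)) y"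
    using y(2) img by (auto simp: continuous_map_in_subtopology)
  then have cont: "continuous_map (top_of_set {-\<epsilon><..<\<epsilon>}) M \<gamma>"
    using continuous_map_compose[OF _ continuous_chart_inv[OF c], of "top_of_set {-\<epsilon><..<\<epsilon>}" y]
    unfolding o_def \<gamma>_def[abs_def] by blast
  have "((\<lambda>t. snd d (\<gamma> t)) has_vector_derivative v d) (at 0)" if d: "d \<in> A" "p \<in> fst d" for d
  proof -
    have x: "snd c p \<in> overlap c d" using p d by (auto simp: overlap_def)
    have "(transition c d has_derivative DT c d (snd c p)) (at (y 0))" using DT[OF c d(1) x] y(1) by simp
    from has_derivative_compose[OF y(3)[unfolded has_vector_derivative_def] this]
    have "((\<lambda>t. transition c d (y t)) has_derivative (\<lambda>h. DT c d (snd c p) (h *\<^sub>R v c))) (at 0)" .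
    moreover have "v d = DT c d (snd c p) (v c)" using v c d p unfolding tangent_space_def by blast
    then have "DT c d (snd c p) (h *\<^sub>R v c) = h *\<^sub>R v d" for h
      using linear_cmul[OF has_derivative_linear[OF DT[OF c d(1) x]], of h "v c"] by simp
    ultimately show ?thesis by (simp add: has_vector_derivative_def transition_def \<gamma>_def)
  qed
  moreover have "\<gamma> 0 = p" using y(1) chart_inv_chart[OF c p] by (simp add: \<gamma>_def)
  moreover have "\<gamma> ` {-\<epsilon><..<\<epsilon>} \<subseteq> N" using img by (auto simp: \<gamma>_def)
  ultimately show ?thesis
    unfolding submanifold_tangent_space_def using v cont \<open>0 < \<epsilon>\<close> by blast
qed

text \<open>The map \<open>x \<mapsto> x - w x *\<^sub>R axis l 1\<close> flattens the graph. As \<open>w\<close> is constant in the vertical direction, the map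
  \<open>x \<mapsto> x + w x *\<^sub>R axis l 1\<close> is its inverse, and no inverse function theorem is needed.\<close>

theorem graph_integral_manifold:
  fixes w :: "real^'n \<Rightarrow> real" and l :: 'n
  assumes c: "c \<in> A" and p0: "p0 \<in> fst c" and x0: "x0 = snd c p0"
    and ker: "is_kernel_on A c \<eta> \<Delta>" and cont: "continuous_on (chart_image c) \<eta>"
    and norml: "\<And>x. x \<in> chart_image c \<Longrightarrow> \<eta> x $ l = 1"
    and graph: "integral_graph l \<eta> (chart_image c) x0 r w w'"
  obtains N where "integral_manifold M A \<Delta> N" "p0 \<in> N"
proof -
  define cyl where "cyl = cylinder l x0 r"
  have cyl_shift: "x + a *\<^sub>R axis l 1 \<in> cyl \<longleftrightarrow> x \<in> cyl" for x a by (simp add: cyl_def cylinder_def axis_def)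
  have "cyl = (\<Inter>m\<in>-{l}. {x. \<bar>x $ m - x0 $ m\<bar> < r})" by (auto simp: cyl_def cylinder_def)
  moreover have "open {x :: real^'n. \<bar>x $ m - x0 $ m\<bar> < r}" for m
    by (intro open_Collect_less continuous_intros)
  ultimately have "open cyl" by (simp add: open_INT)
  have dw: "(w has_derivative w' x) (at x)" and img: "x + (w x - x $ l) *\<^sub>R axis l 1 \<in> chart_image c"
    and w': "w' x u = u $ l - \<eta> (x + (w x - x $ l) *\<^sub>R axis l 1) \<bullet> u" if "x \<in> cyl" for x u
    using graph that by (auto simp: integral_graph_def graph_point_def cyl_def)
  have r: "0 < r" and w0: "w x0 = x0 $ l" and inv: "w (x + a *\<^sub>R axis l 1) = w x" for x a
    using graph by (auto simp: integral_graph_def)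
  have wcont: "continuous_on cyl w"
    by (intro continuous_at_imp_continuous_on ballI has_derivative_continuous[OF dw])
  have w'cont: "continuous_on cyl (\<lambda>x. w' x u)" for u
  proof -
    have "continuous_on cyl (\<lambda>x. \<eta> (x + (w x - x $ l) *\<^sub>R axis l 1))"
      by (rule continuous_on_compose2[OF cont]) (use img in \<open>auto intro!: continuous_intros wcont\<close>)
    then have "continuous_on cyl (\<lambda>x. u $ l - \<eta> (x + (w x - x $ l) *\<^sub>R axis l 1) \<bullet> u)"
      by (intro continuous_intros)
    then show ?thesis by (rule continuous_on_eq) (simp add: w')
  qed
  define N where "N = {p \<in> fst c. snd c p \<in> cyl \<and> snd c p $ l = w (snd c p)}"
  define c' where "c' = ({p \<in> fst c. snd c p \<in> cyl}, snd c)"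
  define T where "T = chart_image c \<inter> cyl"
  have c': "c' \<in> A" "chart_image c' = T"
    using restricted_chart[OF c \<open>open cyl\<close>] by (auto simp: c'_def T_def)
  have "open T" using open_image[OF c] \<open>open cyl\<close> by (auto simp: T_def)
  define \<psi> where "\<psi> x = x - w x *\<^sub>R axis l 1" for x :: "real^'n"
  define \<phi> where "\<phi> x = x + w x *\<^sub>R axis l 1" for x :: "real^'n"
  have w\<psi>: "w (\<psi> x) = w x" for x using inv[of x "- w x"] by (simp add: \<psi>_def)
  have w\<phi>: "w (\<phi> x) = w x" for x using inv[of x "w x"] by (simp add: \<phi>_def)
  have \<phi>\<psi>: "\<phi> (\<psi> x) = x" for x using w\<psi>[of x] by (simp add: \<phi>_def) (simp add: \<psi>_def)
  have \<psi>\<phi>: "\<psi> (\<phi> x) = x" for x using w\<phi>[of x] by (simp add: \<psi>_def) (simp add: \<phi>_def)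
  have \<psi>T: "\<psi> ` T = cyl \<inter> \<phi> -` T"
  proof -
    have "y \<in> cyl" if "\<phi> y \<in> cyl" for y using that cyl_shift by (simp add: \<phi>_def)
    moreover have "\<psi> x \<in> cyl \<longleftrightarrow> x \<in> cyl" for x
      using cyl_shift[of x "- w x"] by (simp add: \<psi>_def)
    moreover have "y \<in> \<psi> ` T \<longleftrightarrow> \<phi> y \<in> T" for y using \<phi>\<psi> \<psi>\<phi> by (metis imageE imageI)
    ultimately show ?thesis unfolding T_def by blast
  qed
  have "continuous_on cyl \<phi>" unfolding \<phi>_def by (intro continuous_intros wcont)
  then have "open (\<psi> ` T)"
    unfolding \<psi>T using \<open>open cyl\<close> \<open>open T\<close> by (simp add: continuous_on_open_vimage Int_commute)
  have inj: "inj_on \<psi> T" by (rule inj_on_inverseI[of _ \<phi>]) (rule \<phi>\<psi>)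
  have d\<phi>: "(\<phi> has_derivative (\<lambda>u. u + w' x u *\<^sub>R axis l 1)) (at x)" if "x \<in> cyl" for x
    unfolding \<phi>_def by (intro has_derivative_add has_derivative_ident has_derivative_scaleR_left dw that)
  have C1\<psi>: "Ck_on 1 \<psi> T"
  proof (rule Ck_on_1I)
    show "(\<psi> has_derivative (\<lambda>u. u - w' x u *\<^sub>R axis l 1)) (at x)" if "x \<in> T" for x
      unfolding \<psi>_def using that
      by (intro has_derivative_diff has_derivative_ident has_derivative_scaleR_left dw) (simp add: T_def)
    show "continuous_on T (\<lambda>x. v - w' x v *\<^sub>R axis l 1)" for v
      by (intro continuous_intros continuous_on_subset[OF w'cont]) (simp add: T_def)
  qed
  have C1\<phi>: "Ck_on 1 (inv_into T \<psi>) (\<psi> ` T)"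
  proof (rule Ck_on_cong[where f=\<phi> and S="\<psi> ` T"])
    show "Ck_on 1 \<phi> (\<psi> ` T)"
    proof (rule Ck_on_1I)
      show "(\<phi> has_derivative (\<lambda>u. u + w' x u *\<^sub>R axis l 1)) (at x)" if "x \<in> \<psi> ` T" for x
        using d\<phi> that by (simp add: \<psi>T)
      show "continuous_on (\<psi> ` T) (\<lambda>x. v + w' x v *\<^sub>R axis l 1)" for v
        by (intro continuous_intros continuous_on_subset[OF w'cont]) (simp add: \<psi>T)
    qed
    show "\<phi> x = inv_into T \<psi> x" if "x \<in> \<psi> ` T" for x
      using that inj by (auto simp: \<phi>\<psi>)
  qed (use \<open>open (\<psi> ` T)\<close> in auto)
  have diffeo: "C1_diffeo_on \<psi> (chart_image c')"
    unfolding C1_diffeo_on_def c'(2)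
    using \<open>open T\<close> \<open>open (\<psi> ` T)\<close> inj C1\<psi> C1\<phi> by (intro conjI)
  define S where "S = {y :: real^'n. axis l 1 \<bullet> y = 0}"
  have S: "subspace S" "dim S = CARD('n) - 1"
    unfolding S_def by (auto simp: subspace_hyperplane dim_hyperplane axis_eq_0_iff)
  have Nc': "N \<inter> fst c' = N" by (auto simp: N_def c'_def)
  have slice: "\<psi> ` (snd c' ` (N \<inter> fst c')) = S \<inter> \<psi> ` chart_image c'"
  proof -
    have "snd c' ` N = {x \<in> T. x $ l = w x}"
      by (auto simp: N_def c'_def T_def chart_image_def)
    moreover have "\<psi> x \<in> S \<longleftrightarrow> x $ l = w x" for x
      by (simp add: S_def \<psi>_def inner_diff_right inner_axis' )
    ultimately show ?thesis unfolding Nc' c'(2) by auto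
  qed
  have sub: "C1_submanifold M A (CARD('n) - 1) N"
    unfolding C1_submanifold_def
  proof (intro conjI ballI)
    show "N \<subseteq> topspace M" using openin_subset[OF openin_chart[OF c]] by (auto simp: N_def)
    fix p assume "p \<in> N"
    then have "p \<in> fst c'" using Nc' by blast
    then show "\<exists>c\<in>A. p \<in> fst c \<and> (\<exists>\<psi> S. C1_diffeo_on \<psi> (chart_image c) \<and> subspace S \<and> dim S = CARD('n) - 1 \<and>
               \<psi> ` (snd c ` (N \<inter> fst c)) = S \<inter> \<psi> ` chart_image c)"
      using c'(1) diffeo S slice by blast
  qed
  have tan: "submanifold_tangent_space M A N p = \<Delta> p" if p: "p \<in> N" for p
  proof -
    define x where "x = snd c p"
    have pc: "p \<in> fst c" and x: "x \<in> cyl" "x $ l = w x" using p by (auto simp: N_def x_def)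
    have w'x: "w' x u = u $ l - \<eta> x \<bullet> u" for u using w'[OF x(1)] x(2) by simp
    have \<Delta>: "v \<in> \<Delta> p \<longleftrightarrow> v \<in> tangent_space A p \<and> \<eta> x \<bullet> v c = 0" for v
      using ker pc by (auto simp: is_kernel_on_def x_def)
    show ?thesis
    proof (intro set_eqI iffI)
      fix v assume "v \<in> submanifold_tangent_space M A N p"
      then obtain \<gamma> \<epsilon> where v: "v \<in> tangent_space A p" and "0 < \<epsilon>" and \<gamma>: "\<gamma> 0 = p" "\<gamma> ` {-\<epsilon><..<\<epsilon>} \<subseteq> N"
        and d\<gamma>: "((\<lambda>t. snd c (\<gamma> t)) has_vector_derivative v c) (at 0)"
        using c pc unfolding submanifold_tangent_space_def by blast
      have "(w has_derivative w' x) (at (snd c (\<gamma> 0)))" using dw[OF x(1)] \<gamma>(1) by (simp add: x_def)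
      from has_derivative_compose[OF d\<gamma>[unfolded has_vector_derivative_def] this]
      have 1: "((\<lambda>t. w (snd c (\<gamma> t))) has_derivative (\<lambda>h. w' x (h *\<^sub>R v c))) (at 0)" .
      have "((\<lambda>t. snd c (\<gamma> t) $ l) has_derivative (\<lambda>h. (h *\<^sub>R v c) $ l)) (at 0)"
        by (rule bounded_linear.has_derivative[OF bounded_linear_vec_nth d\<gamma>[unfolded has_vector_derivative_def]])
      then have 2: "((\<lambda>t. w (snd c (\<gamma> t))) has_derivative (\<lambda>h. (h *\<^sub>R v c) $ l)) (at 0)"
      proof (rule has_derivative_transform_within_open[of _ _ _ _ "{-\<epsilon><..<\<epsilon>}"])
        fix t assume "t \<in> {-\<epsilon><..<\<epsilon>}"
        then have "\<gamma> t \<in> N" using \<gamma>(2) by blast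
        then show "snd c (\<gamma> t) $ l = w (snd c (\<gamma> t))" by (simp add: N_def)
      qed (use \<open>0 < \<epsilon>\<close> in auto)
      have "w' x (1 *\<^sub>R v c) = (1 *\<^sub>R v c) $ l"
        by (rule fun_cong[OF has_derivative_unique[OF 1 2]])
      then show "v \<in> \<Delta> p" using v by (simp add: w'x \<Delta>)
    next
      fix v assume "v \<in> \<Delta> p"
      then have v: "v \<in> tangent_space A p" "\<eta> x \<bullet> v c = 0" using \<Delta> by auto
      \<comment> \<open>The straight line with velocity \<open>v c\<close>, projected vertically to the graph.\<close>
      define z where "z t = x + t *\<^sub>R v c" for t :: real
      define y where "y t = z t + (w (z t) - z t $ l) *\<^sub>R axis l 1" for t
      have zc: "continuous_on UNIV z" unfolding z_def by (intro continuous_intros)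
      then have "open (z -` cyl)" using \<open>open cyl\<close> by (simp add: continuous_on_open_vimage)
      moreover have "0 \<in> z -` cyl" using x by (simp add: z_def)
      ultimately obtain \<epsilon> where "0 < \<epsilon>" and \<epsilon>: "ball 0 \<epsilon> \<subseteq> z -` cyl" using open_contains_ball by blast
      have zcyl: "z t \<in> cyl" if "t \<in> {-\<epsilon><..<\<epsilon>}" for t using \<epsilon> that by (auto simp: subset_iff dist_real_def)
      show "v \<in> submanifold_tangent_space M A N p"
      proof (rule curve_tangent[OF c pc v(1) \<open>0 < \<epsilon>\<close>, of y])
        show "y 0 = snd c p" using x by (simp add: y_def z_def x_def)
        have "continuous_on {-\<epsilon><..<\<epsilon>} (\<lambda>t. w (z t))"
          by (rule continuous_on_compose2[OF wcont continuous_on_subset[OF zc]]) (use zcyl in auto)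
        then show "continuous_on {-\<epsilon><..<\<epsilon>} y"
          unfolding y_def by (intro continuous_intros continuous_on_subset[OF zc]) auto
        have dz: "(z has_derivative (\<lambda>h. h *\<^sub>R v c)) (at 0)"
          unfolding z_def by (auto intro!: derivative_eq_intros)
        have "(w has_derivative w' x) (at (z 0))" using dw[OF x(1)] by (simp add: z_def)
        from has_derivative_compose[OF dz this]
        have dwz: "((\<lambda>t. w (z t)) has_derivative (\<lambda>h. w' x (h *\<^sub>R v c))) (at 0)" .
        have "(y has_derivative (\<lambda>h. h *\<^sub>R v c + (w' x (h *\<^sub>R v c) - (h *\<^sub>R v c) $ l) *\<^sub>R axis l 1)) (at 0)"
          unfolding y_def
          by (intro has_derivative_add has_derivative_scaleR_left has_derivative_diff dz dwz
              bounded_linear.has_derivative[OF bounded_linear_vec_nth dz])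
        then show "(y has_vector_derivative v c) (at 0)"
          using v(2) by (simp add: has_vector_derivative_def w'x)
        fix t assume t: "t \<in> {-\<epsilon><..<\<epsilon>}"
        have yi: "y t \<in> chart_image c" unfolding y_def by (rule img[OF zcyl[OF t]])
        moreover have "y t \<in> cyl" unfolding y_def cyl_shift by (rule zcyl[OF t])
        moreover have "w (y t) = w (z t)" unfolding y_def by (rule inv)
        then have "y t $ l = w (y t)" by (simp add: y_def)
        ultimately show "y t \<in> chart_image c \<and> chart_inv c (y t) \<in> N"
          by (simp add: N_def chart_inv_mem chart_chart_inv)
      qed
    qed
  qed
  have "p0 \<in> N" using p0 w0 r x0 by (simp add: N_def cyl_def cylinder_def)
  moreover have "integral_manifold M A \<Delta> N"
    unfolding integral_manifold_def using sub tan by blast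
  ultimately show ?thesis by (rule that[rotated])
qed

end

section \<open>Integral manifolds are locally graphs\<close>

lemma subspace_codim1_hyperplane:
  fixes S :: "'a::euclidean_space set"
  assumes "subspace S" "dim S = DIM('a) - 1"
  obtains \<nu> where "\<nu> \<noteq> 0" "S = {x. \<nu> \<bullet> x = 0}"
proof -
  have "dim S < DIM('a)" using assms(2) DIM_positive[where 'a='a] by linarith
  then obtain \<nu> where \<nu>: "\<nu> \<noteq> 0" "span S \<subseteq> {x. \<nu> \<bullet> x = 0}"
    using lowdim_subset_hyperplane by blast
  have "S = {x. \<nu> \<bullet> x = 0}"
  proof (rule subspace_dim_equal[OF assms(1) subspace_hyperplane])
    show "S \<subseteq> {x. \<nu> \<bullet> x = 0}" using \<nu>(2) span_superset by blast
    show "dim {x. \<nu> \<bullet> x = 0} \<le> dim S" using assms(2) dim_hyperplane[OF \<nu>(1)] by simp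
  qed
  with \<nu>(1) show ?thesis by (rule that)
qed

context manifold
begin

text \<open>A slice chart describes \<open>N\<close> as the zero set of a function \<open>f\<close>: the linear functional vanishing on the slice,
  composed with the slice chart. The last conclusion is where tangency to \<open>\<Delta>\<close> enters. A vector in the
  kernel of \<open>f'\<close> is the velocity of a curve in \<open>N\<close>, namely of the preimage of a straight line in the slice, and
  therefore lies in \<open>\<Delta>\<close>.\<close>

lemma integral_manifold_defining_function:
  assumes c: "c \<in> A" and N: "integral_manifold M A \<Delta> N" and p: "p \<in> N" "p \<in> fst c"
    and ker: "is_kernel_on A c \<eta> \<Delta>"
  obtains Q f f' where "open Q" "snd c p \<in> Q" "Q \<subseteq> chart_image c"
    "\<And>x. x \<in> Q \<Longrightarrow> (f has_derivative f' x) (at x)" "\<And>v. continuous_on Q (\<lambda>x. f' x v)"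
    "\<And>q. q \<in> fst c \<Longrightarrow> snd c q \<in> Q \<Longrightarrow> q \<in> N \<longleftrightarrow> f (snd c q) = (0::real)"
    "\<And>q u. q \<in> N \<Longrightarrow> q \<in> fst c \<Longrightarrow> snd c q \<in> Q \<Longrightarrow> f' (snd c q) u = 0 \<Longrightarrow> \<eta> (snd c q) \<bullet> u = 0"
proof -
  obtain d \<psi> S where d: "d \<in> A" "p \<in> fst d" and \<psi>: "C1_diffeo_on \<psi> (chart_image d)"
    and S: "subspace S" "dim S = CARD('n) - 1" and slice: "\<psi> ` (snd d ` (N \<inter> fst d)) = S \<inter> \<psi> ` chart_image d"
    using N p(1) unfolding integral_manifold_def C1_submanifold_def by blast
  obtain \<nu> where \<nu>: "\<nu> \<noteq> 0" "S = {x. \<nu> \<bullet> x = 0}"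
    by (rule subspace_codim1_hyperplane[OF S(1)]) (use S(2) in simp)
  define D where "D = chart_image d"
  have inj: "inj_on \<psi> D" and op: "open (\<psi> ` D)" and C1: "Ck_on 1 \<psi> D" and C1': "Ck_on 1 (inv_into D \<psi>) (\<psi> ` D)"
    using \<psi> by (auto simp: C1_diffeo_on_def D_def)
  define D\<psi> where "D\<psi> x = Blinfun (frechet_derivative \<psi> (at x))" for x
  have D\<psi>: "(\<psi> has_derivative blinfun_apply (D\<psi> x)) (at x)" if "x \<in> D" for x
    using Ck_on_1_blinfun(2)[OF C1 that] by (simp add: D\<psi>_def)
  have D\<psi>c: "continuous_on D D\<psi>" using Ck_on_1_blinfun(3)[OF C1] by (simp add: D\<psi>_def[abs_def])
  define Q where "Q = overlap c d"
  have Q: "q \<in> fst c \<Longrightarrow> snd c q \<in> Q \<Longrightarrow> q \<in> fst d" for q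
    unfolding Q_def overlap_def using inj_onD[OF chart_inj[OF c]] by blast
  have TD: "transition c d x \<in> D" if "x \<in> Q" for x
    using that by (auto simp: Q_def overlap_def D_def transition_chart[OF c] chart_mem)
  have memN: "q \<in> N \<longleftrightarrow> \<nu> \<bullet> \<psi> (snd d q) = 0" if q: "q \<in> fst d" for q
  proof
    assume "q \<in> N"
    then have "\<psi> (snd d q) \<in> S" using slice q by blast
    then show "\<nu> \<bullet> \<psi> (snd d q) = 0" by (simp add: \<nu>)
  next
    assume "\<nu> \<bullet> \<psi> (snd d q) = 0"
    then have "\<psi> (snd d q) \<in> S \<inter> \<psi> ` chart_image d" using chart_mem[OF q] by (simp add: \<nu>)
    then obtain q' where q': "q' \<in> N" "q' \<in> fst d" "\<psi> (snd d q) = \<psi> (snd d q')" unfolding slice[symmetric] by blast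
    then have "snd d q = snd d q'" using inj_onD[OF inj] chart_mem q unfolding D_def by metis
    then show "q \<in> N" using inj_onD[OF chart_inj[OF d(1)]] q' q by metis
  qed
  define f where "f x = \<nu> \<bullet> \<psi> (transition c d x)" for x
  define f' where "f' x u = \<nu> \<bullet> D\<psi> (transition c d x) (DT c d x u)" for x u
  show ?thesis
  proof (rule that[of Q f f'])
    show "open Q" unfolding Q_def by (rule open_overlap[OF c d(1)])
    show "snd c p \<in> Q" using p d by (auto simp: Q_def overlap_def)
    show "Q \<subseteq> chart_image c" by (auto simp: Q_def overlap_def chart_image_def)
    show "(f has_derivative f' x) (at x)" if x: "x \<in> Q" for x
      unfolding f_def[abs_def] f'_def[abs_def]
      by (rule has_derivative_inner_right, rule has_derivative_compose[OF DT[OF c d(1)] D\<psi>[OF TD[OF x]]])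
         (use x in \<open>simp add: Q_def\<close>)
    show "continuous_on Q (\<lambda>x. f' x v)" for v
    proof -
      have 1: "continuous_on Q (\<lambda>x. DT c d x v)" using transition_C1[OF c d(1)] by (simp add: Q_def)
      have "continuous_on Q (transition c d)"
        by (intro continuous_at_imp_continuous_on ballI has_derivative_continuous[OF DT[OF c d(1)]]) (simp add: Q_def)
      then have 2: "continuous_on Q (\<lambda>x. D\<psi> (transition c d x))"
        by (rule continuous_on_compose2[OF D\<psi>c]) (use TD in blast)
      show ?thesis unfolding f'_def by (intro continuous_intros 1 2)
    qed
    show "q \<in> N \<longleftrightarrow> f (snd c q) = 0" if "q \<in> fst c" "snd c q \<in> Q" for q
      using memN[OF Q[OF that]] by (simp add: f_def transition_chart[OF c that(1)])
    fix q u assume q: "q \<in> N" "q \<in> fst c" "snd c q \<in> Q" and u: "f' (snd c q) u = 0"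
    note qd = Q[OF q(2,3)]
    define x where "x = snd d q"
    have xD: "x \<in> D" using chart_mem[OF qd] by (simp add: x_def D_def)
    define v where "v = coord_vec A c q u"
    have v: "v \<in> tangent_space A q" "v c = u" using coord_vec_tangent[OF c q(2)] by (simp_all add: v_def)
    have vd: "v d = DT c d (snd c q) u" using d qd by (simp add: v_def coord_vec_def)
    define a where "a = D\<psi> x (v d)"
    have a: "\<nu> \<bullet> a = 0" using u by (simp add: a_def f'_def vd x_def transition_chart[OF c q(2)])
    define z where "z t = \<psi> x + t *\<^sub>R a" for t :: real
    define y where "y t = inv_into D \<psi> (z t)" for t
    have zc: "continuous_on UNIV z" unfolding z_def by (intro continuous_intros)
    then have "open (z -` (\<psi> ` D))" using op by (simp add: continuous_on_open_vimage)
    moreover have "0 \<in> z -` (\<psi> ` D)" using xD by (simp add: z_def)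
    ultimately obtain \<epsilon> where "0 < \<epsilon>" and \<epsilon>: "ball 0 \<epsilon> \<subseteq> z -` (\<psi> ` D)" using open_contains_ball by blast
    have zD: "z t \<in> \<psi> ` D" if "t \<in> {-\<epsilon><..<\<epsilon>}" for t using \<epsilon> that by (auto simp: subset_iff dist_real_def)
    have z0: "z 0 = \<psi> x" by (simp add: z_def)
    define I' where "I' = frechet_derivative (inv_into D \<psi>) (at (\<psi> x))"
    have dI: "(inv_into D \<psi> has_derivative I') (at (\<psi> x))"
      using C1' xD frechet_derivative_works unfolding I'_def by auto
    have Ic: "continuous_on (\<psi> ` D) (inv_into D \<psi>)"
      by (intro continuous_at_imp_continuous_on ballI has_derivative_continuous[OF Ck_on_1_blinfun(2)[OF C1']])
    have "open D" using open_image[OF d(1)] by (simp add: D_def)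
    have "((\<lambda>x. inv_into D \<psi> (\<psi> x)) has_derivative (\<lambda>h. I' (D\<psi> x h))) (at x)"
      by (rule has_derivative_compose[OF D\<psi>[OF xD] dI])
    then have "((\<lambda>x. x) has_derivative (\<lambda>h. I' (D\<psi> x h))) (at x)"
      by (rule has_derivative_transform_within_open[OF _ \<open>open D\<close> xD]) (simp add: inj)
    from fun_cong[OF has_derivative_unique[OF this has_derivative_ident]]
    have I'D: "I' (D\<psi> x h) = h" for h .
    have "v \<in> submanifold_tangent_space M A N q"
    proof (rule curve_tangent[OF d(1) qd v(1) \<open>0 < \<epsilon>\<close>, of y])
      show "y 0 = snd d q" using inj xD by (simp add: y_def z0 x_def)
      show "continuous_on {-\<epsilon><..<\<epsilon>} y"
        unfolding y_def by (rule continuous_on_compose2[OF Ic continuous_on_subset[OF zc]]) (use zD in auto)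
      have "(z has_derivative (\<lambda>h. h *\<^sub>R a)) (at 0)" unfolding z_def by (auto intro!: derivative_eq_intros)
      from has_derivative_compose[OF this, of "inv_into D \<psi>" I'] dI
      have "(y has_derivative (\<lambda>h. I' (h *\<^sub>R a))) (at 0)" by (simp add: z0 y_def[abs_def])
      moreover have "I' (h *\<^sub>R a) = h *\<^sub>R v d" for h
        using linear_cmul[OF has_derivative_linear[OF dI], of h a] I'D[of "v d"] by (simp add: a_def)
      ultimately show "(y has_vector_derivative v d) (at 0)" by (simp add: has_vector_derivative_def)
      fix t assume t: "t \<in> {-\<epsilon><..<\<epsilon>}"
      have yD: "y t \<in> D" unfolding y_def by (rule inv_into_into[OF zD[OF t]])
      have "\<psi> (y t) = z t" unfolding y_def by (rule f_inv_into_f[OF zD[OF t]])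
      moreover have "\<nu> \<bullet> z t = 0" using memN[OF qd] q(1) a by (simp add: z_def inner_add_right x_def)
      ultimately show "y t \<in> chart_image d \<and> chart_inv d (y t) \<in> N"
        using yD memN[OF chart_inv_mem[of "y t" d]] by (simp add: D_def chart_chart_inv)
    qed
    then have "v \<in> \<Delta> q" using N q(1) by (simp add: integral_manifold_def)
    then show "\<eta> (snd c q) \<bullet> u = 0" using ker q(2) v(2) by (auto simp: is_kernel_on_def)
  qed
qed

text \<open>Since \<open>\<eta>(\<partial>/\<partial>x\<^sup>l) = 1\<close>, the vertical direction is not in \<open>\<Delta>\<close>, so the derivative of the defining function \<open>f\<close> in this
  direction does not vanish. The inverse function theorem thus applies to the map that replaces the last
  coordinate by \<open>f\<close>. Its local inverse \<open>g\<close>, restricted to the hyperplane where the last coordinate vanishes,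
  parametrises \<open>N\<close>. The coordinate lines in \<open>N\<close> have the velocities \<open>\<partial>/\<partial>x\<^sup>i - \<eta>\<^sub>i \<partial>/\<partial>x\<^sup>l\<close>, the only vectors in the
  kernel of \<open>\<eta>\<close> with this projection.\<close>

lemma integral_manifold_local_graph:
  fixes l :: 'n
  assumes c: "c \<in> A" and N: "integral_manifold M A \<Delta> N" and p: "p \<in> N" "p \<in> fst c"
    and ker: "is_kernel_on A c \<eta> \<Delta>" and norml: "\<And>x. x \<in> chart_image c \<Longrightarrow> \<eta> x $ l = 1"
  obtains U V g where "open U" "snd c p \<in> U" "U \<subseteq> chart_image c" "open V"
    "snd c p - (snd c p $ l) *\<^sub>R axis l 1 \<in> V" "continuous_on V g" "g ` V \<subseteq> U"
    "g (snd c p - (snd c p $ l) *\<^sub>R axis l 1) = snd c p"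
    "\<And>q. q \<in> fst c \<Longrightarrow> snd c q \<in> U \<Longrightarrow> q \<in> N \<longleftrightarrow>
       snd c q - (snd c q $ l) *\<^sub>R axis l 1 \<in> V \<and> g (snd c q - (snd c q $ l) *\<^sub>R axis l 1) = snd c q"
    "\<And>y i. y \<in> V \<Longrightarrow> y $ l = 0 \<Longrightarrow> i \<noteq> l \<Longrightarrow>
       ((\<lambda>h. g (y + h *\<^sub>R axis i 1)) has_vector_derivative axis i 1 - (\<eta> (g y) $ i) *\<^sub>R axis l 1) (at 0)"
proof -
  define e :: "real^'n" where "e = axis l 1"
  have el: "e $ l = 1" by (simp add: e_def)
  define x0 where "x0 = snd c p"
  obtain Q f f' where Q: "open Q" "x0 \<in> Q" "Q \<subseteq> chart_image c"
    and df: "\<And>x. x \<in> Q \<Longrightarrow> (f has_derivative f' x) (at x)" and cf: "\<And>v. continuous_on Q (\<lambda>x. f' x v)"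
    and memN: "\<And>q. q \<in> fst c \<Longrightarrow> snd c q \<in> Q \<Longrightarrow> q \<in> N \<longleftrightarrow> f (snd c q) = (0::real)"
    and kerN: "\<And>q u. q \<in> N \<Longrightarrow> q \<in> fst c \<Longrightarrow> snd c q \<in> Q \<Longrightarrow> f' (snd c q) u = 0 \<Longrightarrow> \<eta> (snd c q) \<bullet> u = 0"
    unfolding x0_def by (rule integral_manifold_defining_function[OF c N p ker]) blast
  have kerx: "\<eta> x \<bullet> u = 0" if "x \<in> Q" "f x = 0" "f' x u = 0" for x u
  proof -
    have x: "x \<in> chart_image c" using that Q by blast
    show ?thesis
      using kerN[of "chart_inv c x" u] memN[of "chart_inv c x"] that chart_inv_mem[OF x] chart_chart_inv[OF x] by simp
  qed
  have fx0: "f x0 = 0" using memN[OF p(2)] p(1) Q(2) by (simp add: x0_def)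
  have fe: "f' x0 e \<noteq> 0"
  proof
    assume "f' x0 e = 0"
    from kerx[OF Q(2) fx0 this] have "\<eta> x0 $ l = 0" by (simp add: e_def inner_axis)
    then show False using norml[of x0] Q by auto
  qed
  define \<Psi> where "\<Psi> x = x + (f x - x $ l) *\<^sub>R e" for x
  define \<Psi>' where "\<Psi>' x = Blinfun (\<lambda>u. u + (f' x u - u $ l) *\<^sub>R e)" for x
  have d\<Psi>0: "(\<Psi> has_derivative (\<lambda>u. u + (f' x u - u $ l) *\<^sub>R e)) (at x)" if "x \<in> Q" for x
    unfolding \<Psi>_def
    by (intro has_derivative_add has_derivative_ident has_derivative_scaleR_left has_derivative_diff df[OF that]
        bounded_linear_imp_has_derivative bounded_linear_vec_nth)
  have \<Psi>'_apply: "\<Psi>' x u = u + (f' x u - u $ l) *\<^sub>R e" if "x \<in> Q" for x u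
    unfolding \<Psi>'_def by (subst bounded_linear_Blinfun_apply[OF has_derivative_bounded_linear[OF d\<Psi>0[OF that]]]) simp
  have d\<Psi>: "(\<Psi> has_derivative blinfun_apply (\<Psi>' x)) (at x)" if "x \<in> Q" for x
    using d\<Psi>0[OF that] by (simp add: \<Psi>'_apply[OF that, abs_def])
  have c\<Psi>: "continuous_on Q \<Psi>'"
  proof (rule continuous_on_blinfun_componentwise)
    fix v :: "real^'n"
    have "continuous_on Q (\<lambda>x. v + (f' x v - v $ l) *\<^sub>R e)" by (intro continuous_intros cf)
    then show "continuous_on Q (\<lambda>x. \<Psi>' x v)" by (rule continuous_on_eq) (simp add: \<Psi>'_apply)
  qed
  have "inj (\<Psi>' x0)"
  proof (rule linear_injective_0[THEN iffD2, OF bounded_linear.linear[OF blinfun.bounded_linear_right]], intro allI impI)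
    fix u assume "\<Psi>' x0 u = 0"
    then have u: "u + (f' x0 u - u $ l) *\<^sub>R e = 0" by (simp add: \<Psi>'_apply[OF Q(2)])
    have "(u + (f' x0 u - u $ l) *\<^sub>R e) $ l = 0" unfolding u by simp
    then have f0: "f' x0 u = 0" by (simp add: el)
    with u have ue: "u = (u $ l) *\<^sub>R e" by (simp add: scaleR_left.minus)
    have "f' x0 ((u $ l) *\<^sub>R e) = (u $ l) * f' x0 e"
      using linear_cmul[OF has_derivative_linear[OF df[OF Q(2)]], of "u $ l" e] by simp
    then have "u $ l = 0" using f0 ue fe by simp
    then show "u = 0" using ue by simp
  qed
  then obtain h where h: "linear h" "h \<circ> \<Psi>' x0 = id"
    using linear_injective_left_inverse[OF bounded_linear.linear[OF blinfun.bounded_linear_right]] by blast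
  have "bounded_linear h" using h(1) linear_conv_bounded_linear by blast
  then have invf: "Blinfun h o\<^sub>L \<Psi>' x0 = id_blinfun"
    using h(2) by (intro blinfun_eqI) (simp add: bounded_linear_Blinfun_apply fun_eq_iff)
  obtain U V g g' where UV: "open U" "U \<subseteq> Q" "x0 \<in> U" "open V" "\<Psi> x0 \<in> V" "homeomorphism U V \<Psi> g"
    and dg: "\<And>y. y \<in> V \<Longrightarrow> (g has_derivative (g' y)) (at y)"
    and g': "\<And>y. y \<in> V \<Longrightarrow> g' y = inv (blinfun_apply (\<Psi>' (g y)))"
    and bij: "\<And>y. y \<in> V \<Longrightarrow> bij (blinfun_apply (\<Psi>' (g y)))"
    by (rule inverse_function_theorem[OF Q(1) d\<Psi> c\<Psi> Q(2) invf]) blast+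
  have gU: "g y \<in> U" if "y \<in> V" for y using UV(6) that unfolding homeomorphism_def by blast
  have g\<Psi>: "g (\<Psi> x) = x" if "x \<in> U" for x using UV(6) that unfolding homeomorphism_def by blast
  have \<Psi>g: "\<Psi> (g y) = y" if "y \<in> V" for y using UV(6) that unfolding homeomorphism_def by blast
  have \<Psi>V: "\<Psi> x \<in> V" if "x \<in> U" for x using UV(6) that unfolding homeomorphism_def by blast
  have \<Psi>l: "\<Psi> x $ l = f x" for x by (simp add: \<Psi>_def el)
  have zero: "f x = 0 \<longleftrightarrow> x - (x $ l) *\<^sub>R e \<in> V \<and> g (x - (x $ l) *\<^sub>R e) = x" if x: "x \<in> U" for x
  proof
    assume "f x = 0"
    then have "x - (x $ l) *\<^sub>R e = \<Psi> x" by (simp add: \<Psi>_def scaleR_left.minus)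
    then show "x - (x $ l) *\<^sub>R e \<in> V \<and> g (x - (x $ l) *\<^sub>R e) = x" using \<Psi>V[OF x] g\<Psi>[OF x] by simp
  next
    assume a: "x - (x $ l) *\<^sub>R e \<in> V \<and> g (x - (x $ l) *\<^sub>R e) = x"
    then have "\<Psi> x = x - (x $ l) *\<^sub>R e" using \<Psi>g[of "x - (x $ l) *\<^sub>R e"] by simp
    then have "\<Psi> x $ l = 0" by (simp add: el)
    then show "f x = 0" by (simp add: \<Psi>l)
  qed
  show ?thesis
  proof (rule that[of U V g, folded x0_def e_def])
    show "open U" "x0 \<in> U" "U \<subseteq> chart_image c" "open V" using UV Q by auto
    show "x0 - (x0 $ l) *\<^sub>R e \<in> V" "g (x0 - (x0 $ l) *\<^sub>R e) = x0" using zero[OF UV(3)] fx0 by auto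
    show "continuous_on V g" using UV(6) by (simp add: homeomorphism_def)
    show "g ` V \<subseteq> U" using gU by blast
    show "q \<in> N \<longleftrightarrow> snd c q - (snd c q $ l) *\<^sub>R e \<in> V \<and> g (snd c q - (snd c q $ l) *\<^sub>R e) = snd c q"
      if "q \<in> fst c" "snd c q \<in> U" for q
      using memN[OF that(1)] zero[OF that(2)] that(2) UV(2) by blast
    fix y i assume y: "y \<in> V" "y $ l = 0" and i: "i \<noteq> l"
    define u where "u = g' y (axis i 1)"
    have gQ: "g y \<in> Q" using gU[OF y(1)] UV(2) by blast
    have f0: "f (g y) = 0" using \<Psi>l[of "g y"] \<Psi>g[OF y(1)] y(2) by simp
    have "\<Psi>' (g y) u = axis i 1"
      unfolding u_def g'[OF y(1)] by (rule surj_f_inv_f[OF bij_is_surj[OF bij[OF y(1)]]])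
    then have u: "u + (f' (g y) u - u $ l) *\<^sub>R e = axis i 1" by (simp add: \<Psi>'_apply[OF gQ])
    have "(u + (f' (g y) u - u $ l) *\<^sub>R e) $ l = 0" unfolding u using i by (simp add: axis_def)
    then have "f' (g y) u = 0" by (simp add: el)
    then have \<eta>u: "\<eta> (g y) \<bullet> u = 0" and ui: "u = axis i 1 + (u $ l) *\<^sub>R e"
      using kerx[OF gQ f0] u by (auto simp: algebra_simps)
    have "\<eta> (g y) \<bullet> u = \<eta> (g y) $ i + u $ l * \<eta> (g y) $ l"
      by (subst ui) (simp add: inner_add_right inner_axis e_def)
    then have "u $ l = - (\<eta> (g y) $ i)" using \<eta>u norml[of "g y"] gQ Q(3) by auto
    then have u_eq: "u = axis i 1 - (\<eta> (g y) $ i) *\<^sub>R e" using ui by simp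
    have "((\<lambda>h. y + h *\<^sub>R axis i 1) has_derivative (\<lambda>h::real. h *\<^sub>R (axis i 1 :: real^'n))) (at 0)"
      by (auto intro!: derivative_eq_intros)
    moreover have "(g has_derivative g' y) (at (y + 0 *\<^sub>R axis i 1))" using dg[OF y(1)] by simp
    ultimately have "((\<lambda>h. g (y + h *\<^sub>R axis i 1)) has_derivative (\<lambda>h. g' y (h *\<^sub>R axis i 1))) (at 0)"
      by (rule has_derivative_compose)
    moreover have "g' y (h *\<^sub>R axis i 1) = h *\<^sub>R u" for h
      using linear_cmul[OF has_derivative_linear[OF dg[OF y(1)]], of h "axis i 1"] by (simp add: u_def)
    ultimately show "((\<lambda>h. g (y + h *\<^sub>R axis i 1)) has_vector_derivative axis i 1 - (\<eta> (g y) $ i) *\<^sub>R e) (at 0)"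
      by (simp add: has_vector_derivative_def u_eq)
  qed
qed

end

section \<open>Integrability and unique integrability\<close>

text \<open>Two graphs through \<open>x0\<close> agree first along the coordinate line in the direction \<open>i\<close>, since there both are the limit
  of the same flow lines, and then along the lines in the direction \<open>j\<close> that start on it.\<close>

lemma (in approximating_flows) integral_graphs_agree:
  fixes g1 g2 :: "real^'n \<Rightarrow> real^'n" and y0 :: "real^'n"
  assumes limit: approximation_limit
    and ij: "UNIV = {i, j, l}" "i \<noteq> l" "j \<noteq> l" and x0: "x0 \<in> V" and y0: "y0 $ l = 0"
    and V1: "open V1" "y0 \<in> V1" "continuous_on V1 g1" "g1 y0 = x0"
    and d1: "\<And>y i. y \<in> V1 \<Longrightarrow> y $ l = 0 \<Longrightarrow> i \<noteq> l \<Longrightarrow>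
       ((\<lambda>h. g1 (y + h *\<^sub>R axis i 1)) has_vector_derivative limit_frame i (g1 y)) (at 0)"
    and V2: "open V2" "y0 \<in> V2" "continuous_on V2 g2" "g2 y0 = x0"
    and d2: "\<And>y i. y \<in> V2 \<Longrightarrow> y $ l = 0 \<Longrightarrow> i \<noteq> l \<Longrightarrow>
       ((\<lambda>h. g2 (y + h *\<^sub>R axis i 1)) has_vector_derivative limit_frame i (g2 y)) (at 0)"
  obtains r where "0 < r" "\<And>y. (\<And>m. m \<noteq> l \<Longrightarrow> \<bar>y $ m - y0 $ m\<bar> < r) \<Longrightarrow> y $ l = 0 \<Longrightarrow>
      y \<in> V1 \<and> y \<in> V2 \<and> g1 y = g2 y"
proof -
  obtain \<rho> where \<rho>: "0 < \<rho>" "cball x0 \<rho> \<subseteq> V" using open_V x0 open_contains_cball by blast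
  have near: "\<exists>\<delta>>0. ball y0 \<delta> \<subseteq> V' \<and> g ` ball y0 \<delta> \<subseteq> cball x0 \<rho>"
    if V': "open V'" "y0 \<in> V'" "continuous_on V' g" "g y0 = x0" for V' and g :: "real^'n \<Rightarrow> real^'n"
  proof -
    have "open (V' \<inter> g -` ball x0 \<rho>)" using V' by (intro continuous_open_preimage) auto
    moreover have "y0 \<in> V' \<inter> g -` ball x0 \<rho>" using V' \<rho> by simp
    ultimately obtain \<delta> where \<delta>: "\<delta> > 0" "ball y0 \<delta> \<subseteq> V' \<inter> g -` ball x0 \<rho>" using open_contains_ball by blast
    have "g ` ball y0 \<delta> \<subseteq> cball x0 \<rho>" using \<delta>(2) ball_subset_cball[of x0 \<rho>] by blast
    then show ?thesis using \<delta> by blast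
  qed
  obtain \<delta>1 where \<delta>1: "\<delta>1 > 0" "ball y0 \<delta>1 \<subseteq> V1" "g1 ` ball y0 \<delta>1 \<subseteq> cball x0 \<rho>" using near[OF V1] by blast
  obtain \<delta>2 where \<delta>2: "\<delta>2 > 0" "ball y0 \<delta>2 \<subseteq> V2" "g2 ` ball y0 \<delta>2 \<subseteq> cball x0 \<rho>" using near[OF V2] by blast
  define B where "B = ball y0 (min \<delta>1 \<delta>2)"
  have B1: "y \<in> V1" "g1 y \<in> cball x0 \<rho>" and B2: "y \<in> V2" "g2 y \<in> cball x0 \<rho>" if "y \<in> B" for y
  proof -
    have "y \<in> ball y0 \<delta>1" "y \<in> ball y0 \<delta>2" using that by (auto simp: B_def)
    then show "y \<in> V1" "g1 y \<in> cball x0 \<rho>" "y \<in> V2" "g2 y \<in> cball x0 \<rho>" using \<delta>1 \<delta>2 by blast+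
  qed
  have flow_limit: "(\<lambda>k. F k m t (g y)) \<longlonglongrightarrow> g (y + t *\<^sub>R axis m 1)"
    if m: "m \<noteq> l" and t: "t \<in> {-t0..t0}" and yl: "y $ l = 0"
      and seg: "\<And>\<tau>. \<tau> \<in> closed_segment 0 t \<Longrightarrow> y + \<tau> *\<^sub>R axis m 1 \<in> B"
      and gB: "\<And>y. y \<in> B \<Longrightarrow> g y \<in> cball x0 \<rho>"
      and dg: "\<And>y. y \<in> B \<Longrightarrow> y $ l = 0 \<Longrightarrow>
         ((\<lambda>h. g (y + h *\<^sub>R axis m 1)) has_vector_derivative limit_frame m (g y)) (at 0)"
    for m t y and g :: "real^'n \<Rightarrow> real^'n"
  proof -
    have "(\<lambda>k. F k m t (g (y + 0 *\<^sub>R axis m 1))) \<longlonglongrightarrow> g (y + t *\<^sub>R axis m 1)"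
    proof (rule curve_limit[OF limit m t compact_cball \<rho>(2), where \<gamma>="\<lambda>\<tau>. g (y + \<tau> *\<^sub>R axis m 1)"])
      fix s assume s: "s \<in> closed_segment 0 t"
      show "g (y + s *\<^sub>R axis m 1) \<in> cball x0 \<rho>" by (rule gB[OF seg[OF s]])
      have "(y + s *\<^sub>R axis m 1) $ l = 0" using yl m by (simp add: axis_def)
      from dg[OF seg[OF s] this]
      have "((\<lambda>h. g (y + s *\<^sub>R axis m 1 + h *\<^sub>R axis m 1)) has_vector_derivative
          limit_frame m (g (y + s *\<^sub>R axis m 1))) (at (-s + 1 * s) within UNIV)" by simp
      from has_vector_derivative_affine[OF this, of "closed_segment 0 t"]
      show "((\<lambda>\<tau>. g (y + \<tau> *\<^sub>R axis m 1)) has_vector_derivative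
          limit_frame m (g (y + s *\<^sub>R axis m 1))) (at s within closed_segment 0 t)"
        by (simp add: add.assoc scaleR_add_left[symmetric])
    qed
    then show ?thesis by simp
  qed
  have step: "g1 (y + t *\<^sub>R axis m 1) = g2 (y + t *\<^sub>R axis m 1)"
    if m: "m \<noteq> l" and t: "t \<in> {-t0..t0}" and yl: "y $ l = 0"
      and seg: "\<And>\<tau>. \<tau> \<in> closed_segment 0 t \<Longrightarrow> y + \<tau> *\<^sub>R axis m 1 \<in> B" and eq: "g1 y = g2 y" for m t y
  proof (rule LIMSEQ_unique)
    show "(\<lambda>k. F k m t (g1 y)) \<longlonglongrightarrow> g1 (y + t *\<^sub>R axis m 1)"
      by (rule flow_limit[OF m t yl seg B1(2) d1[OF B1(1) _ m]])
    show "(\<lambda>k. F k m t (g1 y)) \<longlonglongrightarrow> g2 (y + t *\<^sub>R axis m 1)"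
      unfolding eq by (rule flow_limit[OF m t yl seg B2(2) d2[OF B2(1) _ m]])
  qed
  define r where "r = min t0 (min \<delta>1 \<delta>2 / 2)"
  have r: "0 < r" using t0 \<delta>1 \<delta>2 by (simp add: r_def)
  have inB: "y0 + s *\<^sub>R axis i 1 + t *\<^sub>R axis j 1 \<in> B" if "\<bar>s\<bar> < r" "\<bar>t\<bar> < r" for s t
  proof -
    have "norm (s *\<^sub>R (axis i 1 :: real^'n) + t *\<^sub>R axis j 1) \<le> \<bar>s\<bar> + \<bar>t\<bar>"
      using norm_triangle_ineq[of "s *\<^sub>R (axis i 1 :: real^'n)" "t *\<^sub>R axis j 1"] by (simp add: norm_axis_1)
    also have "\<dots> < min \<delta>1 \<delta>2" using that by (simp add: r_def)
    finally have "norm (s *\<^sub>R (axis i 1 :: real^'n) + t *\<^sub>R axis j 1) < min \<delta>1 \<delta>2" .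
    moreover have "dist (y0 + s *\<^sub>R axis i 1 + t *\<^sub>R axis j 1) y0 = norm (s *\<^sub>R (axis i 1 :: real^'n) + t *\<^sub>R axis j 1)"
      by (simp add: dist_norm add.assoc)
    ultimately show ?thesis by (simp add: B_def dist_commute)
  qed
  have shrink: "\<bar>\<tau>\<bar> < r" if "\<tau> \<in> closed_segment 0 t" "\<bar>t\<bar> < r" for \<tau> t
    using segment_bound(1)[OF that(1)] that(2) by simp
  show ?thesis
  proof (rule that[OF r])
    fix y :: "real^'n" assume y: "\<And>m. m \<noteq> l \<Longrightarrow> \<bar>y $ m - y0 $ m\<bar> < r" and yl: "y $ l = 0"
    define s where "s = y $ i - y0 $ i"
    define t where "t = (if i = j then 0 else y $ j - y0 $ j)"
    have st: "\<bar>s\<bar> < r" "\<bar>t\<bar> < r" using y[OF ij(2)] y[OF ij(3)] r by (auto simp: s_def t_def)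
    have st0: "s \<in> {-t0..t0}" "t \<in> {-t0..t0}" using st by (auto simp: r_def)
    have y_eq: "y = y0 + s *\<^sub>R axis i 1 + t *\<^sub>R axis j 1"
      unfolding vec_eq_iff
    proof
      fix m
      have "m = i \<or> m = j \<or> m = l" using ij(1) by blast
      then show "y $ m = (y0 + s *\<^sub>R axis i 1 + t *\<^sub>R axis j 1) $ m"
        using ij(2,3) yl y0 by (auto simp: axis_def s_def t_def)
    qed
    have "g1 (y0 + s *\<^sub>R axis i 1) = g2 (y0 + s *\<^sub>R axis i 1)"
      by (rule step[OF ij(2) st0(1) y0]) (use inB[OF shrink[OF _ st(1)], of _ 0] r V1(4) V2(4) in auto)
    then have "g1 y = g2 y"
      unfolding y_eq by (intro step[OF ij(3) st0(2)])
        (use y0 ij(2) inB[OF st(1) shrink[OF _ st(2)]] in \<open>auto simp: axis_def\<close>)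
    moreover have "y \<in> B" unfolding y_eq by (rule inB[OF st])
    ultimately show "y \<in> V1 \<and> y \<in> V2 \<and> g1 y = g2 y" using B1 B2 by blast
  qed
qed

lemma (in manifold) approximating_flows_of_data:
  assumes g: "riemannian_metric A g" and data: "approximation_data A g l \<Delta> x0 c \<eta> \<eta>s V t0 F"
  shows "approximating_flows (metric_coord A g c) (chart_image c) V l \<eta> \<eta>s t0 F"
proof -
  have c: "c \<in> A" using data by (simp add: approximation_data_def)
  show ?thesis
  proof (intro approximating_flows.intro coordinate_metric.intro approximating_flows_axioms.intro)
    show "bilinear (metric_coord A g c x)" if "x \<in> chart_image c" for x
      using g c that unfolding riemannian_metric_def by blast
    show "0 < metric_coord A g c x u u" if "x \<in> chart_image c" "u \<noteq> 0" for x u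
      using g c that unfolding riemannian_metric_def by blast
    show "continuous_on (chart_image c) (\<lambda>x. metric_coord A g c x u v)" for u v
    proof -
      have "smooth_on (\<lambda>x. metric_coord A g c x u v) (chart_image c)"
        using g c unfolding riemannian_metric_def by blast
      then have "Ck_on 0 (\<lambda>x. metric_coord A g c x u v) (chart_image c)" unfolding smooth_on_def by blast
      then show ?thesis by simp
    qed
    show "open (chart_image c)" by (rule open_image[OF c])
  qed (use data in \<open>simp_all add: approximation_data_def local_defining_form_def\<close>)
qed

text \<open>In dimension 2 the indices \<open>i\<close> and \<open>j\<close> are equal.\<close>

lemma card_2_or_3_indices:
  fixes l :: "'n::finite"
  assumes "CARD('n) = 2 \<or> CARD('n) = 3"
  obtains i j where "UNIV = {i, j, l}" "i \<noteq> l" "j \<noteq> l"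
  using assms
proof
  assume "CARD('n) = 2"
  then obtain a b :: 'n where "UNIV = {a, b}" "a \<noteq> b" by (auto simp: card_2_iff)
  then show ?thesis using that[of a a] that[of b b] by (cases "l = a") auto
next
  assume "CARD('n) = 3"
  then obtain a b c :: 'n where "UNIV = {a, b, c}" "a \<noteq> b" "b \<noteq> c" "a \<noteq> c" by (auto simp: card_3_iff)
  moreover from this have "l = a \<or> l = b \<or> l = c" by blast
  ultimately show ?thesis using that[of b c] that[of a c] that[of a b] by (auto simp: insert_commute)
qed

lemma (in manifold) asymp_involutive_imp_integrable:
  fixes l :: 'n
  assumes card: "CARD('n) = 2 \<or> CARD('n) = 3" and g: "riemannian_metric A g"
    and asymp: "asymp_involutive_on_average M A g l \<Delta>"
  shows "integrable_distribution M A \<Delta>"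
  unfolding integrable_distribution_def
proof
  fix p assume "p \<in> topspace M"
  then obtain c \<eta> \<eta>s V t0 F where data: "approximation_data A g l \<Delta> p c \<eta> \<eta>s V t0 F"
    and limit: "involutive_limit A g l c \<eta>s V t0 F"
    using asymp unfolding asymp_involutive_on_average_def by blast
  interpret approximating_flows "metric_coord A g c" "chart_image c" V l \<eta> \<eta>s t0 F
    by (rule approximating_flows_of_data[OF g data])
  have c: "c \<in> A" "p \<in> fst c" "snd c p \<in> V" and ker: "is_kernel_on A c \<eta> \<Delta>"
    using data by (auto simp: approximation_data_def local_defining_form_def)
  obtain i j where ij: "UNIV = {i, j, l}" "i \<noteq> l" "j \<noteq> l" by (rule card_2_or_3_indices[OF card])
  obtain r w w' where graph: "integral_graph l \<eta> (chart_image c) (snd c p) r w w'"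
    by (rule local_integral_graph[OF limit[unfolded involutive_limit_def] ij c(3)])
  show "\<exists>N. integral_manifold M A \<Delta> N \<and> p \<in> N"
    by (rule graph_integral_manifold[OF c(1,2) refl ker continuous_form limit_normalised graph]) blast+
qed

lemma (in manifold) unif_asymp_involutive_imp_uniquely_integrable:
  fixes l :: 'n
  assumes card: "CARD('n) = 2 \<or> CARD('n) = 3" and g: "riemannian_metric A g"
    and asymp: "unif_asymp_involutive_on_average M A g l \<Delta>"
  shows "uniquely_integrable_distribution M A \<Delta>"
  unfolding uniquely_integrable_distribution_def
proof (intro conjI ballI allI impI)
  have "asymp_involutive_on_average M A g l \<Delta>"
    using asymp unfolding unif_asymp_involutive_on_average_def asymp_involutive_on_average_def by blast
  then show "integrable_distribution M A \<Delta>" by (rule asymp_involutive_imp_integrable[OF card g])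
  fix p N N' assume p: "p \<in> topspace M"
    and "integral_manifold M A \<Delta> N \<and> p \<in> N \<and> integral_manifold M A \<Delta> N' \<and> p \<in> N'"
  then have N: "integral_manifold M A \<Delta> N" "p \<in> N" and N': "integral_manifold M A \<Delta> N'" "p \<in> N'" by auto
  obtain c \<eta> \<eta>s V t0 F where data: "approximation_data A g l \<Delta> p c \<eta> \<eta>s V t0 F"
    and limit: "uniform_approximation_limit A g l c \<eta> \<eta>s V t0 F"
    using asymp p unfolding unif_asymp_involutive_on_average_def by blast
  interpret approximating_flows "metric_coord A g c" "chart_image c" V l \<eta> \<eta>s t0 F
    by (rule approximating_flows_of_data[OF g data])
  have c: "c \<in> A" "p \<in> fst c" "snd c p \<in> V" and ker: "is_kernel_on A c \<eta> \<Delta>"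
    using data by (auto simp: approximation_data_def local_defining_form_def)
  obtain i j where ij: "UNIV = {i, j, l}" "i \<noteq> l" "j \<noteq> l" by (rule card_2_or_3_indices[OF card])
  define P where "P x = x - (x $ l) *\<^sub>R axis l 1" for x :: "real^'n"
  have Pl: "P x $ l = 0" for x by (simp add: P_def)
  have Pm: "P x $ m = x $ m" if "m \<noteq> l" for x m using that by (simp add: P_def axis_def)
  obtain U1 V1 g1 where U1: "open U1" "snd c p \<in> U1" "U1 \<subseteq> chart_image c"
    and V1: "open V1" "P (snd c p) \<in> V1" "continuous_on V1 g1" and g1: "g1 (P (snd c p)) = snd c p"
    and N1: "\<And>q. q \<in> fst c \<Longrightarrow> snd c q \<in> U1 \<Longrightarrow> q \<in> N \<longleftrightarrow> P (snd c q) \<in> V1 \<and> g1 (P (snd c q)) = snd c q"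
    and d1: "\<And>y i. y \<in> V1 \<Longrightarrow> y $ l = 0 \<Longrightarrow> i \<noteq> l \<Longrightarrow>
       ((\<lambda>h. g1 (y + h *\<^sub>R axis i 1)) has_vector_derivative limit_frame i (g1 y)) (at 0)"
    unfolding P_def by (rule integral_manifold_local_graph[OF c(1) N c(2) ker limit_normalised]) blast+
  obtain U2 V2 g2 where U2: "open U2" "snd c p \<in> U2" "U2 \<subseteq> chart_image c"
    and V2: "open V2" "P (snd c p) \<in> V2" "continuous_on V2 g2" and g2: "g2 (P (snd c p)) = snd c p"
    and N2: "\<And>q. q \<in> fst c \<Longrightarrow> snd c q \<in> U2 \<Longrightarrow> q \<in> N' \<longleftrightarrow> P (snd c q) \<in> V2 \<and> g2 (P (snd c q)) = snd c q"
    and d2: "\<And>y i. y \<in> V2 \<Longrightarrow> y $ l = 0 \<Longrightarrow> i \<noteq> l \<Longrightarrow>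
       ((\<lambda>h. g2 (y + h *\<^sub>R axis i 1)) has_vector_derivative limit_frame i (g2 y)) (at 0)"
    unfolding P_def by (rule integral_manifold_local_graph[OF c(1) N' c(2) ker limit_normalised]) blast+
  obtain r where r: "0 < r" and agree: "\<And>y. (\<And>m. m \<noteq> l \<Longrightarrow> \<bar>y $ m - P (snd c p) $ m\<bar> < r) \<Longrightarrow> y $ l = 0 \<Longrightarrow>
      y \<in> V1 \<and> y \<in> V2 \<and> g1 y = g2 y"
    by (rule integral_graphs_agree[OF limit[unfolded uniform_approximation_limit_def] ij c(3) Pl V1 g1 d1 V2 g2 d2]) blast+
  define T where "T = U1 \<inter> U2 \<inter> ball (snd c p) r"
  have "open T" using U1 U2 by (auto simp: T_def)
  define W where "W = {q \<in> fst c. snd c q \<in> T}"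
  have "openin M W" unfolding W_def by (rule openin_preimage[OF c(1) \<open>open T\<close>])
  moreover have "p \<in> W" using c U1 U2 r by (simp add: W_def T_def)
  moreover have "N \<inter> W = N' \<inter> W"
  proof -
    have "q \<in> N \<longleftrightarrow> q \<in> N'" if "q \<in> W" for q
    proof -
      have q: "q \<in> fst c" "snd c q \<in> U1" "snd c q \<in> U2" "dist (snd c p) (snd c q) < r"
        using that by (auto simp: W_def T_def)
      have "\<bar>P (snd c q) $ m - P (snd c p) $ m\<bar> < r" if "m \<noteq> l" for m
        using component_le_norm_cart[of "snd c q - snd c p" m] q(4) that
        by (simp add: Pm dist_norm norm_minus_commute)
      from agree[OF this Pl] show ?thesis using N1[OF q(1,2)] N2[OF q(1,3)] by simp
    qed
    then show ?thesis by blast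
  qed
  ultimately show "\<exists>W. openin M W \<and> p \<in> W \<and> N \<inter> W = N' \<inter> W" by blast
qed

theorem theorem1p5:
  fixes M :: "'a topology"
    and A :: "('a, 'n::finite) chart set"
    and g :: "'a \<Rightarrow> ('a, 'n) tvec \<Rightarrow> ('a, 'n) tvec \<Rightarrow> real"
    and \<Delta> :: "'a \<Rightarrow> ('a, 'n) tvec set"
    and l :: 'n
  assumes "CARD('n) = 2 \<or> CARD('n) = 3"
    and "smooth_manifold M A"
    and "riemannian_metric A g"
    and "continuous_corank1_distribution M A \<Delta>"
  shows "(asymp_involutive_on_average M A g l \<Delta> \<longrightarrow> integrable_distribution M A \<Delta>) \<and>
         (unif_asymp_involutive_on_average M A g l \<Delta> \<longrightarrow> uniquely_integrable_distribution M A \<Delta>)"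
proof -
  interpret manifold M A by unfold_locales (rule assms(2))
  show ?thesis
    using asymp_involutive_imp_integrable[OF assms(1,3)]
      unif_asymp_involutive_imp_uniquely_integrable[OF assms(1,3)] by blast
qed

end
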